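(* The Riccati equation $$P_t=e^{A^*(T-t)}Ge^{A(T-t)}+\int_t^T e^{A^*(s-t)}\Big[\sum_{i=1}^\infty C_i^*(s)P_sC_i(s)+Q_s-\lambda^*(s,P_s)\Lambda(s,P_s)\lambda(s,P_s)\Big]e^{A(s-t)}ds,\quad t\in[0,T],$$ has a unique solution $P\in C_s([0,T];\mathcal S^+(H))$ such that, for some constant $C>0$, $$\Big|\sum_{i=1}^\infty C_i^*(s)P_sC_i(s)\Big|_{\mathcal L(H)}\le C(T-s)^{-2\alpha},\quad s\in[0,T).$$
   Context: $H,U$ are (real) separable Hilbert spaces; $\mathcal L(\cdot,\cdot)$ denotes bounded linear operators; $\mathcal S(H)$ the self-adjoint bounded operators on $H$; $\mathcal S^+(H)$ the non-negative ones. $C_s([0,T];\mathcal S^+(H))$ is the set of strongly continuous maps $[0,T]\to\mathcal S^+(H)$. $T>0$; $A$ generates a strongly continuous semigroup $e^{tA}$ on $H$; $B\in L^\infty(0,T;\mathcal L(U,H))$, $C_j\in L^\infty(0,T;\mathcal L(H))$, $D_j\in L^\infty(0,T;\mathcal L(U,H))$ ($j\ge1$), $Q\in L^\infty(0,T;\mathcal S^+(H))$, $G\in\mathcal S^+(H)$, $R\in L^\infty(0,T;\mathcal S^+(U))$ with $R\ge\delta I_U$ for some $\delta>0$. Standing assumptions: for some $\alpha\in(0,\frac12)$ and $c>0$, $$\sum_{j=1}^\infty|e^{At}C_j(s)x|_H^2\le ct^{-2\alpha}|x|_H^2\ (t>0,\ s\in[0,T],\ x\in H),\qquad \sum_{j=1}^\infty|D_j(s)v|_H^2\le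 c|v|_U^2\ (v\in U,\ s\in[0,T]).$$ For $P\in\mathcal S^+(H)$ with $\sum_j\langle C_j^*(s)PC_j(s)x,x\rangle<\infty$ for all $x\in H$: $$\Lambda(s,P):=R_s+\sum_{i=1}^\infty D_i^*(s)PD_i(s)\ (\ge\delta I_U),\qquad \lambda(s,P):=-\Lambda(s,P)^{-1}\Big(B_s^*P+\sum_{i=1}^\infty D_i^*(s)PC_i(s)\Big),$$ where $\sum_iD_i^*(s)PC_i(s)$ converges strongly. $\sum_i C_i^*(s)PC_i(s)$ is defined through its quadratic form; operator integrals are understood in the weak/strong sense. Uniqueness is among solutions in $C_s([0,T];\mathcal S^+(H))$ satisfying an estimate of the displayed form (for some constant). *)

theory Defs
  imports "HOL-Analysis.Analysis"
begin

text \<open>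
  Real separable Hilbert spaces are types of sort
  \<open>{real_inner, banach, second_countable_topology}\<close>; for metric spaces, second countability
  is separability.  Sequences of operators indexed by \<open>i \<ge> 1\<close> in the mathematics are
  indexed by \<open>i :: nat\<close> starting from \<open>0\<close> here.
\<close>

definition op_adj ::
  "('a::{real_inner, banach, second_countable_topology}
      \<Rightarrow>\<^sub>L 'b::{real_inner, banach, second_countable_topology}) \<Rightarrow> ('b \<Rightarrow>\<^sub>L 'a)"
  where "op_adj F = Blinfun (adjoint (blinfun_apply F))"

definition nonneg_ops ::
  "('a::{real_inner, banach, second_countable_topology} \<Rightarrow>\<^sub>L 'a) set"
  where "nonneg_ops = {P. op_adj P = P \<and> (\<forall>x. 0 \<le> blinfun_apply P x \<bullet> x)}"

definition op_inverse ::
  "('a::real_normed_vector \<Rightarrow>\<^sub>L 'a) \<Rightarrow> ('a \<Rightarrow>\<^sub>L 'a)"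
  where "op_inverse L = (THE M. M o\<^sub>L L = id_blinfun \<and> L o\<^sub>L M = id_blinfun)"

text \<open>
  Sum of a series of operators in the strong operator topology.  If the series converges
  at every point, the limit is bounded by Banach--Steinhaus; otherwise the value is unspecified.
\<close>

definition strong_sum ::
  "(nat \<Rightarrow> 'a::real_normed_vector \<Rightarrow>\<^sub>L 'b::real_normed_vector) \<Rightarrow> ('a \<Rightarrow>\<^sub>L 'b)"
  where "strong_sum F = (THE M. \<forall>x. (\<lambda>i. blinfun_apply (F i) x) sums blinfun_apply M x)"

text \<open>
  Sum of a series of self-adjoint operators through its quadratic form: the self-adjoint
  operator whose quadratic form is the sum of the given ones.  It is unspecified unless
  \<open>form_summable\<close> holds.
\<close>

definition form_summable ::
  "(nat \<Rightarrow> 'a::{real_inner, banach, second_countable_topology} \<Rightarrow>\<^sub>L 'a) \<Rightarrow> bool"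
  where "form_summable F \<longleftrightarrow> (\<forall>x. summable (\<lambda>i. blinfun_apply (F i) x \<bullet> x))"

definition form_sum ::
  "(nat \<Rightarrow> 'a::{real_inner, banach, second_countable_topology} \<Rightarrow>\<^sub>L 'a) \<Rightarrow> ('a \<Rightarrow>\<^sub>L 'a)"
  where "form_sum F =
    (THE M. op_adj M = M \<and>
       (\<forall>x. (\<lambda>i. blinfun_apply (F i) x \<bullet> x) sums (blinfun_apply M x \<bullet> x)))"

text \<open>
  Strongly continuous semigroups; only times \<open>t \<ge> 0\<close> matter.  The generator is an unbounded
  operator, represented by its graph.
\<close>

definition C0_semigroup :: "(real \<Rightarrow> 'a::real_normed_vector \<Rightarrow>\<^sub>L 'a) \<Rightarrow> bool"
  where "C0_semigroup S \<longleftrightarrow>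
    S 0 = id_blinfun \<and>
    (\<forall>s\<ge>0. \<forall>t\<ge>0. S (s + t) = S s o\<^sub>L S t) \<and>
    (\<forall>x. continuous_on {0..} (\<lambda>t. blinfun_apply (S t) x))"

definition generator :: "(real \<Rightarrow> 'a::real_normed_vector \<Rightarrow>\<^sub>L 'a) \<Rightarrow> ('a \<times> 'a) set"
  where "generator S =
    {(x, y). ((\<lambda>t. (1 / t) *\<^sub>R (blinfun_apply (S t) x - x)) \<longlongrightarrow> y) (at_right 0)}"

definition generates ::
  "('a::real_normed_vector \<times> 'a) set \<Rightarrow> (real \<Rightarrow> 'a \<Rightarrow>\<^sub>L 'a) \<Rightarrow> bool"
  where "generates A S \<longleftrightarrow> C0_semigroup S \<and> A = generator S"

text \<open>
  \<open>L\<^sup>\<infinity>(0,T;X)\<close> for a set \<open>X\<close> of operators.  Measurability is that of \<open>s \<mapsto> F(s)x\<close> for every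
  \<open>x\<close>, which is weaker than Bochner measurability in operator norm; membership in \<open>X\<close> and
  boundedness hold almost everywhere.
\<close>

definition Linf_ops ::
  "real \<Rightarrow> ('a::real_normed_vector \<Rightarrow>\<^sub>L 'b::real_normed_vector) set \<Rightarrow> (real \<Rightarrow> 'a \<Rightarrow>\<^sub>L 'b) set"
  where "Linf_ops T X =
    {F. (\<forall>x. (\<lambda>s. blinfun_apply (F s) x) \<in> borel_measurable (lebesgue_on {0..T})) \<and>
        (\<exists>M. AE s in lebesgue_on {0..T}. norm (F s) \<le> M) \<and>
        (AE s in lebesgue_on {0..T}. F s \<in> X)}"

text \<open>
  \<open>C\<^sub>s([0,T];S\<^sup>+(H))\<close>.  The extensional function space makes an element determined by its
  values on \<open>[0,T]\<close>, so that unique existence has its usual meaning.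
\<close>

definition Cs_nonneg ::
  "real \<Rightarrow> (real \<Rightarrow> 'a::{real_inner, banach, second_countable_topology} \<Rightarrow>\<^sub>L 'a) set"
  where "Cs_nonneg T =
    {P \<in> {0..T} \<rightarrow>\<^sub>E nonneg_ops. \<forall>x. continuous_on {0..T} (\<lambda>t. blinfun_apply (P t) x)}"

definition CPC ::
  "(nat \<Rightarrow> real \<Rightarrow> 'h::{real_inner, banach, second_countable_topology} \<Rightarrow>\<^sub>L 'h)
    \<Rightarrow> real \<Rightarrow> ('h \<Rightarrow>\<^sub>L 'h) \<Rightarrow> nat \<Rightarrow> ('h \<Rightarrow>\<^sub>L 'h)"
  where "CPC C s P i = op_adj (C i s) o\<^sub>L P o\<^sub>L C i s"

definition Lambda_op ::
  "(real \<Rightarrow> 'u::{real_inner, banach, second_countable_topology} \<Rightarrow>\<^sub>L 'u)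
    \<Rightarrow> (nat \<Rightarrow> real \<Rightarrow> 'u \<Rightarrow>\<^sub>L 'h::{real_inner, banach, second_countable_topology})
    \<Rightarrow> real \<Rightarrow> ('h \<Rightarrow>\<^sub>L 'h) \<Rightarrow> ('u \<Rightarrow>\<^sub>L 'u)"
  where "Lambda_op R D s P = R s + strong_sum (\<lambda>i. op_adj (D i s) o\<^sub>L P o\<^sub>L D i s)"

definition lambda_op ::
  "(real \<Rightarrow> 'u::{real_inner, banach, second_countable_topology}
        \<Rightarrow>\<^sub>L 'h::{real_inner, banach, second_countable_topology})
    \<Rightarrow> (nat \<Rightarrow> real \<Rightarrow> 'h \<Rightarrow>\<^sub>L 'h) \<Rightarrow> (nat \<Rightarrow> real \<Rightarrow> 'u \<Rightarrow>\<^sub>L 'h) \<Rightarrow> (real \<Rightarrow> 'u \<Rightarrow>\<^sub>L 'u)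
    \<Rightarrow> real \<Rightarrow> ('h \<Rightarrow>\<^sub>L 'h) \<Rightarrow> ('h \<Rightarrow>\<^sub>L 'u)"
  where "lambda_op B C D R s P =
    - (op_inverse (Lambda_op R D s P) o\<^sub>L
        ((op_adj (B s) o\<^sub>L P) + strong_sum (\<lambda>i. op_adj (D i s) o\<^sub>L P o\<^sub>L C i s)))"

definition riccati_bracket ::
  "(real \<Rightarrow> 'u::{real_inner, banach, second_countable_topology}
        \<Rightarrow>\<^sub>L 'h::{real_inner, banach, second_countable_topology})
    \<Rightarrow> (nat \<Rightarrow> real \<Rightarrow> 'h \<Rightarrow>\<^sub>L 'h) \<Rightarrow> (nat \<Rightarrow> real \<Rightarrow> 'u \<Rightarrow>\<^sub>L 'h)
    \<Rightarrow> (real \<Rightarrow> 'h \<Rightarrow>\<^sub>L 'h) \<Rightarrow> (real \<Rightarrow> 'u \<Rightarrow>\<^sub>L 'u)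
    \<Rightarrow> real \<Rightarrow> ('h \<Rightarrow>\<^sub>L 'h) \<Rightarrow> ('h \<Rightarrow>\<^sub>L 'h)"
  where "riccati_bracket B C D Q R s P =
    form_sum (CPC C s P) + Q s -
    (op_adj (lambda_op B C D R s P) o\<^sub>L Lambda_op R D s P o\<^sub>L lambda_op B C D R s P)"

text \<open>
  The Riccati equation with the operator integral in the strong sense: for every \<open>x\<close> the
  integrand applied to \<open>x\<close> is Bochner integrable.  Here \<open>S t\<close> is \<open>e\<^sup>t\<^sup>A\<close>, and the semigroup
  generated by the adjoint of \<open>A\<close> is written as the adjoint semigroup.
\<close>

definition riccati_solution ::
  "real \<Rightarrow> (real \<Rightarrow> 'h::{real_inner, banach, second_countable_topology} \<Rightarrow>\<^sub>L 'h)
    \<Rightarrow> (real \<Rightarrow> 'u::{real_inner, banach, second_countable_topology} \<Rightarrow>\<^sub>L 'h)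
    \<Rightarrow> (nat \<Rightarrow> real \<Rightarrow> 'h \<Rightarrow>\<^sub>L 'h) \<Rightarrow> (nat \<Rightarrow> real \<Rightarrow> 'u \<Rightarrow>\<^sub>L 'h)
    \<Rightarrow> (real \<Rightarrow> 'h \<Rightarrow>\<^sub>L 'h) \<Rightarrow> (real \<Rightarrow> 'u \<Rightarrow>\<^sub>L 'u) \<Rightarrow> ('h \<Rightarrow>\<^sub>L 'h)
    \<Rightarrow> (real \<Rightarrow> 'h \<Rightarrow>\<^sub>L 'h) \<Rightarrow> bool"
  where "riccati_solution T S B C D Q R G P \<longleftrightarrow>
    (\<forall>t\<in>{0..T}. \<forall>x.
      (let F = (\<lambda>s. blinfun_apply
                 (op_adj (S (s - t)) o\<^sub>L riccati_bracket B C D Q R s (P s) o\<^sub>L S (s - t)) x)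
       in integrable (lebesgue_on {t..T}) F \<and>
          blinfun_apply (P t) x =
            blinfun_apply (op_adj (S (T - t)) o\<^sub>L G o\<^sub>L S (T - t)) x +
            integral\<^sup>L (lebesgue_on {t..T}) F))"

definition riccati_estimate ::
  "real \<Rightarrow> real \<Rightarrow> (nat \<Rightarrow> real \<Rightarrow> 'h::{real_inner, banach, second_countable_topology} \<Rightarrow>\<^sub>L 'h)
    \<Rightarrow> (real \<Rightarrow> 'h \<Rightarrow>\<^sub>L 'h) \<Rightarrow> real \<Rightarrow> bool"
  where "riccati_estimate T \<alpha> C P K \<longleftrightarrow>
    (\<forall>s\<in>{0..<T}. form_summable (CPC C s (P s)) \<and>
       norm (form_sum (CPC C s (P s))) \<le> K * (T - s) powr (- 2 * \<alpha>))"

end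

theory Submission
  imports Defs
begin

text \<open>
  For almost every \<open>s\<close> the quadratic form of the bracket at \<open>P\<close> is the minimum over \<open>v\<close> of
  \<open>\<Sum>\<^sub>i \<langle>P(C\<^sub>ix + D\<^sub>iv), C\<^sub>ix + D\<^sub>iv\<rangle> + \<langle>Rv,v\<rangle> + \<langle>Qx,x\<rangle> + 2\<langle>Bv,Px\<rangle>\<close>.  Its value at \<open>v = 0\<close> bounds it from
  above by the uncontrolled Lyapunov bracket; completing the square shows that it becomes nonnegative
  after adding \<open>\<mu>P\<close> for \<open>\<mu>\<close> large; inserting the minimiser of one operator into the cost of another
  gives a Lipschitz estimate; and as an infimum over a countable dense set of \<open>v\<close> it is measurable.

  Shifting the equation by \<open>\<mu>\<close> (which replaces \<open>e\<^bsup>tA\<^esup>\<close> by \<open>e\<^bsup>-\<mu>t/2\<^esup>e\<^bsup>tA\<^esup>\<close>) therefore yields a map that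
  preserves the set of nonnegative \<open>P\<close> lying below a supersolution of the Lyapunov equation.  Distances are
  measured by the least \<open>a\<close> with \<open>\<bar>\<langle>(P\<^sub>t - P'\<^sub>t)y,y\<rangle>\<bar> \<le> a W\<^sub>t(y)\<close>, where
  \<open>W\<^sub>t(y) = \<integral>\<^sub>t\<^sup>T (T-r)\<^bsup>-2\<alpha>\<^esup> e\<^bsup>\<nu>(T-r)\<^esup> |e\<^bsup>(r-t)A\<^esup>y|\<^sup>2 dr\<close>.  The hypothesis on \<open>C\<^sub>i\<close> controls
  \<open>\<Sum>\<^sub>i W\<^sub>s(C\<^sub>ix)\<close> by a weakly singular Volterra kernel, which is a contraction for \<open>\<nu>\<close> large.  Uniqueness
  is the same contraction with \<open>\<mu> = 0\<close>.
\<close>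

section \<open>Operators on Hilbert spaces\<close>

text \<open>Square summability is assumed of \<open>S t (C j s x)\<close> for t > 0, not of
  \<open>C j s x\<close>. A bound on the norm of P therefore says nothing about the sum of the forms
  of P at the vectors C_i x: bounds on P, and on the difference of two P's, have to be functionals
  in which y enters through the semigroup. \<open>W\<close> and the supersolution \<open>U\<close>
  are of this kind. As \<open>W\<close> vanishes at t = T, two operator functions can be compared
  only if they agree there. After one application of the map they do: the terminal terms cancel, and
  all brackets are of order (T-s)^(-2\<alpha>), which is the origin of that factor in
  \<open>W\<close>. The shift is not circular: \<mu> depends on a norm bound read off from
  \<open>U\<close>, and \<open>U\<close> itself does not depend on \<mu>. Since this bound holds on
  all of [0,T], one fixed point argument covers the whole interval, without continuation in time.
  Positivity of the images serves only to iterate the map; a given solution is already nonnegative,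
  which is why uniqueness can be run with \<mu> = 0.\<close>

lemma quadratic_nonneg_imp_linear_coeff_0:
  fixes p q :: real
  assumes "\<And>t. 0 \<le> t\<^sup>2 * p + 2 * t * q" and "0 \<le> p"
  shows "q = 0"
proof (rule ccontr)
  assume q: "q \<noteq> 0"
  \<comment> \<open>The minimiser would be -q/p; with p + 1 in the denominator the value is still
    negative and p = 0 needs no separate case.\<close>
  have "0 \<le> (- q / (p + 1))\<^sup>2 * p + 2 * (- q / (p + 1)) * q"
    by (rule assms)
  also have "\<dots> = q\<^sup>2 * (- p - 2) / (p + 1)\<^sup>2"
    using assms(2) by (simp add: divide_simps) (simp add: power2_eq_square algebra_simps)
  also have "\<dots> < 0"
    using q assms(2) by (intro divide_neg_pos mult_pos_neg) auto
  finally show False by simp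
qed

text \<open>Lax-Milgram for a symmetric coercive form, by minimising \<open>J\<close> over
  \<open>V\<close>: minimising sequences are Cauchy and the minimiser satisfies the Euler equation.
  With both \<open>A\<close> and \<open>V\<close> general, one proof yields the Riesz theorem
  (\<open>A\<close> the identity, \<open>V\<close> the whole space), the inverse of a coercive
  operator, and the projection onto a closed subspace.\<close>

lemma coercive_form_represents:
  fixes A :: "'a::{real_inner, banach} \<Rightarrow>\<^sub>L 'a" and f :: "'a \<Rightarrow> real"
  assumes sym: "\<And>x y. A x \<bullet> y = x \<bullet> A y"
    and coer: "\<And>x. d * (norm x)\<^sup>2 \<le> A x \<bullet> x" and d: "d > 0"
    and f: "bounded_linear f" and V: "subspace V" "closed V"
  obtains z where "z \<in> V" "\<And>y. y \<in> V \<Longrightarrow> A z \<bullet> y = f y"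
proof -
  interpret f: bounded_linear f by fact
  define J where "J x = A x \<bullet> x - 2 * f x" for x
  obtain F where F: "F > 0" "\<And>x. norm (f x) \<le> norm x * F"
    using f.pos_bounded by blast
  have lower: "- F\<^sup>2 / d \<le> J x" for x
  proof -
    have "0 \<le> (d * norm x - F)\<^sup>2 / d" using d by simp
    also have "\<dots> = d * (norm x)\<^sup>2 - 2 * (norm x * F) + F\<^sup>2 / d"
      using d by (simp add: power2_eq_square field_simps)
    also have "\<dots> \<le> J x + F\<^sup>2 / d"
      using coer[of x] F(2)[of x] by (auto simp: J_def)
    finally show ?thesis by simp
  qed
  define m where "m = Inf (J ` V)"
  have V0: "0 \<in> V" using V by (simp add: subspace_0)
  have bdd: "bdd_below (J ` V)" using lower by (rule bdd_belowI2)
  have m_le: "m \<le> J x" if "x \<in> V" for x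
    unfolding m_def using that bdd by (auto intro: cInf_lower)
  have "\<exists>x\<in>V. J x < m + 1 / real (Suc n)" for n
    using cInf_lessD[of "J ` V" "m + 1 / real (Suc n)"] V0 by (auto simp: m_def)
  then obtain x where xV: "\<And>n. x n \<in> V" and xJ: "\<And>n. J (x n) < m + 1 / real (Suc n)"
    by metis
  \<comment> \<open>Parallelogram identity for the form of \<open>A\<close>: the midpoint lies in
    \<open>V\<close>, so its value is at least \<open>m\<close>, and near-minimisers are close to
    each other.\<close>
  have par: "d / 2 * (norm (u - v))\<^sup>2 \<le> J u + J v - 2 * m" if "u \<in> V" "v \<in> V" for u v
  proof -
    have "d / 2 * (norm (u - v))\<^sup>2 \<le> A (u - v) \<bullet> (u - v) / 2"
      using coer[of "u - v"] by simp
    also have "\<dots> = J u + J v - 2 * J ((1/2) *\<^sub>R (u + v))"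
      unfolding J_def using sym[of v u]
      by (simp add: blinfun.bilinear_simps inner_simps f.add f.diff f.scaleR inner_commute field_simps)
    also have "\<dots> \<le> J u + J v - 2 * m"
      using that V m_le[of "(1/2) *\<^sub>R (u + v)"] by (auto intro: subspace_add subspace_scale)
    finally show ?thesis by simp
  qed
  have "Cauchy x"
  proof (rule metric_CauchyI)
    fix e :: real assume e: "e > 0"
    obtain N where N: "inverse (real (Suc N)) < d * e\<^sup>2 / 4"
      using reals_Archimedean[of "d * e\<^sup>2 / 4"] e d by auto
    show "\<exists>M. \<forall>i\<ge>M. \<forall>j\<ge>M. dist (x i) (x j) < e"
    proof (intro exI allI impI)
      fix i j assume "N \<le> i" "N \<le> j"
      then have "1 / real (Suc i) \<le> inverse (real (Suc N))" "1 / real (Suc j) \<le> inverse (real (Suc N))"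
        by (auto simp: divide_simps)
      then have "d / 2 * (norm (x i - x j))\<^sup>2 < d / 2 * e\<^sup>2"
        using par[OF xV xV, of i j] xJ[of i] xJ[of j] N by linarith
      then have "(norm (x i - x j))\<^sup>2 < e\<^sup>2" using d by simp
      then show "dist (x i) (x j) < e"
        using e by (simp add: dist_norm power2_less_imp_less)
    qed
  qed
  then obtain z where z: "x \<longlonglongrightarrow> z" using Cauchy_convergent convergent_def by blast
  have zV: "z \<in> V" using V(2) xV z closed_sequentially by blast
  have "(\<lambda>n. J (x n)) \<longlonglongrightarrow> J z"
    unfolding J_def by (intro tendsto_intros z f.tendsto)
  moreover have "(\<lambda>n. m + 1 / real (Suc n)) \<longlonglongrightarrow> m + 0"
    by (intro tendsto_intros LIMSEQ_Suc lim_1_over_n)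
  ultimately have "J z \<le> m + 0"
    using xJ by (intro LIMSEQ_le) (auto intro: less_imp_le)
  then have Jz: "J z \<le> J y" if "y \<in> V" for y using m_le[OF that] by simp
  have "A z \<bullet> y = f y" if y: "y \<in> V" for y
  proof -
    \<comment> \<open>First variation: along \<open>z + t y\<close> the increment of
      \<open>J\<close> is a quadratic in t whose linear coefficient is twice this quantity.\<close>
    have "A z \<bullet> y - f y = 0"
    proof (rule quadratic_nonneg_imp_linear_coeff_0)
      show "0 \<le> A y \<bullet> y" using coer[of y] d by (meson mult_nonneg_nonneg less_imp_le order_trans zero_le_power2)
      fix t
      have "J z \<le> J (z + t *\<^sub>R y)" using V y zV by (intro Jz) (auto intro: subspace_add subspace_scale)
      also have "\<dots> = J z + (t\<^sup>2 * (A y \<bullet> y) + 2 * t * (A z \<bullet> y - f y))"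
        unfolding J_def using sym[of y z]
        by (simp add: blinfun.bilinear_simps inner_simps f.add f.diff f.scaleR inner_commute
            power2_eq_square algebra_simps)
      finally show "0 \<le> t\<^sup>2 * (A y \<bullet> y) + 2 * t * (A z \<bullet> y - f y)" by simp
    qed
    then show ?thesis by simp
  qed
  with zV show thesis using that by blast
qed

lemma riesz_representation:
  fixes f :: "'a::{real_inner, banach} \<Rightarrow> real"
  assumes "bounded_linear f"
  obtains z where "\<And>y. f y = z \<bullet> y"
proof -
  have "\<And>x y :: 'a. id_blinfun x \<bullet> y = x \<bullet> id_blinfun y"
    and "\<And>x :: 'a. 1 * (norm x)\<^sup>2 \<le> id_blinfun x \<bullet> x"
    by (simp_all add: power2_norm_eq_inner)
  then obtain z where "\<And>y. y \<in> UNIV \<Longrightarrow> id_blinfun z \<bullet> y = f y"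
    using coercive_form_represents[OF _ _ zero_less_one assms, of id_blinfun UNIV] by auto
  then show thesis using that[of z] by simp
qed

text \<open>Riesz in the first argument, for each \<open>y\<close> separately; linearity of the
  representing map follows from uniqueness. Adjoints and form sums are produced from their forms by
  this lemma.\<close>

lemma bounded_form_represents:
  fixes b :: "'a::{real_inner, banach} \<Rightarrow> 'b::real_normed_vector \<Rightarrow> real"
  assumes lin1: "\<And>y. linear (\<lambda>x. b x y)" and lin2: "\<And>x. linear (b x)"
    and bd: "\<And>x y. \<bar>b x y\<bar> \<le> K * norm x * norm y"
  obtains M :: "'b \<Rightarrow>\<^sub>L 'a" where "\<And>x y. b x y = x \<bullet> M y" "norm M \<le> \<bar>K\<bar>"
proof -
  have "\<exists>z. \<forall>x. b x y = x \<bullet> z" for y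
  proof -
    have "bounded_linear (\<lambda>x. b x y)"
      using lin1[of y] bd[of _ y]
      by (intro bounded_linear_intro[where K="K * norm y"])
         (auto simp: linear_add[OF lin1] linear_cmul[OF lin1] mult_ac)
    then obtain z where "\<And>x. b x y = z \<bullet> x" by (rule riesz_representation) blast
    then show ?thesis by (auto simp: inner_commute)
  qed
  then obtain m where m: "\<And>x y. b x y = x \<bullet> m y" by metis
  have bm: "norm (m y) \<le> \<bar>K\<bar> * norm y" for y
  proof (cases "m y = 0")
    case False
    have "norm (m y) * norm (m y) = b (m y) y"
      by (simp add: m power2_norm_eq_inner flip: power2_eq_square)
    also have "\<dots> \<le> \<bar>K\<bar> * norm (m y) * norm y"
      using bd[of "m y" y] by (smt (verit) abs_ge_self mult_right_mono norm_ge_zero)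
    finally show ?thesis using False by (simp add: mult.commute mult.left_commute)
  qed simp
  have "bounded_linear m"
  proof (rule bounded_linear_intro)
    show "m (x + y) = m x + m y" for x y
      by (subst vector_eq_ldot[symmetric]) (simp add: m[symmetric] inner_add_right linear_add[OF lin2])
    show "m (r *\<^sub>R x) = r *\<^sub>R m x" for r x
      by (subst vector_eq_ldot[symmetric]) (simp add: m[symmetric] linear_cmul[OF lin2])
    show "norm (m y) \<le> norm y * \<bar>K\<bar>" for y using bm[of y] by (simp add: mult.commute)
  qed
  then have "blinfun_apply (Blinfun m) = m" by (rule bounded_linear_Blinfun_apply)
  then show thesis using that[of "Blinfun m"] m bm norm_blinfun_bound[of "\<bar>K\<bar>" "Blinfun m"] by auto
qed


text \<open>By homogeneity only unit vectors matter, and there the assumed bound is k. Polarisation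
  and Young's inequality give bounds by sums of squares; this converts them into product
  bounds.\<close>

lemma bilinear_bound_homogeneous:
  fixes b :: "'a::real_normed_vector \<Rightarrow> 'b::real_normed_vector \<Rightarrow> real"
  assumes lin1: "\<And>y. linear (\<lambda>x. b x y)" and lin2: "\<And>x. linear (b x)"
    and bd: "\<And>x y. \<bar>b x y\<bar> \<le> k / 2 * ((norm x)\<^sup>2 + (norm y)\<^sup>2)"
  shows "\<bar>b x y\<bar> \<le> k * norm x * norm y"
proof (cases "x = 0 \<or> y = 0")
  case True
  then show ?thesis using linear_0[OF lin1, of y] linear_0[OF lin2, of x] by auto
next
  case False
  define u v where "u = x /\<^sub>R norm x" and "v = y /\<^sub>R norm y"
  have xy: "x = norm x *\<^sub>R u" "y = norm y *\<^sub>R v" using False by (auto simp: u_def v_def)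
  have "b x y = b (norm x *\<^sub>R u) (norm y *\<^sub>R v)" using xy by simp
  also have "\<dots> = norm x * norm y * b u v"
    by (simp add: linear_cmul[OF lin1] linear_cmul[OF lin2])
  finally have "\<bar>b x y\<bar> = norm x * norm y * \<bar>b u v\<bar>"
    by (simp add: abs_mult)
  also have "\<dots> \<le> norm x * norm y * k"
    using bd[of u v] False by (intro mult_left_mono) (simp_all add: u_def v_def)
  finally show ?thesis by (simp add: mult_ac)
qed

text \<open>\<open>op_adj\<close> wraps \<open>adjoint\<close>, which is a choice among maps with
  this property, so the identity is available only once a bounded adjoint is known to exist; the
  Riesz theorem provides it.\<close>

lemma inner_op_adj: "F x \<bullet> y = x \<bullet> op_adj F y"
  for F :: "'a::{real_inner, banach, second_countable_topology} \<Rightarrow>\<^sub>L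
    'b::{real_inner, banach, second_countable_topology}"
proof -
  obtain M :: "'b \<Rightarrow>\<^sub>L 'a" where M: "\<And>x y. F x \<bullet> y = x \<bullet> M y"
  proof (rule bounded_form_represents[of "\<lambda>x y. F x \<bullet> y" "norm F"])
    show "linear (\<lambda>x. F x \<bullet> y)" for y
      by (rule linearI) (simp_all add: blinfun.bilinear_simps inner_simps)
    show "linear ((\<bullet>) (F x))" for x by (rule linearI) (simp_all add: inner_simps)
    show "\<bar>F x \<bullet> y\<bar> \<le> norm F * norm x * norm y" for x y
      by (rule order_trans[OF Cauchy_Schwarz_ineq2]) (simp add: mult_right_mono norm_blinfun)
  qed blast
  have "adjoint F = M" by (rule adjoint_unique) (simp add: M)
  then have "op_adj F = M" by (simp add: op_adj_def blinfun_apply_inverse)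
  then show ?thesis using M by simp
qed

lemma inner_op_adj': "op_adj F y \<bullet> x = y \<bullet> F x"
  for F :: "'a::{real_inner, banach, second_countable_topology} \<Rightarrow>\<^sub>L
    'b::{real_inner, banach, second_countable_topology}"
  by (metis inner_op_adj inner_commute)

lemma op_adj_eqI: "(\<And>x y. F x \<bullet> y = x \<bullet> G y) \<Longrightarrow> op_adj F = G"
  for F :: "'a::{real_inner, banach, second_countable_topology} \<Rightarrow>\<^sub>L
    'b::{real_inner, banach, second_countable_topology}" and G :: "'b \<Rightarrow>\<^sub>L 'a"
  by (intro blinfun_eqI) (metis inner_op_adj vector_eq_ldot)

lemma norm_op_adj_le: "norm (op_adj F y) \<le> norm F * norm y"
  for F :: "'a::{real_inner, banach, second_countable_topology} \<Rightarrow>\<^sub>L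
    'b::{real_inner, banach, second_countable_topology}"
proof (cases "op_adj F y = 0")
  case False
  have "norm (op_adj F y) * norm (op_adj F y) = F (op_adj F y) \<bullet> y"
    by (simp add: inner_op_adj power2_norm_eq_inner flip: power2_eq_square)
  also have "\<dots> \<le> norm (F (op_adj F y)) * norm y" by (rule norm_cauchy_schwarz)
  also have "\<dots> \<le> norm F * norm (op_adj F y) * norm y"
    by (simp add: mult_right_mono norm_blinfun)
  finally show ?thesis using False by (simp add: mult_ac)
qed simp

section \<open>Self-adjoint and nonnegative operators through their quadratic forms\<close>

lemma selfadj_inner: "op_adj M = M \<Longrightarrow> M x \<bullet> y = x \<bullet> M y"
  for M :: "'a::{real_inner, banach, second_countable_topology} \<Rightarrow>\<^sub>L 'a"
  by (metis inner_op_adj)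

lemma selfadj_polarization:
  fixes M :: "'a::{real_inner, banach, second_countable_topology} \<Rightarrow>\<^sub>L 'a"
  assumes "op_adj M = M"
  shows "4 * (M x \<bullet> y) = M (x + y) \<bullet> (x + y) - M (x - y) \<bullet> (x - y)"
  using selfadj_inner[OF assms, of x y]
  by (simp add: blinfun.bilinear_simps inner_simps inner_commute)

text \<open>Polarisation. Together with \<open>selfadj_norm_le\<close> it allows the later sections
  to identify and estimate operators through quadratic forms alone.\<close>

lemma selfadj_eqI:
  fixes M N :: "'a::{real_inner, banach, second_countable_topology} \<Rightarrow>\<^sub>L 'a"
  assumes "op_adj M = M" "op_adj N = N" "\<And>x. M x \<bullet> x = N x \<bullet> x"
  shows "M = N"
proof (rule blinfun_eqI)
  fix x
  have "M x \<bullet> y = N x \<bullet> y" for y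
    using selfadj_polarization[OF assms(1), of x y] selfadj_polarization[OF assms(2), of x y] assms(3)
    by simp
  then show "M x = N x" by (metis inner_commute vector_eq_ldot)
qed

text \<open>Polarisation reduces the left side to the forms at x + y and x - y, whose squared norms
  add up by the parallelogram law.\<close>

lemma selfadj_form_bound:
  fixes M :: "'a::{real_inner, banach, second_countable_topology} \<Rightarrow>\<^sub>L 'a"
  assumes "op_adj M = M" "\<And>x. \<bar>M x \<bullet> x\<bar> \<le> m * (norm x)\<^sup>2"
  shows "\<bar>M x \<bullet> y\<bar> \<le> m / 2 * ((norm x)\<^sup>2 + (norm y)\<^sup>2)"
proof -
  have par: "(norm (x + y))\<^sup>2 + (norm (x - y))\<^sup>2 = 2 * ((norm x)\<^sup>2 + (norm y)\<^sup>2)"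
    by (simp add: power2_norm_eq_inner inner_simps inner_commute)
  have "m * (norm (x + y))\<^sup>2 + m * (norm (x - y))\<^sup>2 = m * (2 * ((norm x)\<^sup>2 + (norm y)\<^sup>2))"
    unfolding par[symmetric] by (rule distrib_left[symmetric])
  also have "\<dots> = 4 * (m / 2 * ((norm x)\<^sup>2 + (norm y)\<^sup>2))" by simp
  finally show ?thesis
    using selfadj_polarization[OF assms(1), of x y] assms(2)[of "x + y"] assms(2)[of "x - y"] by linarith
qed

text \<open>The numerical radius controls the norm: the bilinear bound obtained by polarisation is
  tested with \<open>y = M x\<close>.\<close>

lemma selfadj_norm_le:
  fixes M :: "'a::{real_inner, banach, second_countable_topology} \<Rightarrow>\<^sub>L 'a"
  assumes "op_adj M = M" "\<And>x. \<bar>M x \<bullet> x\<bar> \<le> m * (norm x)\<^sup>2" "0 \<le> m"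
  shows "norm M \<le> m"
proof (rule norm_blinfun_bound)
  fix x
  have "\<bar>M x \<bullet> y\<bar> \<le> m * norm x * norm y" for y
    using selfadj_form_bound[OF assms(1,2)]
    by (intro bilinear_bound_homogeneous) (auto intro!: linearI simp: blinfun.bilinear_simps inner_simps)
  from this[of "M x"] have "norm (M x) * norm (M x) \<le> m * norm x * norm (M x)"
    by (simp add: power2_norm_eq_inner flip: power2_eq_square)
  then show "norm (M x) \<le> m * norm x"
    using assms(3) by (cases "M x = 0") auto
qed fact

lemma form_le_norm: "\<bar>M x \<bullet> x\<bar> \<le> norm M * (norm x)\<^sup>2"
  for M :: "'a::real_inner \<Rightarrow>\<^sub>L 'a"
proof -
  have "\<bar>M x \<bullet> x\<bar> \<le> norm (M x) * norm x" by (rule Cauchy_Schwarz_ineq2)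
  also have "\<dots> \<le> norm M * norm x * norm x" by (simp add: mult_right_mono norm_blinfun)
  finally show ?thesis by (simp add: power2_eq_square)
qed

lemma nonneg_opsD:
  fixes P :: "'a::{real_inner, banach, second_countable_topology} \<Rightarrow>\<^sub>L 'a"
  assumes "P \<in> nonneg_ops"
  shows "op_adj P = P" "0 \<le> P x \<bullet> x" "P x \<bullet> y = x \<bullet> P y"
  using assms selfadj_inner by (auto simp: nonneg_ops_def)

text \<open>Expand the nonnegative form of \<open>P\<close> at \<open>k x - y\<close> and
  \<open>k x + y\<close>. This additive version of Cauchy-Schwarz can be summed term by term over an
  operator series.\<close>

lemma nonneg_ops_young:
  fixes P :: "'a::{real_inner, banach, second_countable_topology} \<Rightarrow>\<^sub>L 'a"
  assumes P: "P \<in> nonneg_ops" and k: "k > 0"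
  shows "2 * \<bar>P x \<bullet> y\<bar> \<le> k * (P x \<bullet> x) + (P y \<bullet> y) / k"
proof -
  have "0 \<le> P (k *\<^sub>R x - y) \<bullet> (k *\<^sub>R x - y)" "0 \<le> P (k *\<^sub>R x + y) \<bullet> (k *\<^sub>R x + y)"
    using P by (simp_all only: nonneg_opsD(2))
  moreover have "P y \<bullet> x = P x \<bullet> y" using nonneg_opsD(3)[OF P, of y x] by (simp add: inner_commute)
  then have "P (k *\<^sub>R x - y) \<bullet> (k *\<^sub>R x - y) = k\<^sup>2 * (P x \<bullet> x) - 2 * k * (P x \<bullet> y) + P y \<bullet> y"
      and "P (k *\<^sub>R x + y) \<bullet> (k *\<^sub>R x + y) = k\<^sup>2 * (P x \<bullet> x) + 2 * k * (P x \<bullet> y) + P y \<bullet> y"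
    by (simp_all add: blinfun.bilinear_simps inner_simps power2_eq_square algebra_simps)
  ultimately have "\<bar>2 * k * (P x \<bullet> y)\<bar> \<le> k\<^sup>2 * (P x \<bullet> x) + P y \<bullet> y" by linarith
  then have "2 * k * \<bar>P x \<bullet> y\<bar> \<le> k\<^sup>2 * (P x \<bullet> x) + P y \<bullet> y"
    using k by (simp add: abs_mult)
  then have "k * (2 * \<bar>P x \<bullet> y\<bar>) \<le> k * (k * (P x \<bullet> x) + (P y \<bullet> y) / k)"
    using k by (simp add: algebra_simps power2_eq_square)
  then show ?thesis using k by (simp del: distrib_left)
qed

lemma nonneg_ops_add_le:
  fixes P :: "'a::{real_inner, banach, second_countable_topology} \<Rightarrow>\<^sub>L 'a"
  assumes P: "P \<in> nonneg_ops"
  shows "P (x + y) \<bullet> (x + y) \<le> 2 * (P x \<bullet> x) + 2 * (P y \<bullet> y)"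
  using nonneg_ops_young[OF P, of 1 x y] nonneg_opsD(3)[OF P, of x y]
  by (simp add: blinfun.bilinear_simps inner_simps inner_commute)

text \<open>Young's inequality with \<open>y = P x\<close> and weight \<open>b\<close>, the form at
  \<open>P x\<close> being absorbed on the left. It is what allows a multiple of \<open>P\<close> to
  dominate the square of \<open>norm (P x)\<close> left over by the drift.\<close>

lemma nonneg_ops_norm_sq_le:
  fixes P :: "'a::{real_inner, banach, second_countable_topology} \<Rightarrow>\<^sub>L 'a"
  assumes P: "P \<in> nonneg_ops" and b: "norm P \<le> b"
  shows "(norm (P x))\<^sup>2 \<le> b * (P x \<bullet> x)"
proof (cases "b = 0")
  case True
  then show ?thesis using b by simp
next
  case False
  then have b0: "b > 0" using b norm_ge_zero[of P] by linarith
  have "2 * (norm (P x))\<^sup>2 \<le> b * (P x \<bullet> x) + (P (P x) \<bullet> P x) / b"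
    using nonneg_ops_young[OF P b0, of x "P x"] by (simp add: power2_norm_eq_inner)
  also have "(P (P x) \<bullet> P x) / b \<le> (norm (P x))\<^sup>2"
  proof -
    have "P (P x) \<bullet> P x \<le> norm P * (norm (P x))\<^sup>2" using form_le_norm[of P "P x"] by simp
    also have "\<dots> \<le> b * (norm (P x))\<^sup>2" by (simp add: b mult_right_mono)
    finally show ?thesis using b0 by (simp add: divide_le_eq mult.commute)
  qed
  finally show ?thesis by simp
qed

text \<open>Coercivity gives surjectivity by the variational lemma, and injectivity with a bounded
  inverse by Cauchy-Schwarz, so the definite description in \<open>op_inverse\<close> has exactly
  one witness. It will be applied to \<open>Lambda_op\<close>.\<close>

lemma op_inverse_coercive:
  fixes L :: "'a::{real_inner, banach, second_countable_topology} \<Rightarrow>\<^sub>L 'a"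
  assumes L: "op_adj L = L" and coer: "\<And>x. d * (norm x)\<^sup>2 \<le> L x \<bullet> x" and d: "d > 0"
  shows "op_inverse L (L x) = x" "L (op_inverse L x) = x"
proof -
  have "\<exists>z. L z = b" for b
  proof -
    obtain z where "\<And>y. y \<in> UNIV \<Longrightarrow> L z \<bullet> y = b \<bullet> y"
      by (rule coercive_form_represents[of L d "(\<bullet>) b" UNIV])
        (use coer d selfadj_inner[OF L] in \<open>auto simp: bounded_linear_inner_right\<close>)
    then show ?thesis by (metis UNIV_I inner_commute vector_eq_ldot)
  qed
  then obtain m where m: "\<And>b. L (m b) = b" by metis
  have bd: "d * norm z \<le> norm (L z)" for z
  proof (cases "z = 0")
    case False
    have "d * norm z * norm z \<le> norm (L z) * norm z"
      using coer[of z] norm_cauchy_schwarz[of "L z" z] by (simp add: power2_eq_square)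
    then show ?thesis using False by simp
  qed simp
  have inj: "y = z" if "L y = L z" for y z
    using bd[of "y - z"] that d by (simp add: blinfun.bilinear_simps mult_le_0_iff)
  have mL: "m (L x) = x" for x by (rule inj) (simp add: m)
  have "bounded_linear m"
  proof (rule bounded_linear_intro)
    show "m (x + y) = m x + m y" for x y by (rule inj) (simp add: m blinfun.bilinear_simps)
    show "m (r *\<^sub>R x) = r *\<^sub>R m x" for r x by (rule inj) (simp add: m blinfun.bilinear_simps)
    show "norm (m x) \<le> norm x * (1 / d)" for x
      using bd[of "m x"] d by (simp add: m field_simps)
  qed
  then have Bm: "blinfun_apply (Blinfun m) = m" by (rule bounded_linear_Blinfun_apply)
  have "op_inverse L = Blinfun m"
    unfolding op_inverse_def
  proof (rule the_equality)
    show "Blinfun m o\<^sub>L L = id_blinfun \<and> L o\<^sub>L Blinfun m = id_blinfun"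
      by (auto intro!: blinfun_eqI simp: Bm m mL)
    fix N assume N: "N o\<^sub>L L = id_blinfun \<and> L o\<^sub>L N = id_blinfun"
    show "N = Blinfun m"
    proof (rule blinfun_eqI, rule inj)
      fix x
      have "L (N x) = (L o\<^sub>L N) x" by simp
      then show "L (N x) = L (Blinfun m x)" using N by (simp add: Bm m)
    qed
  qed
  then show "op_inverse L (L x) = x" "L (op_inverse L x) = x" by (simp_all add: Bm m mL)
qed

lemma strong_sum_eq: "(\<And>x. (\<lambda>i. F i x) sums M x) \<Longrightarrow> strong_sum F = M"
  for F :: "nat \<Rightarrow> 'a::real_normed_vector \<Rightarrow>\<^sub>L 'b::real_normed_vector" and M :: "'a \<Rightarrow>\<^sub>L 'b"
  unfolding strong_sum_def
proof (rule the_equality)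
  assume M: "\<And>x. (\<lambda>i. F i x) sums M x"
  show "\<forall>x. (\<lambda>i. F i x) sums M x" using M by simp
  show "N = M" if "\<forall>x. (\<lambda>i. F i x) sums N x" for N :: "'a \<Rightarrow>\<^sub>L 'b"
    by (rule blinfun_eqI) (rule sums_unique2[OF spec[OF that] M])
qed

text \<open>By polarisation at most one self-adjoint operator has a given form; this is why
  self-adjointness is part of the definite description.\<close>

lemma form_sum_eq:
  fixes F :: "nat \<Rightarrow> 'a::{real_inner, banach, second_countable_topology} \<Rightarrow>\<^sub>L 'a"
    and M :: "'a \<Rightarrow>\<^sub>L 'a"
  assumes "op_adj M = M" "\<And>x. (\<lambda>i. F i x \<bullet> x) sums (M x \<bullet> x)"
  shows "form_sum F = M"
  unfolding form_sum_def
proof (rule the_equality)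
  show "op_adj M = M \<and> (\<forall>x. (\<lambda>i. F i x \<bullet> x) sums (M x \<bullet> x))" using assms by simp
  show "N = M" if N: "op_adj N = N \<and> (\<forall>x. (\<lambda>i. F i x \<bullet> x) sums (N x \<bullet> x))" for N :: "'a \<Rightarrow>\<^sub>L 'a"
    by (rule selfadj_eqI) (use N assms(1) sums_unique2[OF spec[OF conjunct2[OF N]] assms(2)] in simp_all)
qed

section \<open>Uniform boundedness, weak measurability, adjoint semigroups\<close>

text \<open>Banach-Steinhaus for quadratic functionals, from Baire's theorem: some common sublevel
  set contains a ball, \<open>diff\<close> moves the ball to the origin and \<open>hom\<close>
  rescales it. Functionals instead of operators, because it is applied both to squared norms and to
  partial sums of operator series.\<close>

lemma uniform_bound_quadratic:
  fixes q :: "'i \<Rightarrow> 'a::banach \<Rightarrow> real"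
  assumes cont: "\<And>i. i \<in> I \<Longrightarrow> continuous_on UNIV (q i)"
    and diff: "\<And>i x y. i \<in> I \<Longrightarrow> q i (x - y) \<le> 2 * q i x + 2 * q i y"
    and hom: "\<And>i r x. i \<in> I \<Longrightarrow> q i (r *\<^sub>R x) = r\<^sup>2 * q i x"
    and bdd: "\<And>x. \<exists>b. \<forall>i\<in>I. q i x \<le> b"
  obtains K where "K \<ge> 0" "\<And>i x. i \<in> I \<Longrightarrow> q i x \<le> K * (norm x)\<^sup>2"
proof -
  define E where "E n = {x. \<forall>i\<in>I. q i x \<le> real n}" for n
  have clE: "closed (E n)" for n
  proof -
    have "E n = (\<Inter>i\<in>I. {x. q i x \<le> real n})" by (auto simp: E_def)
    moreover have "closed {x. q i x \<le> real n}" if "i \<in> I" for i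
      using cont[OF that] by (intro closed_Collect_le) auto
    ultimately show ?thesis by auto
  qed
  have UE: "(\<Union>n. E n) = UNIV"
  proof -
    have "\<exists>n. x \<in> E n" for x
    proof -
      obtain b where "\<forall>i\<in>I. q i x \<le> b" using bdd by blast
      moreover obtain n where "b \<le> real n" using real_arch_simple by blast
      ultimately have "x \<in> E n" by (force simp: E_def)
      then show ?thesis ..
    qed
    then show ?thesis by blast
  qed
  have "\<exists>n. interior (E n) \<noteq> {}"
  proof (rule ccontr)
    assume none: "\<not> ?thesis"
    have "(euclidean :: 'a topology) interior_of \<Union>(range E) = {}"
    proof (rule Baire_category_alt)
      show "completely_metrizable_space (euclidean :: 'a topology) \<or>
        locally_compact_space (euclidean :: 'a topology) \<and> regular_space (euclidean :: 'a topology)"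
        using completely_metrizable_space_euclidean by blast
    qed (use clE none in auto)
    then show False using UE by simp
  qed
  then obtain n x0 where "x0 \<in> interior (E n)" by blast
  then obtain e where e: "e > 0" "ball x0 e \<subseteq> E n" by (auto simp: mem_interior)
  have x0: "q i x0 \<le> n" if "i \<in> I" for i
    using e that by (force simp: E_def)
  have small: "q i y \<le> 4 * n" if "norm y < e" "i \<in> I" for i y
  proof -
    have "x0 + y \<in> E n" using that e by (intro subsetD[OF e(2)]) (auto simp: dist_norm)
    then have "q i (x0 + y) \<le> n" using that by (auto simp: E_def)
    then show ?thesis using diff[OF that(2), of "x0 + y" x0] x0[OF that(2)] by simp
  qed
  show thesis
  proof (rule that[of "16 * n / e\<^sup>2"])
    fix i x assume i: "i \<in> I"
    show "q i x \<le> 16 * n / e\<^sup>2 * (norm x)\<^sup>2"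
    proof (cases "x = 0")
      case True
      then show ?thesis using hom[OF i, of 0 x] by simp
    next
      case False
      \<comment> \<open>Half the radius puts \<open>r x\<close> strictly inside the ball. The
        constant 16 is a factor 4 from translating the ball times a factor 4 from halving its
        radius.\<close>
      define r where "r = e / 2 / norm x"
      have r: "r > 0" using e False by (simp add: r_def)
      have "r\<^sup>2 * q i x \<le> 4 * n"
        using small[of "r *\<^sub>R x" i] i e False hom[OF i, of r x] by (simp add: r_def)
      then show ?thesis using e False
        by (simp add: r_def power2_eq_square field_simps)
    qed
  qed simp
qed

lemma strongly_continuous_bounded:
  fixes F :: "'t::topological_space \<Rightarrow> 'a::banach \<Rightarrow>\<^sub>L 'b::real_normed_vector"
  assumes K: "compact K" and cont: "\<And>x. continuous_on K (\<lambda>t. F t x)"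
  obtains M where "M \<ge> 1" "\<And>t. t \<in> K \<Longrightarrow> norm (F t) \<le> M"
proof -
  obtain L where L: "L \<ge> 0" "\<And>t x. t \<in> K \<Longrightarrow> (norm (F t x))\<^sup>2 \<le> L * (norm x)\<^sup>2"
  proof (rule uniform_bound_quadratic[of K "\<lambda>t x. (norm (F t x))\<^sup>2"])
    fix t x y
    have "(norm (F t (x - y)))\<^sup>2 \<le> (norm (F t x) + norm (F t y))\<^sup>2"
      by (simp add: blinfun.diff_right norm_triangle_ineq4 power_mono)
    also have "\<dots> \<le> 2 * (norm (F t x))\<^sup>2 + 2 * (norm (F t y))\<^sup>2"
      using sum_squares_bound[of "norm (F t x)" "norm (F t y)"] by (simp add: power2_sum)
    finally show "(norm (F t (x - y)))\<^sup>2 \<le> 2 * (norm (F t x))\<^sup>2 + 2 * (norm (F t y))\<^sup>2" .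
  next
    fix x
    have "compact ((\<lambda>t. F t x) ` K)" using cont K by (intro compact_continuous_image)
    then obtain b where "\<forall>t\<in>K. norm (F t x) \<le> b"
      using compact_imp_bounded by (force simp: bounded_iff)
    then show "\<exists>b. \<forall>t\<in>K. (norm (F t x))\<^sup>2 \<le> b"
      by (intro exI[of _ "b\<^sup>2"]) (auto intro: power_mono)
  qed (auto intro!: continuous_intros simp: blinfun.scaleR_right power_mult_distrib)
  show thesis
  proof (rule that[of "sqrt L + 1"])
    fix t assume t: "t \<in> K"
    have "norm (F t) \<le> sqrt L"
    proof (rule norm_blinfun_bound)
      fix x
      have "norm (F t x) \<le> sqrt (L * (norm x)\<^sup>2)" by (intro real_le_rsqrt L(2) t)
      then show "norm (F t x) \<le> sqrt L * norm x" by (simp add: real_sqrt_mult)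
    qed (use L in simp)
    then show "norm (F t) \<le> sqrt L + 1" by simp
  qed (use L in simp)
qed

text \<open>Pettis' theorem on a separable space: a closed ball is a countable intersection of
  closed half-spaces, and every open set is a countable union of closed balls.\<close>

lemma borel_measurable_weakly:
  fixes f :: "'m \<Rightarrow> 'a::{real_inner, second_countable_topology}"
  assumes f: "\<And>y. (\<lambda>s. f s \<bullet> y) \<in> borel_measurable M"
  shows "f \<in> borel_measurable M"
proof -
  obtain D :: "'a set" where D: "countable D" "\<And>X. open X \<Longrightarrow> X \<noteq> {} \<Longrightarrow> \<exists>d\<in>D. d \<in> X"
    by (erule countable_dense_setE)
  obtain g :: "nat \<Rightarrow> 'a" where g: "D = range g"
    using D(1) D(2)[of UNIV] by (metis UNIV_not_empty empty_iff open_UNIV range_from_nat_into)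
  \<comment> \<open>The left side of each inequality is |u|^2 - |u-d|^2 with u = z - a, whose
    supremum over d is attained at d = u. A violation is an open condition on d, hence is detected
    by a point of the dense set.\<close>
  have cball_iff: "z \<in> cball a e \<longleftrightarrow> (\<forall>d\<in>D. 2 * (z \<bullet> d) - 2 * (a \<bullet> d) - (norm d)\<^sup>2 \<le> e\<^sup>2)"
    if e: "e \<ge> 0" for z a :: 'a and e
  proof -
    define u where "u = z - a"
    have id: "2 * (u \<bullet> d) - (norm d)\<^sup>2 = (norm u)\<^sup>2 - (norm (u - d))\<^sup>2" for d
      by (simp add: power2_norm_eq_inner inner_simps inner_commute)
    have "(norm u)\<^sup>2 \<le> e\<^sup>2 \<longleftrightarrow> (\<forall>d\<in>D. 2 * (u \<bullet> d) - (norm d)\<^sup>2 \<le> e\<^sup>2)" (is "?l \<longleftrightarrow> ?r")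
    proof
      assume ?l
      show ?r unfolding id using \<open>?l\<close> by (auto intro: order_trans[of _ "(norm u)\<^sup>2"])
    next
      assume r: ?r
      show ?l
      proof (rule ccontr)
        assume n: "\<not> ?l"
        have "open {d. 2 * (u \<bullet> d) - (norm d)\<^sup>2 > e\<^sup>2}"
          by (intro open_Collect_less continuous_intros)
        moreover have "u \<in> {d. 2 * (u \<bullet> d) - (norm d)\<^sup>2 > e\<^sup>2}" using n by (simp add: id)
        ultimately obtain d where "d \<in> D" "2 * (u \<bullet> d) - (norm d)\<^sup>2 > e\<^sup>2" using D(2) by blast
        then show False using r by force
      qed
    qed
    moreover have "z \<in> cball a e \<longleftrightarrow> (norm u)\<^sup>2 \<le> e\<^sup>2"
      using e by (simp add: u_def dist_norm norm_minus_commute power_mono_iff abs_le_square_iff[symmetric])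
    ultimately show ?thesis by (simp add: u_def inner_simps algebra_simps)
  qed
  have cb: "f -` cball a e \<inter> space M \<in> sets M" if "e \<ge> 0" for a e
  proof -
    note [measurable] = f
    have "f -` cball a e \<inter> space M =
      {s \<in> space M. \<forall>d\<in>D. 2 * (f s \<bullet> d) - 2 * (a \<bullet> d) - (norm d)\<^sup>2 \<le> e\<^sup>2}"
      using cball_iff[OF that] by auto
    also have "\<dots> = {s \<in> space M. \<forall>n. 2 * (f s \<bullet> g n) - 2 * (a \<bullet> g n) - (norm (g n))\<^sup>2 \<le> e\<^sup>2}"
      by (simp add: g)
    also have "\<dots> \<in> sets M" by measurable
    finally show ?thesis .
  qed
  show ?thesis
  proof (rule borel_measurableI)
    fix U :: "'a set" assume U: "open U"
    define I where "I = {(d, n :: nat). d \<in> D \<and> cball d (inverse (real (Suc n))) \<subseteq> U}"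
    have "U = (\<Union>(d, n)\<in>I. cball d (inverse (real (Suc n))))"
    proof (intro set_eqI iffI)
      fix x assume "x \<in> U"
      then obtain e where e: "e > 0" "ball x e \<subseteq> U" using U open_contains_ball by blast
      obtain n where n: "inverse (real (Suc n)) < e / 2" using reals_Archimedean[of "e / 2"] e by auto
      obtain d where d: "d \<in> D" "d \<in> ball x (inverse (real (Suc n)))"
        using D(2)[of "ball x (inverse (real (Suc n)))"] by force
      have "cball d (inverse (real (Suc n))) \<subseteq> ball x e"
      proof
        fix y assume y: "y \<in> cball d (inverse (real (Suc n)))"
        have "dist x y \<le> dist x d + dist d y" by (rule dist_triangle)
        then show "y \<in> ball x e" using d n y by (simp add: dist_commute)
      qed
      then show "x \<in> (\<Union>(d, n)\<in>I. cball d (inverse (real (Suc n))))"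
        using e d by (auto simp: I_def dist_commute intro!: exI[of _ d] exI[of _ n])
    qed (auto simp: I_def)
    then have eq: "f -` U \<inter> space M =
        (\<Union>(d, n)\<in>I. f -` cball d (inverse (real (Suc n))) \<inter> space M)"
      by auto
    have "countable I"
      by (rule countable_subset[of _ "D \<times> UNIV"]) (auto simp: I_def D(1))
    then show "f -` U \<inter> space M \<in> sets M"
      unfolding eq by (intro sets.countable_UN') (auto intro!: cb)
  qed
qed

text \<open>\<open>F\<close> is measurable only pointwise in its argument, so the moving argument is
  approximated by simple functions: on each of their countably many values the assumption applies,
  and continuity of each \<open>F s\<close> gives the limit.\<close>

lemma borel_measurable_blinfun_apply:
  fixes F :: "'m \<Rightarrow> 'a::{real_normed_vector, second_countable_topology} \<Rightarrow>\<^sub>L 'b::real_normed_vector"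
  assumes F: "\<And>x. (\<lambda>s. F s x) \<in> borel_measurable M" and c: "c \<in> borel_measurable M"
  shows "(\<lambda>s. F s (c s)) \<in> borel_measurable M"
proof -
  obtain u where u: "\<And>i. simple_function M (u i)" "\<And>s. s \<in> space M \<Longrightarrow> (\<lambda>i. u i s) \<longlonglongrightarrow> c s"
    using borel_measurable_implies_sequence_metric[OF c] by blast
  have "(\<lambda>s. F s (u i s)) \<in> borel_measurable M" for i
  proof (rule measurable_compose_countable'[where I="u i ` space M"])
    show "u i \<in> measurable M (count_space (u i ` space M))"
      using u(1)[of i] by (subst measurable_count_space_eq2) (auto simp: simple_function_def)
    show "countable (u i ` space M)" using u(1)[of i] by (simp add: simple_function_def countable_finite)
  qed (rule F)
  then show ?thesis
    by (rule borel_measurable_LIMSEQ_metric[where f="\<lambda>i s. F s (u i s)"]) (intro tendsto_intros u)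
qed


section \<open>Semigroup bounds and the adjoint semigroup\<close>

lemma C0_semigroup_norm_bound:
  fixes S :: "real \<Rightarrow> 'a::banach \<Rightarrow>\<^sub>L 'a"
  assumes "C0_semigroup S"
  obtains M where "M \<ge> 1" "\<And>t. t \<in> {0..T} \<Longrightarrow> norm (S t) \<le> M"
proof (rule strongly_continuous_bounded[of "{0..T}" S])
  show "continuous_on {0..T} (\<lambda>t. S t x)" for x
    using assms continuous_on_subset[of "{0..}" _ "{0..T}"] by (auto simp: C0_semigroup_def)
qed (auto intro: that)

lemma op_adj_id: "op_adj (id_blinfun :: 'a::{real_inner, banach, second_countable_topology} \<Rightarrow>\<^sub>L 'a) = id_blinfun"
  by (rule op_adj_eqI) simp

lemma op_adj_compose: "op_adj (F o\<^sub>L G) = op_adj G o\<^sub>L op_adj F"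
  for F :: "'b::{real_inner, banach, second_countable_topology} \<Rightarrow>\<^sub>L
      'c::{real_inner, banach, second_countable_topology}"
    and G :: "'a::{real_inner, banach, second_countable_topology} \<Rightarrow>\<^sub>L 'b"
  by (rule op_adj_eqI) (simp add: inner_op_adj)

lemma op_adj_diff: "op_adj (F - G) = op_adj F - op_adj G"
  for F G :: "'a::{real_inner, banach, second_countable_topology} \<Rightarrow>\<^sub>L
      'b::{real_inner, banach, second_countable_topology}"
  by (rule op_adj_eqI) (simp add: blinfun.bilinear_simps inner_simps inner_op_adj)

text \<open>On a Hilbert space the adjoint semigroup is strongly continuous: the vectors on which it
  is continuous at \<open>0\<close> form a closed subspace which contains the range of the adjoint of
  \<open>x \<mapsto> \<integral>\<^sub>0\<^sup>h S\<^sub>s x ds\<close> for every \<open>h\<close>, and therefore has trivial orthogonal complement.\<close>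

lemma adjoint_semigroup_right_continuous_0:
  fixes S :: "real \<Rightarrow> 'a::{real_inner, banach, second_countable_topology} \<Rightarrow>\<^sub>L 'a"
  assumes S: "C0_semigroup S"
  shows "((\<lambda>t. op_adj (S t) x) \<longlongrightarrow> x) (at_right 0)"
proof -
  have S0: "S 0 = id_blinfun" and Sadd: "\<And>s t. s \<ge> 0 \<Longrightarrow> t \<ge> 0 \<Longrightarrow> S (s + t) = S s o\<^sub>L S t"
    and Scont: "\<And>x. continuous_on {0..} (\<lambda>t. S t x)"
    using S by (auto simp: C0_semigroup_def)
  \<comment> \<open>Times up to 2 suffice: \<open>h\<close> is at most 1 and \<open>t\<close> is
    below \<open>h\<close>, so \<open>h + t\<close> does not exceed 2.\<close>
  obtain M where M: "M \<ge> 1" "\<And>t. t \<in> {0..2} \<Longrightarrow> norm (S t) \<le> M"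
    using C0_semigroup_norm_bound[OF S] by blast
  have Sn: "norm (S t y) \<le> M * norm y" if "t \<in> {0..2}" for t y
    using norm_blinfun[of "S t" y] M(2)[OF that] by (meson mult_right_mono norm_ge_zero order_trans)
  have Nn: "norm (op_adj (S t) y) \<le> M * norm y" if "t \<in> {0..2}" for t y
    using norm_op_adj_le[of "S t" y] M(2)[OF that] by (meson mult_right_mono norm_ge_zero order_trans)
  define X where "X = {y. ((\<lambda>t. op_adj (S t) y) \<longlongrightarrow> y) (at_right 0)}"
  have ev2: "eventually (\<lambda>t. t \<in> {0<..<2}) (at_right (0::real))"
    by (rule eventually_at_right_real) simp
  have "subspace X"
    unfolding X_def subspace_def
    by (auto simp: blinfun.bilinear_simps intro!: tendsto_intros)
  have "closed X"
  proof (rule closed_sequential_limits[THEN iffD2], intro allI impI, elim conjE)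
    fix y l assume y: "\<forall>n. y n \<in> X" and l: "y \<longlonglongrightarrow> l"
    show "l \<in> X"
      unfolding X_def mem_Collect_eq
    proof (rule tendstoI)
      fix e :: real assume e: "e > 0"
      define e' where "e' = e / 2 / (M + 1)"
      have e': "e' > 0" using e M by (simp add: e'_def)
      obtain n where n: "dist (y n) l < e'"
        using tendstoD[OF l e'] eventually_sequentially by auto
      have "((\<lambda>t. op_adj (S t) (y n)) \<longlongrightarrow> y n) (at_right 0)" using y by (auto simp: X_def)
      then have "eventually (\<lambda>t. dist (op_adj (S t) (y n)) (y n) < e / 2) (at_right 0)"
        using e by (intro tendstoD) auto
      then show "eventually (\<lambda>t. dist (op_adj (S t) l) l < e) (at_right 0)"
        using ev2
      proof eventually_elim
        fix t :: real assume t: "dist (op_adj (S t) (y n)) (y n) < e / 2" "t \<in> {0<..<2}"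
        have "op_adj (S t) l - l =
            op_adj (S t) (l - y n) + (op_adj (S t) (y n) - y n) + (y n - l)"
          by (simp add: blinfun.bilinear_simps)
        then have "norm (op_adj (S t) l - l) \<le>
            norm (op_adj (S t) (l - y n)) + norm (op_adj (S t) (y n) - y n) + norm (y n - l)"
          by (metis norm_triangle_le norm_triangle_ineq add_mono order_refl)
        also have "\<dots> < M * e' + e / 2 + e'"
        proof -
          have "norm (op_adj (S t) (l - y n)) \<le> M * norm (l - y n)" using t by (intro Nn) auto
          also have "\<dots> \<le> M * e'" using n M
            by (intro mult_left_mono) (auto simp: dist_norm norm_minus_commute)
          finally show ?thesis using t n by (simp add: dist_norm)
        qed
        also have "\<dots> = (M + 1) * e' + e / 2" by (simp add: algebra_simps)
        also have "(M + 1) * e' = e / 2" using M by (simp add: e'_def del: distrib_right) (simp add: field_simps)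
        finally show "dist (op_adj (S t) l) l < e" by (simp add: dist_norm)
      qed
    qed
  qed
  have int: "(\<lambda>s. S s y) integrable_on {a..b}" if "a \<ge> 0" for a b y
    using that by (intro integrable_continuous_interval continuous_on_subset[OF Scont]) auto
  have intbd: "norm (integral {a..b} (\<lambda>s. S s y)) \<le> (M * norm y) * (b - a)"
    if "0 \<le> a" "a \<le> b" "b \<le> 2" for a b y
    using that by (intro integral_bound continuous_on_subset[OF Scont] Sn) auto
  define B where "B h = Blinfun (\<lambda>y. integral {0..h} (\<lambda>s. S s y))" for h :: real
  have B: "B h y = integral {0..h} (\<lambda>s. S s y)" if "0 \<le> h" "h \<le> 2" for h y
  proof -
    have "bounded_linear (\<lambda>y. integral {0..h} (\<lambda>s. S s y))"
      by (rule bounded_linear_intro[where K="M * h"])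
        (use intbd[of 0 h] that in \<open>auto simp: blinfun.bilinear_simps integral_add int mult_ac\<close>)
    then show ?thesis by (simp add: B_def bounded_linear_Blinfun_apply)
  qed
  have rangeB: "op_adj (B h) y \<in> X" if h: "0 < h" "h \<le> 1" for h y
  proof -
    have bd: "norm (op_adj (S t) (op_adj (B h) y) - op_adj (B h) y) \<le> 2 * M * t * norm y"
      if t: "t \<in> {0<..<h}" for t
    proof -
      \<comment> \<open>Translation leaves only the integrals over the two end pieces, each of
        length \<open>t\<close>. This gives the operator bound \<open>2 * M * t\<close>, which
        passes to the adjoint.\<close>
      have shift: "B h (S t z) - B h z = integral {h..h+t} (\<lambda>s. S s z) - integral {0..t} (\<lambda>s. S s z)" for z
      proof -
        have "B h (S t z) = integral {0..h} (\<lambda>s. S (s + t) z)"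
          using h t by (subst B) (auto simp: Sadd intro!: integral_cong)
        also have "\<dots> = integral {t..h+t} (\<lambda>s. S s z)"
          using has_integral_affinity'[of "\<lambda>s. S s z" "integral {t..h+t} (\<lambda>s. S s z)" t "h + t" 1 t]
            int[of t z "h + t"] t by (intro integral_unique) (auto simp: has_integral_integral)
        finally have 1: "B h (S t z) = integral {t..h+t} (\<lambda>s. S s z)" .
        have 2: "integral {0..t} (\<lambda>s. S s z) + integral {t..h+t} (\<lambda>s. S s z) = integral {0..h+t} (\<lambda>s. S s z)"
          using t h by (intro Henstock_Kurzweil_Integration.integral_combine int) auto
        have 3: "integral {0..h} (\<lambda>s. S s z) + integral {h..h+t} (\<lambda>s. S s z) = integral {0..h+t} (\<lambda>s. S s z)"
          using t h by (intro Henstock_Kurzweil_Integration.integral_combine int) auto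
        have alg: "d - a = b - c" if "c + d = e" "a + b = e" for a b c d e :: 'a
          using that by (auto simp: algebra_simps)
        show ?thesis using alg[OF 2 3] 1 B[of h z] h by simp
      qed
      have "norm ((B h o\<^sub>L S t) - B h) \<le> 2 * M * t"
      proof (rule norm_blinfun_bound)
        fix z
        have "norm (((B h o\<^sub>L S t) - B h) z) \<le>
            norm (integral {h..h+t} (\<lambda>s. S s z)) + norm (integral {0..t} (\<lambda>s. S s z))"
          by (simp add: blinfun.bilinear_simps shift norm_triangle_ineq4)
        also have "\<dots> \<le> M * norm z * t + M * norm z * t"
          using intbd[of h "h + t" z] intbd[of 0 t z] h t by (intro add_mono) auto
        finally show "norm (((B h o\<^sub>L S t) - B h) z) \<le> 2 * M * t * norm z" by (simp add: mult_ac)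
      qed (use M t in auto)
      moreover have "op_adj (S t) (op_adj (B h) y) - op_adj (B h) y = op_adj ((B h o\<^sub>L S t) - B h) y"
        by (simp add: op_adj_diff op_adj_compose blinfun.bilinear_simps)
      ultimately show ?thesis
        by (simp only:) (rule order_trans[OF norm_op_adj_le mult_right_mono[OF _ norm_ge_zero]])
    qed
    have "((\<lambda>t. op_adj (S t) (op_adj (B h) y) - op_adj (B h) y) \<longlongrightarrow> 0) (at_right 0)"
    proof (rule Lim_null_comparison)
      show "\<forall>\<^sub>F t in at_right 0. norm (op_adj (S t) (op_adj (B h) y) - op_adj (B h) y) \<le> 2 * M * t * norm y"
        using eventually_at_right_real[OF h(1)] by eventually_elim (rule bd)
      have "((\<lambda>t. 2 * M * t * norm y) \<longlongrightarrow> 2 * M * 0 * norm y) (at_right 0)" by (intro tendsto_intros)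
      then show "((\<lambda>t. 2 * M * t * norm y) \<longlongrightarrow> 0) (at_right 0)" by simp
    qed
    then show ?thesis by (simp add: X_def LIM_zero_iff)
  qed
  have perp: "z = 0" if z: "\<And>y. y \<in> X \<Longrightarrow> z \<bullet> y = 0" for z
  proof (rule ccontr)
    assume nz: "z \<noteq> 0"
    \<comment> \<open>Orthogonality to the range of the adjoint of \<open>B h\<close> forces
      \<open>B h z\<close> to vanish, while for short \<open>h\<close> the mean of
      \<open>S s z\<close> stays within half of \<open>norm z\<close> of \<open>z\<close>.\<close>
    have Bz: "B h z = 0" if "0 < h" "h \<le> 1" for h
    proof -
      have "B h z \<bullet> B h z = z \<bullet> op_adj (B h) (B h z)" by (rule inner_op_adj)
      then show ?thesis using z[OF rangeB[OF that]] by simp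
    qed
    have "continuous (at 0 within {0..}) (\<lambda>t. S t z)" using Scont[of z] by (simp add: continuous_on_eq_continuous_within)
    then have "\<forall>e>0. \<exists>d>0. \<forall>t\<in>{0..}. dist t 0 < d \<longrightarrow> dist (S t z) (S 0 z) < e"
      unfolding continuous_within_eps_delta .
    moreover have "norm z / 2 > 0" using nz by simp
    ultimately obtain d where d': "d > 0" "\<forall>t\<in>{0..}. dist t 0 < d \<longrightarrow> dist (S t z) (S 0 z) < norm z / 2"
      by blast
    then have d: "d > 0" "\<And>t. t \<ge> 0 \<Longrightarrow> t < d \<Longrightarrow> norm (S t z - z) < norm z / 2"
      by (simp_all add: S0 dist_norm)
    define h where "h = min (d / 2) 1"
    have h: "0 < h" "h \<le> 1" "h < d" using d by (auto simp: h_def)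
    have "norm (integral {0..h} (\<lambda>s. S s z - z)) \<le> norm z / 2 * (h - 0)"
      using h d by (intro integral_bound continuous_intros continuous_on_subset[OF Scont]) (auto intro: less_imp_le)
    moreover have "integral {0..h} (\<lambda>s. S s z - z) = B h z - h *\<^sub>R z"
      using h int[of 0 z h] by (subst integral_diff) (auto simp: B)
    ultimately have "h * norm z \<le> norm z / 2 * h" using Bz[OF h(1,2)] h by simp
    then show False using nz h by simp
  qed
  obtain w where w: "w \<in> X" "\<And>y. y \<in> X \<Longrightarrow> id_blinfun w \<bullet> y = x \<bullet> y"
    by (rule coercive_form_represents[of id_blinfun 1 "(\<bullet>) x" X])
      (use \<open>subspace X\<close> \<open>closed X\<close> in \<open>auto simp: power2_norm_eq_inner bounded_linear_inner_right\<close>)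
  have "x - w = 0" by (rule perp) (use w in \<open>simp add: inner_diff_left\<close>)
  then show ?thesis using w(1) by (simp add: X_def)
qed

text \<open>Factor out the smaller of the two times and compare only the short remainder with 0; the
  local norm bound absorbs the common factor. One estimate, \<open>key\<close>, thus serves
  continuity from both sides.\<close>

lemma adjoint_semigroup_continuous:
  fixes S :: "real \<Rightarrow> 'a::{real_inner, banach, second_countable_topology} \<Rightarrow>\<^sub>L 'a"
  assumes S: "C0_semigroup S"
  shows "continuous_on {0..} (\<lambda>t. op_adj (S t) x)"
  unfolding continuous_on_iff
proof (intro ballI allI impI)
  fix t0 e :: real assume t0: "t0 \<in> {0..}" and e: "e > 0"
  have S0: "S 0 = id_blinfun" and Sadd: "\<And>s t. s \<ge> 0 \<Longrightarrow> t \<ge> 0 \<Longrightarrow> S (s + t) = S s o\<^sub>L S t"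
    using S by (auto simp: C0_semigroup_def)
  have Nadd: "op_adj (S (s + t)) = op_adj (S s) o\<^sub>L op_adj (S t)" if "s \<ge> 0" "t \<ge> 0" for s t
    using Sadd[OF that(2,1)] by (simp add: op_adj_compose add.commute)
  obtain M where M: "M \<ge> 1" "\<And>t. t \<in> {0..t0 + 1} \<Longrightarrow> norm (S t) \<le> M"
    using C0_semigroup_norm_bound[OF S] by blast
  have "eventually (\<lambda>t. dist (op_adj (S t) x) x < e / M) (at_right 0)"
    using e M by (intro tendstoD[OF adjoint_semigroup_right_continuous_0[OF S]]) auto
  then obtain d where d: "d > 0" "\<And>r. 0 < r \<Longrightarrow> r < d \<Longrightarrow> dist (op_adj (S r) x) x < e / M"
    unfolding eventually_at_right_field by auto
  have d': "norm (op_adj (S r) x - x) < e / M" if "0 \<le> r" "r < d" for r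
    using d(2)[of r] that S0 e M by (cases "r = 0") (auto simp: op_adj_id dist_norm)
  have key: "norm (op_adj (S (s + r)) x - op_adj (S s) x) < e"
    if "0 \<le> s" "s \<le> t0 + 1" "0 \<le> r" "r < d" for s r
  proof -
    have "norm (op_adj (S (s + r)) x - op_adj (S s) x) = norm (op_adj (S s) (op_adj (S r) x - x))"
      using that by (simp add: Nadd blinfun.bilinear_simps)
    also have "\<dots> \<le> norm (S s) * norm (op_adj (S r) x - x)" by (rule norm_op_adj_le)
    also have "\<dots> \<le> M * norm (op_adj (S r) x - x)" using that M by (intro mult_right_mono) auto
    also have "\<dots> < M * (e / M)" using d'[of r] that M by (intro mult_strict_left_mono) auto
    finally show ?thesis using M by simp
  qed
  show "\<exists>d>0. \<forall>t\<in>{0..}. dist t t0 < d \<longrightarrow> dist (op_adj (S t) x) (op_adj (S t0) x) < e"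
  proof (intro exI conjI ballI impI)
    show "min d 1 > 0" using d by simp
    fix t assume t: "t \<in> {0..}" "dist t t0 < min d 1"
    show "dist (op_adj (S t) x) (op_adj (S t0) x) < e"
    proof (cases "t0 \<le> t")
      case True
      then show ?thesis using key[of t0 "t - t0"] t0 t by (auto simp: dist_norm)
    next
      case False
      then show ?thesis using key[of t "t0 - t"] t0 t by (auto simp: dist_norm norm_minus_commute)
    qed
  qed
qed

section \<open>Mild operator integrals\<close>

lemma lebesgue_on_subset_eq:
  fixes A B :: "real set"
  assumes "B \<subseteq> A" "A \<in> sets lebesgue" "B \<in> sets lebesgue"
  shows "lebesgue_on B = restrict_space (lebesgue_on A) B"
  using assms by (simp add: restrict_restrict_space Int_absorb1)

lemma borel_measurable_lebesgue_on_subset: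
  fixes A B :: "real set"
  assumes "f \<in> borel_measurable (lebesgue_on A)" "B \<subseteq> A" "A \<in> sets lebesgue" "B \<in> sets lebesgue"
  shows "f \<in> borel_measurable (lebesgue_on B)"
  unfolding lebesgue_on_subset_eq[OF assms(2-4)] using assms(1) by (rule measurable_restrict_space1)

lemma AE_lebesgue_on_iff:
  fixes A :: "real set"
  assumes "A \<in> sets lebesgue"
  shows "(AE s in lebesgue_on A. P s) \<longleftrightarrow> (AE s in lebesgue. s \<in> A \<longrightarrow> P s)"
  using assms by (simp add: AE_restrict_space_iff)

lemma AE_lebesgue_on_subset:
  fixes A B :: "real set"
  assumes "AE s in lebesgue_on A. P s" "B \<subseteq> A" "A \<in> sets lebesgue" "B \<in> sets lebesgue"
  shows "AE s in lebesgue_on B. P s"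
  using assms by (auto simp: AE_lebesgue_on_iff elim: AE_mp)

lemma integrable_lebesgue_on_iff:
  fixes f :: "real \<Rightarrow> 'b::{banach, second_countable_topology}"
  assumes "A \<in> sets lebesgue"
  shows "integrable (lebesgue_on A) f \<longleftrightarrow> integrable lebesgue (\<lambda>s. indicator A s *\<^sub>R f s)"
  using assms by (simp add: integrable_restrict_space)

lemma integral_lebesgue_on_eq:
  fixes f :: "real \<Rightarrow> 'b::{banach, second_countable_topology}"
  assumes "A \<in> sets lebesgue"
  shows "integral\<^sup>L (lebesgue_on A) f = integral\<^sup>L lebesgue (\<lambda>s. indicator A s *\<^sub>R f s)"
  using assms by (simp add: integral_restrict_space)

lemma integrable_lebesgue_on_subset:
  fixes f :: "real \<Rightarrow> 'b::{banach, second_countable_topology}"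
  assumes "integrable (lebesgue_on A) f" "B \<subseteq> A" "A \<in> sets lebesgue" "B \<in> sets lebesgue"
  shows "integrable (lebesgue_on B) f"
  using assms set_integrable_subset[of lebesgue A f B]
  by (simp add: integrable_lebesgue_on_iff set_integrable_def)

lemma AE_lebesgue_on_I: "(\<And>s. s \<in> A \<Longrightarrow> P s) \<Longrightarrow> AE s in lebesgue_on A. P s"
  for A :: "real set"
  by (rule AE_I2) simp

text \<open>The mild solution of the backward Lyapunov equation P' + A^* P + P A + M = 0 with
  terminal value \<open>G\<close>. Because of \<open>Blinfun\<close> it is meaningful only when the
  integrals define a bounded map, which \<open>kernel_dom\<close> guarantees.\<close>

definition mild_op ::
  "real \<Rightarrow> (real \<Rightarrow> 'h::{real_inner, banach, second_countable_topology} \<Rightarrow>\<^sub>L 'h)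
    \<Rightarrow> ('h \<Rightarrow>\<^sub>L 'h) \<Rightarrow> (real \<Rightarrow> 'h \<Rightarrow>\<^sub>L 'h) \<Rightarrow> real \<Rightarrow> ('h \<Rightarrow>\<^sub>L 'h)"
  where "mild_op T S G M t = Blinfun (\<lambda>x. op_adj (S (T - t)) (G (S (T - t) x)) +
    integral\<^sup>L (lebesgue_on {t..T}) (\<lambda>s. op_adj (S (s - t)) (M s (S (s - t) x))))"

text \<open>The scalar majorant \<open>g\<close> takes the place of integrability of the operator
  norm; measurability is only pointwise in \<open>x\<close>, as it is for the coefficients.\<close>

definition kernel_dom ::
  "real \<Rightarrow> (real \<Rightarrow> 'h::{real_inner, banach, second_countable_topology} \<Rightarrow>\<^sub>L 'h) \<Rightarrow> (real \<Rightarrow> real) \<Rightarrow> bool"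
  where "kernel_dom T M g \<longleftrightarrow>
    (\<forall>x. (\<lambda>s. M s x) \<in> borel_measurable (lebesgue_on {0..T})) \<and> integrable (lebesgue_on {0..T}) g \<and>
    (AE s in lebesgue_on {0..T}. op_adj (M s) = M s \<and> norm (M s) \<le> g s)"

lemma kernel_domD:
  assumes "kernel_dom T M g"
  shows "(\<lambda>s. M s x) \<in> borel_measurable (lebesgue_on {0..T})"
    and "integrable (lebesgue_on {0..T}) g"
    and "AE s in lebesgue_on {0..T}. op_adj (M s) = M s \<and> norm (M s) \<le> g s"
  using assms unfolding kernel_dom_def by blast+

text \<open>A uniform norm bound makes the contribution of \<open>z n - y\<close> vanish, so strong
  convergence tolerates a moving argument.\<close>

lemma strong_tendsto_apply:
  fixes F :: "nat \<Rightarrow> 'a::real_normed_vector \<Rightarrow>\<^sub>L 'b::real_normed_vector"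
  assumes bd: "\<And>n. norm (F n) \<le> K" and F: "(\<lambda>n. F n y) \<longlonglongrightarrow> l" and z: "z \<longlonglongrightarrow> y"
  shows "(\<lambda>n. F n (z n)) \<longlonglongrightarrow> l"
proof -
  have "(\<lambda>n. F n (z n - y)) \<longlonglongrightarrow> 0"
  proof (rule Lim_null_comparison)
    show "\<forall>\<^sub>F n in sequentially. norm (F n (z n - y)) \<le> K * norm (z n - y)"
      by (intro always_eventually allI order_trans[OF norm_blinfun] mult_right_mono bd norm_ge_zero)
    have "(\<lambda>n. norm (z n - y)) \<longlonglongrightarrow> 0" using z by (simp add: LIM_zero tendsto_norm_zero)
    then show "(\<lambda>n. K * norm (z n - y)) \<longlonglongrightarrow> 0" by (rule tendsto_mult_right_zero)
  qed
  from tendsto_add[OF this F] show ?thesis by (simp add: blinfun.diff_right)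
qed

section \<open>Conjugation by the semigroup and mild integrals\<close>

locale semigroup_on =
  fixes T :: real and S :: "real \<Rightarrow> 'h::{real_inner, banach, second_countable_topology} \<Rightarrow>\<^sub>L 'h"
  assumes T_pos: "T > 0" and C0: "C0_semigroup S"
begin

lemma S_0: "S 0 = id_blinfun" and S_add: "\<And>s t. s \<ge> 0 \<Longrightarrow> t \<ge> 0 \<Longrightarrow> S (s + t) = S s o\<^sub>L S t"
  and S_cont: "continuous_on {0..} (\<lambda>t. S t x)"
  using C0 by (auto simp: C0_semigroup_def)

lemma S_add_apply: "s \<ge> 0 \<Longrightarrow> t \<ge> 0 \<Longrightarrow> S (s + t) x = S s (S t x)"
  by (simp add: S_add)

definition NS :: real where "NS = (SOME N. N \<ge> 1 \<and> (\<forall>t\<in>{0..T}. norm (S t) \<le> N))"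

lemma NS_ge_1: "NS \<ge> 1" and norm_S_le_NS: "t \<in> {0..T} \<Longrightarrow> norm (S t) \<le> NS"
proof -
  obtain N where "N \<ge> 1" "\<And>t. t \<in> {0..T} \<Longrightarrow> norm (S t) \<le> N"
    using C0_semigroup_norm_bound[OF C0] by blast
  then have "\<exists>N. N \<ge> 1 \<and> (\<forall>t\<in>{0..T}. norm (S t) \<le> N)" by blast
  then have "NS \<ge> 1 \<and> (\<forall>t\<in>{0..T}. norm (S t) \<le> NS)" unfolding NS_def by (rule someI_ex)
  then show "NS \<ge> 1" "t \<in> {0..T} \<Longrightarrow> norm (S t) \<le> NS" by auto
qed

lemma norm_S_apply_le: "t \<in> {0..T} \<Longrightarrow> norm (S t x) \<le> NS * norm x"
  by (rule order_trans[OF norm_blinfun mult_right_mono[OF norm_S_le_NS norm_ge_zero]])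

lemma norm_S_adj_apply_le: "t \<in> {0..T} \<Longrightarrow> norm (op_adj (S t) x) \<le> NS * norm x"
  by (rule order_trans[OF norm_op_adj_le mult_right_mono[OF norm_S_le_NS norm_ge_zero]])

lemma norm_conj_le:
  fixes M :: "'h \<Rightarrow>\<^sub>L 'h"
  assumes "t \<in> {0..T}" "norm M \<le> m"
  shows "norm (op_adj (S t) (M (S t x))) \<le> NS\<^sup>2 * m * norm x"
proof -
  have m: "0 \<le> m" using assms(2) norm_ge_zero order_trans by blast
  have "norm (M (S t x)) \<le> norm M * norm (S t x)" by (rule norm_blinfun)
  also have "\<dots> \<le> m * (NS * norm x)"
    using norm_S_apply_le[OF assms(1), of x] assms(2) m by (intro mult_mono) auto
  finally have "norm (M (S t x)) \<le> m * (NS * norm x)" .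
  then have "NS * norm (M (S t x)) \<le> NS * (m * (NS * norm x))"
    using NS_ge_1 by (intro mult_left_mono) auto
  then show ?thesis
    using norm_S_adj_apply_le[OF assms(1), of "M (S t x)"] by (simp add: power2_eq_square mult_ac)
qed

lemma conj_continuous:
  fixes M :: "'h \<Rightarrow>\<^sub>L 'h"
  shows "continuous_on {0..T} (\<lambda>r. op_adj (S r) (M (S r x)))"
  unfolding continuous_on_sequentially comp_def
proof (intro allI ballI impI, elim conjE)
  fix r and a assume r: "\<forall>n. r n \<in> {0..T}" "a \<in> {0..T}" "r \<longlonglongrightarrow> a"
  have c1: "continuous_on {0..T} (\<lambda>t. op_adj (S t) y)" for y
    by (rule continuous_on_subset[OF adjoint_semigroup_continuous[OF C0]]) auto
  have c2: "continuous_on {0..T} (\<lambda>t. M (S t x))"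
    by (intro continuous_intros continuous_on_subset[OF S_cont]) auto
  show "(\<lambda>n. op_adj (S (r n)) (M (S (r n) x))) \<longlonglongrightarrow> op_adj (S a) (M (S a x))"
  proof (rule strong_tendsto_apply[where y="M (S a x)"])
    show "norm (op_adj (S (r n))) \<le> NS" for n
      using r NS_ge_1 by (intro norm_blinfun_bound norm_S_adj_apply_le) auto
    show "(\<lambda>n. op_adj (S (r n)) (M (S a x))) \<longlonglongrightarrow> op_adj (S a) (M (S a x))"
      using c1[of "M (S a x)"] r unfolding continuous_on_sequentially comp_def by blast
    show "(\<lambda>n. M (S (r n) x)) \<longlonglongrightarrow> M (S a x)"
      using c2 r unfolding continuous_on_sequentially comp_def by blast
  qed
qed

context
  fixes M :: "real \<Rightarrow> 'h \<Rightarrow>\<^sub>L 'h" and g :: "real \<Rightarrow> real"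
  assumes dom: "kernel_dom T M g"
begin

lemma kernel_measurable:
  assumes t: "t \<in> {0..T}"
  shows "(\<lambda>s. M s (S (s - t) x)) \<in> borel_measurable (lebesgue_on {t..T})"
    and "(\<lambda>s. op_adj (S (s - t)) (M s (S (s - t) x))) \<in> borel_measurable (lebesgue_on {t..T})"
proof -
  have "continuous_on {t..T} (\<lambda>s. S (s - t) y)" for y
    by (rule continuous_on_compose2[OF S_cont]) (auto intro!: continuous_intros)
  then have 1: "(\<lambda>s. S (s - t) y) \<in> borel_measurable (lebesgue_on {t..T})" for y
    by (intro continuous_imp_measurable_on_sets_lebesgue) auto
  have "(\<lambda>s. M s y) \<in> borel_measurable (lebesgue_on {t..T})" for y
    by (rule borel_measurable_lebesgue_on_subset[OF kernel_domD(1)[OF dom]]) (use t in auto)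
  then show 2: "(\<lambda>s. M s (S (s - t) x)) \<in> borel_measurable (lebesgue_on {t..T})"
    using 1 by (rule borel_measurable_blinfun_apply)
  have "continuous_on {t..T} (\<lambda>s. op_adj (S (s - t)) y)" for y
    by (rule continuous_on_compose2[OF adjoint_semigroup_continuous[OF C0]]) (auto intro!: continuous_intros)
  then have "(\<lambda>s. op_adj (S (s - t)) y) \<in> borel_measurable (lebesgue_on {t..T})" for y
    by (intro continuous_imp_measurable_on_sets_lebesgue) auto
  then show "(\<lambda>s. op_adj (S (s - t)) (M s (S (s - t) x))) \<in> borel_measurable (lebesgue_on {t..T})"
    using 2 by (rule borel_measurable_blinfun_apply)
qed

lemma kernel_integrable_g: "t \<in> {0..T} \<Longrightarrow> integrable (lebesgue_on {t..T}) g"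
  by (rule integrable_lebesgue_on_subset[OF kernel_domD(2)[OF dom]]) auto

lemma kernel_AE:
  assumes "t \<in> {0..T}"
  shows "AE s in lebesgue_on {t..T}. op_adj (M s) = M s \<and> norm (M s) \<le> g s"
  by (rule AE_lebesgue_on_subset[OF kernel_domD(3)[OF dom]]) (use assms in auto)

lemma kernel_AE_bound:
  assumes t: "t \<in> {0..T}"
  shows "AE s in lebesgue_on {t..T}. norm (op_adj (S (s - t)) (M s (S (s - t) x))) \<le> NS\<^sup>2 * g s * norm x"
  using kernel_AE[OF t] AE_space
proof eventually_elim
  case (elim s)
  then show ?case using t by (intro norm_conj_le) auto
qed

lemma kernel_integrable:
  assumes t: "t \<in> {0..T}"
  shows "integrable (lebesgue_on {t..T}) (\<lambda>s. op_adj (S (s - t)) (M s (S (s - t) x)))"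
proof (rule Bochner_Integration.integrable_bound)
  show "integrable (lebesgue_on {t..T}) (\<lambda>s. NS\<^sup>2 * g s * norm x)"
    using kernel_integrable_g[OF t] by simp
  show "AE s in lebesgue_on {t..T}. norm (op_adj (S (s - t)) (M s (S (s - t) x))) \<le> norm (NS\<^sup>2 * g s * norm x)"
    using kernel_AE_bound[OF t, of x] by eventually_elim simp
qed (rule kernel_measurable[OF t])

lemma mild_op_apply:
  assumes t: "t \<in> {0..T}"
  shows "mild_op T S G M t x = op_adj (S (T - t)) (G (S (T - t) x)) +
    integral\<^sup>L (lebesgue_on {t..T}) (\<lambda>s. op_adj (S (s - t)) (M s (S (s - t) x)))"
proof -
  have "bounded_linear (\<lambda>x. integral\<^sup>L (lebesgue_on {t..T}) (\<lambda>s. op_adj (S (s - t)) (M s (S (s - t) x))))"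
  proof (rule bounded_linear_intro)
    show "integral\<^sup>L (lebesgue_on {t..T}) (\<lambda>s. op_adj (S (s - t)) (M s (S (s - t) (x + y)))) =
        integral\<^sup>L (lebesgue_on {t..T}) (\<lambda>s. op_adj (S (s - t)) (M s (S (s - t) x))) +
        integral\<^sup>L (lebesgue_on {t..T}) (\<lambda>s. op_adj (S (s - t)) (M s (S (s - t) y)))" for x y
      by (simp add: blinfun.add_right kernel_integrable[OF t])
    show "integral\<^sup>L (lebesgue_on {t..T}) (\<lambda>s. op_adj (S (s - t)) (M s (S (s - t) (r *\<^sub>R x)))) =
        r *\<^sub>R integral\<^sup>L (lebesgue_on {t..T}) (\<lambda>s. op_adj (S (s - t)) (M s (S (s - t) x)))" for r x
      by (simp add: blinfun.scaleR_right)
    fix x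
    have "norm (integral\<^sup>L (lebesgue_on {t..T}) (\<lambda>s. op_adj (S (s - t)) (M s (S (s - t) x)))) \<le>
        integral\<^sup>L (lebesgue_on {t..T}) (\<lambda>s. NS\<^sup>2 * g s * norm x)"
      by (intro order_trans[OF integral_norm_bound] integral_mono_AE kernel_AE_bound t
            integrable_norm kernel_integrable)
        (use kernel_integrable_g[OF t] in simp)
    then show "norm (integral\<^sup>L (lebesgue_on {t..T}) (\<lambda>s. op_adj (S (s - t)) (M s (S (s - t) x)))) \<le>
        norm x * (NS\<^sup>2 * integral\<^sup>L (lebesgue_on {t..T}) g)"
      by (simp add: mult_ac)
  qed
  then have "bounded_linear (\<lambda>x. op_adj (S (T - t)) (G (S (T - t) x)) +
    integral\<^sup>L (lebesgue_on {t..T}) (\<lambda>s. op_adj (S (s - t)) (M s (S (s - t) x))))"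
    by (intro bounded_linear_add bounded_linear_blinfun_apply bounded_linear_ident)
  then show ?thesis by (simp add: mild_op_def bounded_linear_Blinfun_apply)
qed

lemma mild_op_form_integrable:
  assumes t: "t \<in> {0..T}"
  shows "integrable (lebesgue_on {t..T}) (\<lambda>s. M s (S (s - t) x) \<bullet> S (s - t) y)"
  using integrable_inner_left[OF kernel_integrable[OF t, of x], of y] by (simp add: inner_op_adj')

lemma mild_op_inner:
  assumes t: "t \<in> {0..T}"
  shows "mild_op T S G M t x \<bullet> y = G (S (T - t) x) \<bullet> S (T - t) y +
    integral\<^sup>L (lebesgue_on {t..T}) (\<lambda>s. M s (S (s - t) x) \<bullet> S (s - t) y)"
  using integral_inner_left[OF kernel_integrable[OF t, of x], of y]
  by (simp add: mild_op_apply[OF t] inner_add_left inner_op_adj')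

lemma mild_op_selfadj:
  assumes t: "t \<in> {0..T}" and G: "op_adj G = G"
  shows "op_adj (mild_op T S G M t) = mild_op T S G M t"
proof (rule op_adj_eqI)
  fix x y
  have "integral\<^sup>L (lebesgue_on {t..T}) (\<lambda>s. M s (S (s - t) x) \<bullet> S (s - t) y) =
      integral\<^sup>L (lebesgue_on {t..T}) (\<lambda>s. M s (S (s - t) y) \<bullet> S (s - t) x)"
  proof (rule integral_cong_AE)
    show "AE s in lebesgue_on {t..T}. M s (S (s - t) x) \<bullet> S (s - t) y = M s (S (s - t) y) \<bullet> S (s - t) x"
      using kernel_AE[OF t]
    proof eventually_elim
      case (elim s)
      then show ?case by (metis inner_commute selfadj_inner)
    qed
  qed (use mild_op_form_integrable[OF t] in blast)+
  moreover have "G (S (T - t) x) \<bullet> S (T - t) y = G (S (T - t) y) \<bullet> S (T - t) x"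
    by (metis inner_commute selfadj_inner[OF G])
  ultimately show "mild_op T S G M t x \<bullet> y = x \<bullet> mild_op T S G M t y"
    using mild_op_inner[OF t] by (simp add: inner_commute[of x])
qed

text \<open>The time \<open>t\<close> enters both the domain and the integrand, so the integrals are
  extended by indicators to the whole line and dominated convergence is applied there; pointwise
  convergence can fail only at \<open>s = t\<close>.\<close>

lemma mild_op_continuous: "continuous_on {0..T} (\<lambda>t. mild_op T S G M t x)"
proof -
  have cint: "continuous_on {0..T} (\<lambda>t. integral\<^sup>L (lebesgue_on {t..T}) (\<lambda>s. op_adj (S (s - t)) (M s (S (s - t) x))))"
    unfolding continuous_on_sequentially comp_def
  proof (intro allI ballI impI, elim conjE)
    fix r and t assume r: "\<forall>n. r n \<in> {0..T}" and t: "t \<in> {0..T}" and lim: "r \<longlonglongrightarrow> t"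
    let ?f = "\<lambda>t s. indicator {t..T} s *\<^sub>R op_adj (S (s - t)) (M s (S (s - t) x))"
    have "(\<lambda>n. integral\<^sup>L lebesgue (?f (r n))) \<longlonglongrightarrow> integral\<^sup>L lebesgue (?f t)"
    proof (rule integral_dominated_convergence)
      have m: "?f t \<in> borel_measurable lebesgue" if "t \<in> {0..T}" for t
        using kernel_integrable[OF that, of x] by (simp add: integrable_lebesgue_on_iff)
      show "?f t \<in> borel_measurable lebesgue" using m[OF t] .
      show "?f (r n) \<in> borel_measurable lebesgue" for n using m r by blast
      show "integrable lebesgue (\<lambda>s. indicator {0..T} s *\<^sub>R (NS\<^sup>2 * g s * norm x))"
        using kernel_integrable_g[of 0] T_pos by (subst integrable_lebesgue_on_iff[symmetric]) auto
      have gAE: "AE s in lebesgue. s \<in> {0..T} \<longrightarrow> op_adj (M s) = M s \<and> norm (M s) \<le> g s"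
        by (rule AE_lebesgue_on_iff[THEN iffD1, OF _ kernel_AE]) (use T_pos in auto)
      show "AE s in lebesgue. norm (?f (r n) s) \<le> indicator {0..T} s *\<^sub>R (NS\<^sup>2 * g s * norm x)" for n
        using gAE
      proof eventually_elim
        case (elim s)
        show ?case
        proof (cases "s \<in> {r n..T}")
          case True
          then have "s \<in> {0..T}" using r by (meson atLeastAtMost_iff order_trans)
          have "0 \<le> r n" using r by simp
          then have "norm (op_adj (S (s - r n)) (M s (S (s - r n) x))) \<le> NS\<^sup>2 * g s * norm x"
            using True elim \<open>s \<in> {0..T}\<close> by (intro norm_conj_le) auto
          then show ?thesis using True \<open>s \<in> {0..T}\<close> by simp
        next
          case False
          have "0 \<le> g s" if "s \<in> {0..T}" using elim that norm_ge_zero order_trans by blast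
          then show ?thesis using False by (auto simp: indicator_def)
        qed
      qed
      have "AE s in lebesgue. s \<noteq> t" by (rule AE_completion) (rule AE_lborel_singleton)
      then show "AE s in lebesgue. (\<lambda>n. ?f (r n) s) \<longlonglongrightarrow> ?f t s"
      proof eventually_elim
        fix s assume st: "s \<noteq> t"
        show "(\<lambda>n. ?f (r n) s) \<longlonglongrightarrow> ?f t s"
        proof (cases "s < t \<or> T < s")
          case True
          have "\<forall>\<^sub>F n in sequentially. ?f (r n) s = 0"
          proof (cases "T < s")
            case True
            then show ?thesis by simp
          next
            case False
            then have "\<forall>\<^sub>F n in sequentially. s < r n" using True by (intro order_tendstoD[OF lim]) auto
            then show ?thesis by eventually_elim simp
          qed
          then have "(\<lambda>n. ?f (r n) s) \<longlonglongrightarrow> 0" by (rule tendsto_eventually)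
          then show ?thesis using True by auto
        next
          case False
          then have s: "t < s" "s \<le> T" using st by auto
          have ev: "\<forall>\<^sub>F n in sequentially. r n < s" using s by (intro order_tendstoD[OF lim])
          \<comment> \<open>Truncating \<open>r n\<close> to \<open>{0..s}\<close> keeps every time
            argument in \<open>{0..T}\<close>, where continuity is known; eventually the truncation
            does nothing.\<close>
          have "(\<lambda>n. op_adj (S (s - max 0 (min s (r n)))) (M s (S (s - max 0 (min s (r n))) x)))
              \<longlonglongrightarrow> op_adj (S (s - t)) (M s (S (s - t) x))"
          proof (rule continuous_on_tendsto_compose[OF conj_continuous[of "M s" x]])
            have "(\<lambda>n. s - max 0 (min s (r n))) \<longlonglongrightarrow> s - max 0 (min s t)"
              by (intro tendsto_intros lim)
            then show "(\<lambda>n. s - max 0 (min s (r n))) \<longlonglongrightarrow> s - t" using s t by simp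
            show "\<forall>\<^sub>F n in sequentially. s - max 0 (min s (r n)) \<in> {0..T}"
              using s t by (intro always_eventually allI) (auto simp: max_def min_def)
          qed (use s t in auto)
          moreover have "\<forall>\<^sub>F n in sequentially.
              op_adj (S (s - max 0 (min s (r n)))) (M s (S (s - max 0 (min s (r n))) x)) = ?f (r n) s"
            using ev
          proof eventually_elim
            case (elim n)
            have "0 \<le> r n" using r by simp
            then show ?case using elim s by simp
          qed
          ultimately have "(\<lambda>n. ?f (r n) s) \<longlonglongrightarrow> op_adj (S (s - t)) (M s (S (s - t) x))"
            by (rule Lim_transform_eventually)
          then show ?thesis using s by simp
        qed
      qed
    qed
    then show "(\<lambda>n. integral\<^sup>L (lebesgue_on {r n..T}) (\<lambda>s. op_adj (S (s - r n)) (M s (S (s - r n) x))))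
        \<longlonglongrightarrow> integral\<^sup>L (lebesgue_on {t..T}) (\<lambda>s. op_adj (S (s - t)) (M s (S (s - t) x)))"
      by (simp add: integral_lebesgue_on_eq)
  qed
  have "continuous_on {0..T} (\<lambda>t. op_adj (S (T - t)) (G (S (T - t) x)))"
    by (rule continuous_on_compose2[OF conj_continuous[of G x]]) (auto intro!: continuous_intros)
  from continuous_on_add[OF this cint] show ?thesis
    by (rule continuous_on_cong[THEN iffD1, rotated 2]) (auto simp: mild_op_apply)
qed

end

end

section \<open>Operator series and the cost functional\<close>

text \<open>The sum of the operators E_i^* P E_i exists as a form bounded by \<open>k\<close>; put
  this way, no definite description is involved.\<close>

definition series_bound ::
  "('h::{real_inner, banach, second_countable_topology} \<Rightarrow>\<^sub>L 'h)
    \<Rightarrow> (nat \<Rightarrow> 'a::{real_inner, banach, second_countable_topology} \<Rightarrow>\<^sub>L 'h) \<Rightarrow> real \<Rightarrow> bool"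
  where "series_bound P E k \<longleftrightarrow>
    (\<forall>x. summable (\<lambda>i. P (E i x) \<bullet> E i x) \<and> (\<Sum>i. P (E i x) \<bullet> E i x) \<le> k * (norm x)\<^sup>2)"

lemma series_boundD:
  fixes P :: "'h::{real_inner, banach, second_countable_topology} \<Rightarrow>\<^sub>L 'h"
    and E :: "nat \<Rightarrow> 'a::{real_inner, banach, second_countable_topology} \<Rightarrow>\<^sub>L 'h"
  assumes "series_bound P E k"
  shows "summable (\<lambda>i. P (E i x) \<bullet> E i x)" "(\<Sum>i. P (E i x) \<bullet> E i x) \<le> k * (norm x)\<^sup>2"
  using assms unfolding series_bound_def by blast+

lemma series_bound_sum_le:
  fixes P :: "'h::{real_inner, banach, second_countable_topology} \<Rightarrow>\<^sub>L 'h"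
    and E :: "nat \<Rightarrow> 'a::{real_inner, banach, second_countable_topology} \<Rightarrow>\<^sub>L 'h"
  assumes "series_bound P E k" "P \<in> nonneg_ops" "finite I"
  shows "(\<Sum>i\<in>I. P (E i x) \<bullet> E i x) \<le> k * (norm x)\<^sup>2"
proof -
  have "(\<Sum>i\<in>I. P (E i x) \<bullet> E i x) \<le> (\<Sum>i. P (E i x) \<bullet> E i x)"
    by (rule sum_le_suminf[OF series_boundD(1)[OF assms(1)] assms(3)]) (rule nonneg_opsD(2)[OF assms(2)])
  then show ?thesis using series_boundD(2)[OF assms(1), of x] by linarith
qed

lemma series_bound_partialI:
  fixes P :: "'h::{real_inner, banach, second_countable_topology} \<Rightarrow>\<^sub>L 'h"
    and E :: "nat \<Rightarrow> 'a::{real_inner, banach, second_countable_topology} \<Rightarrow>\<^sub>L 'h"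
  assumes P: "P \<in> nonneg_ops" and bd: "\<And>n x. (\<Sum>i<n. P (E i x) \<bullet> E i x) \<le> k * (norm x)\<^sup>2"
  shows "series_bound P E k"
  unfolding series_bound_def
proof (intro allI conjI)
  fix x
  show s: "summable (\<lambda>i. P (E i x) \<bullet> E i x)"
    by (rule summableI_nonneg_bounded[where x="k * (norm x)\<^sup>2"]) (use P bd in \<open>auto simp: nonneg_opsD(2)\<close>)
  show "(\<Sum>i. P (E i x) \<bullet> E i x) \<le> k * (norm x)\<^sup>2"
    by (rule suminf_le_const[OF s bd])
qed

lemma series_bound_mono:
  assumes "series_bound P E k" "k \<le> k'"
  shows "series_bound P E k'"
  using assms unfolding series_bound_def by (meson mult_right_mono order_trans zero_le_power2)

lemma series_bound_of_norm:
  fixes P :: "'h::{real_inner, banach, second_countable_topology} \<Rightarrow>\<^sub>L 'h"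
    and D :: "nat \<Rightarrow> 'a::{real_inner, banach, second_countable_topology} \<Rightarrow>\<^sub>L 'h"
  assumes P: "P \<in> nonneg_ops" and b: "norm P \<le> b" and c: "0 \<le> c"
    and D: "\<And>v. summable (\<lambda>i. (norm (D i v))\<^sup>2)" "\<And>v. (\<Sum>i. (norm (D i v))\<^sup>2) \<le> c * (norm v)\<^sup>2"
  shows "series_bound P D (b * c)"
proof (rule series_bound_partialI[OF P])
  fix n v
  have b0: "0 \<le> b" using b norm_ge_zero order_trans by blast
  have "(\<Sum>i<n. P (D i v) \<bullet> D i v) \<le> (\<Sum>i<n. b * (norm (D i v))\<^sup>2)"
  proof (rule sum_mono)
    fix i
    have "P (D i v) \<bullet> D i v \<le> norm P * (norm (D i v))\<^sup>2" using form_le_norm[of P "D i v"] by linarith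
    also have "\<dots> \<le> b * (norm (D i v))\<^sup>2" by (rule mult_right_mono[OF b]) simp
    finally show "P (D i v) \<bullet> D i v \<le> b * (norm (D i v))\<^sup>2" .
  qed
  also have "\<dots> = b * (\<Sum>i<n. (norm (D i v))\<^sup>2)" by (simp add: sum_distrib_left)
  also have "\<dots> \<le> b * (c * (norm v)\<^sup>2)"
    by (intro mult_left_mono b0 order_trans[OF sum_le_suminf[OF D(1)] D(2)]) auto
  finally show "(\<Sum>i<n. P (D i v) \<bullet> D i v) \<le> b * c * (norm v)\<^sup>2" by (simp add: mult_ac)
qed

text \<open>Uniform boundedness applied to the partial sums, which are quadratic functionals. It is
  needed for given solutions, where summability is known only vector by vector.\<close>

lemma form_summable_imp_series_bound:
  fixes E :: "nat \<Rightarrow> 'a::{real_inner, banach, second_countable_topology} \<Rightarrow>\<^sub>L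
    'h::{real_inner, banach, second_countable_topology}"
  assumes P: "P \<in> nonneg_ops" and sm: "\<And>x. summable (\<lambda>i. P (E i x) \<bullet> E i x)"
  obtains k where "k \<ge> 0" "series_bound P E k"
proof -
  have P0: "0 \<le> P y \<bullet> y" for y by (rule nonneg_opsD(2)[OF P])
  obtain K where K: "K \<ge> 0" "\<And>n x. n \<in> UNIV \<Longrightarrow> (\<Sum>i<n. P (E i x) \<bullet> E i x) \<le> K * (norm x)\<^sup>2"
  proof (rule uniform_bound_quadratic[of UNIV "\<lambda>n x. \<Sum>i<n. P (E i x) \<bullet> E i x"])
    show "continuous_on UNIV (\<lambda>x. \<Sum>i<n. P (E i x) \<bullet> E i x)" for n
      by (intro continuous_intros)
    show "(\<Sum>i<n. P (E i (x - y)) \<bullet> E i (x - y)) \<le>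
        2 * (\<Sum>i<n. P (E i x) \<bullet> E i x) + 2 * (\<Sum>i<n. P (E i y) \<bullet> E i y)" for n x y
      unfolding sum_distrib_left sum.distrib[symmetric]
    proof (rule sum_mono)
      fix i
      show "P (E i (x - y)) \<bullet> E i (x - y) \<le> 2 * (P (E i x) \<bullet> E i x) + 2 * (P (E i y) \<bullet> E i y)"
        using nonneg_ops_add_le[OF P, of "E i x" "- E i y"] by (simp add: blinfun.bilinear_simps)
    qed
    show "(\<Sum>i<n. P (E i (r *\<^sub>R x)) \<bullet> E i (r *\<^sub>R x)) = r\<^sup>2 * (\<Sum>i<n. P (E i x) \<bullet> E i x)" for n r x
      by (simp add: blinfun.scaleR_right sum_distrib_left power2_eq_square mult_ac)
    show "\<exists>b. \<forall>n\<in>UNIV. (\<Sum>i<n. P (E i x) \<bullet> E i x) \<le> b" for x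
      by (intro exI[of _ "\<Sum>i. P (E i x) \<bullet> E i x"] ballI sum_le_suminf sm) (auto simp: P0)
  qed blast
  show thesis
    by (rule that[OF K(1) series_bound_partialI[OF P]]) (rule K(2), simp)
qed

lemma series_pair_summable:
  fixes P :: "'h::{real_inner, banach, second_countable_topology} \<Rightarrow>\<^sub>L 'h"
  assumes P: "P \<in> nonneg_ops"
    and "summable (\<lambda>i. P (u i) \<bullet> u i)" "summable (\<lambda>i. P (w i) \<bullet> w i)"
  shows "summable (\<lambda>i. P (u i) \<bullet> w i)"
proof (rule summable_comparison_test')
  show "summable (\<lambda>i. P (u i) \<bullet> u i + P (w i) \<bullet> w i)" by (intro summable_add assms)
  fix i :: nat assume "i \<ge> 0"
  have "0 \<le> P (u i) \<bullet> u i" "0 \<le> P (w i) \<bullet> w i" using nonneg_opsD(2)[OF P] by blast+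
  then show "norm (P (u i) \<bullet> w i) \<le> P (u i) \<bullet> u i + P (w i) \<bullet> w i"
    using nonneg_ops_young[OF P zero_less_one, of "u i" "w i"] by simp
qed

text \<open>Young's inequality makes the polarised series absolutely convergent and bounded, so a
  bounded bilinear form exists; the operator representing it is the witness for
  \<open>form_sum\<close>.\<close>

lemma form_sum_series:
  fixes E :: "nat \<Rightarrow> 'a::{real_inner, banach, second_countable_topology} \<Rightarrow>\<^sub>L
    'h::{real_inner, banach, second_countable_topology}"
  assumes P: "P \<in> nonneg_ops" and bd: "series_bound P E k"
  defines "M \<equiv> form_sum (\<lambda>i. op_adj (E i) o\<^sub>L P o\<^sub>L E i)"
  shows "op_adj M = M" "\<And>x. (\<lambda>i. P (E i x) \<bullet> E i x) sums (M x \<bullet> x)"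
proof -
  define b where "b x y = (\<Sum>i. P (E i x) \<bullet> E i y)" for x y
  have sm: "summable (\<lambda>i. P (E i x) \<bullet> E i y)" for x y
    by (rule series_pair_summable[OF P series_boundD(1)[OF bd] series_boundD(1)[OF bd]])
  have lin1: "linear (\<lambda>x. b x y)" for y
    by (rule linearI)
      (simp_all add: b_def blinfun.bilinear_simps inner_simps suminf_add[OF sm sm, symmetric] suminf_mult[OF sm])
  have lin2: "linear (b x)" for x
    by (rule linearI)
      (simp_all add: b_def blinfun.bilinear_simps inner_simps suminf_add[OF sm sm, symmetric] suminf_mult[OF sm])
  have "\<bar>b x y\<bar> \<le> k / 2 * ((norm x)\<^sup>2 + (norm y)\<^sup>2)" for x y
  proof -
    have t: "\<bar>P (E i x) \<bullet> E i y\<bar> \<le> 1/2 * (P (E i x) \<bullet> E i x) + 1/2 * (P (E i y) \<bullet> E i y)" for i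
      using nonneg_ops_young[OF P zero_less_one, of "E i x" "E i y"] by simp
    have s2: "summable (\<lambda>i. 1/2 * (P (E i x) \<bullet> E i x) + 1/2 * (P (E i y) \<bullet> E i y))"
      by (intro summable_add summable_mult sm)
    have s1: "summable (\<lambda>i. \<bar>P (E i x) \<bullet> E i y\<bar>)"
      by (rule summable_comparison_test'[OF s2]) (use t in simp)
    have "\<bar>b x y\<bar> \<le> (\<Sum>i. \<bar>P (E i x) \<bullet> E i y\<bar>)"
      unfolding b_def by (rule summable_rabs[OF s1])
    also have "\<dots> \<le> (\<Sum>i. 1/2 * (P (E i x) \<bullet> E i x) + 1/2 * (P (E i y) \<bullet> E i y))"
      by (rule suminf_le[OF t s1 s2])
    also have "\<dots> = 1/2 * (\<Sum>i. P (E i x) \<bullet> E i x) + 1/2 * (\<Sum>i. P (E i y) \<bullet> E i y)"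
      by (rule sums_unique[symmetric]) (intro sums_add sums_mult summable_sums sm)
    also have "\<dots> \<le> 1/2 * (k * (norm x)\<^sup>2) + 1/2 * (k * (norm y)\<^sup>2)"
      by (intro add_mono mult_left_mono series_boundD(2)[OF bd]) auto
    finally show ?thesis by (simp add: algebra_simps)
  qed
  then have "\<bar>b x y\<bar> \<le> k * norm x * norm y" for x y
    by (intro bilinear_bound_homogeneous lin1 lin2)
  then obtain F :: "'a \<Rightarrow>\<^sub>L 'a" where F: "\<And>x y. b x y = x \<bullet> F y"
    using bounded_form_represents[OF lin1 lin2] by blast
  have bsym: "b x y = b y x" for x y
    unfolding b_def by (intro suminf_cong) (metis inner_commute nonneg_opsD(3)[OF P])
  have sa: "op_adj F = F"
    by (rule op_adj_eqI) (metis F bsym inner_commute)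
  have sums: "(\<lambda>i. P (E i x) \<bullet> E i x) sums (F x \<bullet> x)" for x
    using summable_sums[OF sm[of x x]] F[of x x] by (simp add: b_def inner_commute)
  have "M = F"
    unfolding M_def by (rule form_sum_eq[OF sa]) (use sums in \<open>simp add: inner_op_adj'\<close>)
  then show "op_adj M = M" "\<And>x. (\<lambda>i. P (E i x) \<bullet> E i x) sums (M x \<bullet> x)" using sa sums by simp_all
qed

text \<open>Weak convergence of the series is immediate; strong convergence needs norm control of
  finite blocks. Testing a block against itself bounds it by the corresponding block of the
  convergent scalar series for \<open>E\<close>.\<close>

lemma strong_sum_series:
  fixes E :: "nat \<Rightarrow> 'a::{real_inner, banach, second_countable_topology} \<Rightarrow>\<^sub>L
      'h::{real_inner, banach, second_countable_topology}"
    and D :: "nat \<Rightarrow> 'u::{real_inner, banach, second_countable_topology} \<Rightarrow>\<^sub>L 'h"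
  assumes P: "P \<in> nonneg_ops" and bE: "series_bound P E k" and bD: "series_bound P D m" and m: "m \<ge> 0"
  defines "M \<equiv> strong_sum (\<lambda>i. op_adj (D i) o\<^sub>L P o\<^sub>L E i)"
  shows "(\<lambda>i. P (E i x) \<bullet> D i v) sums (M x \<bullet> v)"
proof -
  define f where "f x i = op_adj (D i) (P (E i x))" for x i
  have P0: "0 \<le> P y \<bullet> y" for y by (rule nonneg_opsD(2)[OF P])
  \<comment> \<open>With z the block sum, Young with weight \<open>m + 1\<close> leaves at most the
    square of \<open>norm z\<close> from the \<open>D\<close> terms, half of what stands on the
    left. Using \<open>m + 1\<close> instead of \<open>m\<close> avoids dividing by zero.\<close>
  have bound: "(norm (sum (f x) I))\<^sup>2 \<le> (m + 1) * (\<Sum>i\<in>I. P (E i x) \<bullet> E i x)" if I: "finite I" for x I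
  proof -
    define z where "z = sum (f x) I"
    have "2 * (norm z)\<^sup>2 = (\<Sum>i\<in>I. 2 * (P (E i x) \<bullet> D i z))"
      by (simp add: power2_norm_eq_inner sum_distrib_left[symmetric])
        (simp add: z_def f_def inner_sum_left inner_op_adj')
    also have "\<dots> \<le> (\<Sum>i\<in>I. (m + 1) * (P (E i x) \<bullet> E i x) + (P (D i z) \<bullet> D i z) / (m + 1))"
    proof (rule sum_mono)
      fix i
      have "m + 1 > 0" using m by simp
      from nonneg_ops_young[OF P this, of "E i x" "D i z"]
      show "2 * (P (E i x) \<bullet> D i z) \<le> (m + 1) * (P (E i x) \<bullet> E i x) + (P (D i z) \<bullet> D i z) / (m + 1)"
        by linarith
    qed
    also have "\<dots> = (m + 1) * (\<Sum>i\<in>I. P (E i x) \<bullet> E i x) + (\<Sum>i\<in>I. P (D i z) \<bullet> D i z) / (m + 1)"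
      by (simp add: sum.distrib sum_distrib_left sum_divide_distrib)
    also have "(\<Sum>i\<in>I. P (D i z) \<bullet> D i z) / (m + 1) \<le> (norm z)\<^sup>2"
    proof -
      have "(\<Sum>i\<in>I. P (D i z) \<bullet> D i z) \<le> m * (norm z)\<^sup>2"
        by (rule series_bound_sum_le[OF bD P I])
      also have "\<dots> \<le> (m + 1) * (norm z)\<^sup>2" by (intro mult_right_mono) auto
      finally show ?thesis using m by (simp add: divide_le_eq mult.commute)
    qed
    finally show ?thesis by (simp add: z_def)
  qed
  have sm: "summable (f x)" for x
    unfolding summable_Cauchy
  proof (intro allI impI)
    fix e :: real assume e: "e > 0"
    then have "e\<^sup>2 / (m + 1) > 0" using m by simp
    then obtain n0 where n0: "\<And>a b. a \<ge> n0 \<Longrightarrow> norm (\<Sum>i\<in>{a..<b}. P (E i x) \<bullet> E i x) < e\<^sup>2 / (m + 1)"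
      using series_boundD(1)[OF bE, of x] unfolding summable_Cauchy by meson
    show "\<exists>N. \<forall>a\<ge>N. \<forall>b. norm (sum (f x) {a..<b}) < e"
    proof (intro exI allI impI)
      fix a b assume "n0 \<le> a"
      have "(norm (sum (f x) {a..<b}))\<^sup>2 \<le> (m + 1) * (\<Sum>i\<in>{a..<b}. P (E i x) \<bullet> E i x)"
        by (rule bound) simp
      also have "\<dots> < (m + 1) * (e\<^sup>2 / (m + 1))"
        using n0[OF \<open>n0 \<le> a\<close>, of b] m by (intro mult_strict_left_mono) auto
      also have "\<dots> = e\<^sup>2" using m by simp
      finally show "norm (sum (f x) {a..<b}) < e" using e by (simp add: power2_less_imp_less)
    qed
  qed
  define g where "g x = (\<Sum>i. f x i)" for x
  have fs: "f x sums g x" for x unfolding g_def by (rule summable_sums[OF sm])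
  have gbound: "(norm (g x))\<^sup>2 \<le> (m + 1) * (k * (norm x)\<^sup>2)" for x
  proof (rule LIMSEQ_le_const2)
    show "(\<lambda>n. (norm (sum (f x) {..<n}))\<^sup>2) \<longlonglongrightarrow> (norm (g x))\<^sup>2"
      using fs[of x] unfolding sums_def by (intro tendsto_intros)
    show "\<exists>N. \<forall>n\<ge>N. (norm (sum (f x) {..<n}))\<^sup>2 \<le> (m + 1) * (k * (norm x)\<^sup>2)"
      using m by (intro exI allI impI order_trans[OF bound] mult_left_mono series_bound_sum_le[OF bE P]) auto
  qed
  have "bounded_linear g"
  proof (rule bounded_linear_intro)
    show "g (x + y) = g x + g y" for x y
    proof (rule sums_unique2[OF fs])
      have "f (x + y) = (\<lambda>i. f x i + f y i)" by (simp add: f_def fun_eq_iff blinfun.bilinear_simps)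
      then show "f (x + y) sums (g x + g y)" by (simp only:) (intro sums_add fs)
    qed
    show "g (r *\<^sub>R x) = r *\<^sub>R g x" for r x
    proof (rule sums_unique2[OF fs])
      have "f (r *\<^sub>R x) = (\<lambda>i. r *\<^sub>R f x i)" by (simp add: f_def fun_eq_iff blinfun.bilinear_simps)
      then show "f (r *\<^sub>R x) sums (r *\<^sub>R g x)" by (simp only:) (intro sums_scaleR_right fs)
    qed
    show "norm (g x) \<le> norm x * sqrt ((m + 1) * \<bar>k\<bar>)" for x
    proof -
      have "(m + 1) * (k * (norm x)\<^sup>2) \<le> (m + 1) * (\<bar>k\<bar> * (norm x)\<^sup>2)"
        using m by (intro mult_left_mono mult_right_mono) auto
      then have "norm (g x) \<le> sqrt ((m + 1) * (\<bar>k\<bar> * (norm x)\<^sup>2))"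
        using gbound[of x] by (intro real_le_rsqrt) linarith
      then show ?thesis by (simp add: real_sqrt_mult mult_ac)
    qed
  qed
  then have Bg: "blinfun_apply (Blinfun g) = g" by (rule bounded_linear_Blinfun_apply)
  have "M = Blinfun g"
    unfolding M_def by (rule strong_sum_eq) (use fs in \<open>simp add: Bg f_def[abs_def]\<close>)
  then have "f x sums M x" using fs Bg by simp
  then have "(\<lambda>i. f x i \<bullet> v) sums (M x \<bullet> v)" by (rule bounded_linear.sums[OF bounded_linear_inner_left])
  then show ?thesis by (simp add: f_def inner_op_adj')
qed

text \<open>The quadratic cost whose pointwise minimum over the control \<open>v\<close> is the form of the bracket
  of the Riccati equation; the minimum is attained at \<open>v = \<lambda>(s,P)x\<close>.\<close>

definition cost ::
  "(real \<Rightarrow> 'u::{real_inner, banach, second_countable_topology}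
        \<Rightarrow>\<^sub>L 'h::{real_inner, banach, second_countable_topology})
    \<Rightarrow> (nat \<Rightarrow> real \<Rightarrow> 'h \<Rightarrow>\<^sub>L 'h) \<Rightarrow> (nat \<Rightarrow> real \<Rightarrow> 'u \<Rightarrow>\<^sub>L 'h)
    \<Rightarrow> (real \<Rightarrow> 'h \<Rightarrow>\<^sub>L 'h) \<Rightarrow> (real \<Rightarrow> 'u \<Rightarrow>\<^sub>L 'u)
    \<Rightarrow> real \<Rightarrow> ('h \<Rightarrow>\<^sub>L 'h) \<Rightarrow> 'h \<Rightarrow> 'u \<Rightarrow> real"
  where "cost B C D Q R s P x v =
    (\<Sum>i. P (C i s x + D i s v) \<bullet> (C i s x + D i s v)) + R s v \<bullet> v + Q s x \<bullet> x + 2 * (P x \<bullet> B s v)"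

text \<open>Complete the square: the cost is a quadratic polynomial in \<open>v\<close> with
  coercive leading part \<open>L\<close> and linear part \<open>N\<close>, and
  \<open>lambda_op\<close> solves \<open>L v = - N x\<close>. The operators defined by description
  inside the bracket are evaluated here once; afterwards the bracket is handled through its
  self-adjointness, its form and the cost.\<close>

lemma bracket_is_min_cost:
  fixes B :: "real \<Rightarrow> 'u::{real_inner, banach, second_countable_topology}
        \<Rightarrow>\<^sub>L 'h::{real_inner, banach, second_countable_topology}"
  assumes P: "P \<in> nonneg_ops" and bC: "series_bound P (\<lambda>i. C i s) k"
    and bD: "series_bound P (\<lambda>i. D i s) m" and m: "m \<ge> 0"
    and Q: "Q s \<in> nonneg_ops" and d: "d > 0" and R: "R s - d *\<^sub>R id_blinfun \<in> nonneg_ops"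
  defines "F \<equiv> riccati_bracket B C D Q R s P" and "J \<equiv> cost B C D Q R s P"
  shows "op_adj F = F"
    and "J x (lambda_op B C D R s P x) = F x \<bullet> x"
    and "F x \<bullet> x \<le> J x v"
    and "continuous_on UNIV (J x)"
    and "summable (\<lambda>i. P (C i s x + D i s v) \<bullet> (C i s x + D i s v))"
proof -
  define A where "A = form_sum (CPC C s P)"
  have A: "op_adj A = A" "\<And>x. (\<lambda>i. P (C i s x) \<bullet> C i s x) sums (A x \<bullet> x)"
    using form_sum_series[OF P bC] unfolding A_def CPC_def[abs_def] by blast+
  define L where "L = Lambda_op R D s P"
  define N where "N = (op_adj (B s) o\<^sub>L P) + strong_sum (\<lambda>i. op_adj (D i s) o\<^sub>L P o\<^sub>L C i s)"
  define l where "l = lambda_op B C D R s P"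
  have SD: "(\<lambda>i. P (D i s v) \<bullet> D i s w) sums (strong_sum (\<lambda>i. op_adj (D i s) o\<^sub>L P o\<^sub>L D i s) v \<bullet> w)" for v w
    by (rule strong_sum_series[OF P bD bD m])
  have SC: "(\<lambda>i. P (C i s x) \<bullet> D i s w) sums (strong_sum (\<lambda>i. op_adj (D i s) o\<^sub>L P o\<^sub>L C i s) x \<bullet> w)" for x w
    by (rule strong_sum_series[OF P bC bD m])
  have Linner: "L v \<bullet> w = R s v \<bullet> w + (\<Sum>i. P (D i s v) \<bullet> D i s w)" for v w
    using sums_unique[OF SD[of v w]] by (simp add: L_def Lambda_op_def blinfun.bilinear_simps inner_simps)
  have Ninner: "N x \<bullet> w = P x \<bullet> B s w + (\<Sum>i. P (C i s x) \<bullet> D i s w)" for x w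
    using sums_unique[OF SC[of x w]] by (simp add: N_def blinfun.bilinear_simps inner_simps inner_op_adj')
  have Rsym: "R s v \<bullet> w = v \<bullet> R s w" for v w
    using nonneg_opsD(3)[OF R, of v w] by (simp add: blinfun.bilinear_simps inner_simps)
  have Rge: "d * (norm v)\<^sup>2 \<le> R s v \<bullet> v" for v
    using nonneg_opsD(2)[OF R, of v] by (simp add: blinfun.bilinear_simps inner_simps power2_norm_eq_inner)
  have Psym: "P u \<bullet> w = P w \<bullet> u" for u w by (metis inner_commute nonneg_opsD(3)[OF P])
  have Lsa: "op_adj L = L"
  proof (rule op_adj_eqI)
    fix v w
    have "(\<Sum>i. P (D i s v) \<bullet> D i s w) = (\<Sum>i. P (D i s w) \<bullet> D i s v)"
      by (rule suminf_cong) (rule Psym)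
    then show "L v \<bullet> w = v \<bullet> L w" unfolding inner_commute[of v] Linner using Rsym[of v w] by (simp add: inner_commute)
  qed
  have Lge: "d * (norm v)\<^sup>2 \<le> L v \<bullet> v" for v
  proof -
    have "0 \<le> (\<Sum>i. P (D i s v) \<bullet> D i s v)"
      by (rule suminf_nonneg[OF series_boundD(1)[OF bD] nonneg_opsD(2)[OF P]])
    then show ?thesis using Rge[of v] Linner[of v v] by linarith
  qed
  have Ll: "L (l x) = - N x" for x
    using op_inverse_coercive(2)[OF Lsa Lge d, of "N x"]
    unfolding l_def lambda_op_def L_def[symmetric] N_def[symmetric] by (simp add: blinfun.bilinear_simps)
  have Fx: "F x = A x + Q s x - op_adj l (L (l x))" for x
    unfolding F_def riccati_bracket_def A_def[symmetric] L_def[symmetric] l_def[symmetric]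
    by (simp add: blinfun.bilinear_simps)
  show "op_adj F = F"
  proof (rule op_adj_eqI)
    fix x y
    have "op_adj l (L (l x)) \<bullet> y = x \<bullet> op_adj l (L (l y))"
      by (metis inner_op_adj inner_op_adj' selfadj_inner[OF Lsa])
    then show "F x \<bullet> y = x \<bullet> F y"
      using selfadj_inner[OF A(1), of x y] nonneg_opsD(3)[OF Q, of x y] by (simp add: Fx inner_simps)
  qed
  have expand: "(\<lambda>i. P (C i s x + D i s v) \<bullet> (C i s x + D i s v)) sums
      (A x \<bullet> x + 2 * (\<Sum>i. P (C i s x) \<bullet> D i s v) + (\<Sum>i. P (D i s v) \<bullet> D i s v))" for x v
  proof -
    have "(\<lambda>i. P (C i s x) \<bullet> C i s x + 2 * (P (C i s x) \<bullet> D i s v) + P (D i s v) \<bullet> D i s v) sums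
      (A x \<bullet> x + 2 * (\<Sum>i. P (C i s x) \<bullet> D i s v) + (\<Sum>i. P (D i s v) \<bullet> D i s v))"
      by (intro sums_add sums_mult A(2) summable_sums[OF sums_summable[OF SC]] summable_sums[OF sums_summable[OF SD]])
    moreover have "P (C i s x) \<bullet> C i s x + 2 * (P (C i s x) \<bullet> D i s v) + P (D i s v) \<bullet> D i s v =
        P (C i s x + D i s v) \<bullet> (C i s x + D i s v)" for i
      using Psym[of "D i s v" "C i s x"] by (simp add: blinfun.bilinear_simps inner_simps)
    ultimately show ?thesis by simp
  qed
  show "summable (\<lambda>i. P (C i s x + D i s v) \<bullet> (C i s x + D i s v))"
    by (rule sums_summable[OF expand])
  have Jeq: "J x v = A x \<bullet> x + Q s x \<bullet> x + 2 * (N x \<bullet> v) + L v \<bullet> v" for x v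
    unfolding J_def cost_def sums_unique[OF expand, symmetric] Linner Ninner by simp
  then have "J x = (\<lambda>v. A x \<bullet> x + Q s x \<bullet> x + 2 * (N x \<bullet> v) + L v \<bullet> v)" by (simp add: fun_eq_iff)
  then show "continuous_on UNIV (J x)" by (simp only:) (intro continuous_intros)
  have Fform: "F x \<bullet> x = A x \<bullet> x + Q s x \<bullet> x - L (l x) \<bullet> l x" for x
    by (simp add: Fx inner_simps inner_op_adj')
  have Nv: "N x \<bullet> v = - (L (l x) \<bullet> v)" for v using Ll[of x] by simp
  show "J x (lambda_op B C D R s P x) = F x \<bullet> x"
    unfolding l_def[symmetric] Jeq Fform using Nv[of "l x"] by simp
  \<comment> \<open>This is exactly the gap between the cost at \<open>v\<close> and the form of the
    bracket.\<close>
  have "0 \<le> L (v - l x) \<bullet> (v - l x)"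
    using Lge[of "v - l x"] d by (meson less_imp_le mult_nonneg_nonneg order_trans zero_le_power2)
  also have "\<dots> = L v \<bullet> v - 2 * (L (l x) \<bullet> v) + L (l x) \<bullet> l x"
    using selfadj_inner[OF Lsa, of v "l x"] by (simp add: blinfun.bilinear_simps inner_simps inner_commute)
  finally show "F x \<bullet> x \<le> J x v" unfolding Jeq Fform using Nv[of v] by simp
qed

section \<open>The bracket of the Riccati equation\<close>

text \<open>Completeness of Lebesgue measure. The minimum formula for the bracket is known only for
  almost every s, so measurability has to survive changes on a null set.\<close>

lemma sets_lebesgue_on_AE:
  fixes A :: "real set"
  assumes A: "A \<in> sets lebesgue" and Q: "{s \<in> A. Q s} \<in> sets (lebesgue_on A)"
    and ae: "AE s in lebesgue_on A. P s \<longleftrightarrow> Q s"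
  shows "{s \<in> A. P s} \<in> sets (lebesgue_on A)"
proof -
  have "{s \<in> A. P s} \<in> sets lebesgue"
  proof (rule completion.in_sets_AE)
    show "{s \<in> A. Q s} \<in> sets lebesgue" using Q A by (simp add: sets_restrict_space_iff)
    have "AE s in lebesgue. s \<in> A \<longrightarrow> (P s \<longleftrightarrow> Q s)" by (rule AE_lebesgue_on_iff[THEN iffD1, OF A ae])
    then show "AE s in lebesgue. (s \<in> {s \<in> A. Q s}) = (s \<in> {s \<in> A. P s})" by eventually_elim auto
  qed simp
  then show ?thesis using A by (simp add: sets_restrict_space_iff)
qed

lemma borel_measurable_lebesgue_on_AE:
  fixes A :: "real set" and f g :: "real \<Rightarrow> 'b::topological_space"
  assumes A: "A \<in> sets lebesgue" and f: "f \<in> borel_measurable (lebesgue_on A)"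
    and ae: "AE s in lebesgue_on A. g s = f s"
  shows "g \<in> borel_measurable (lebesgue_on A)"
proof (rule borel_measurableI)
  fix U :: "'b set" assume "open U"
  then have "f -` U \<inter> space (lebesgue_on A) \<in> sets (lebesgue_on A)"
    by (intro measurable_sets[OF f]) auto
  moreover have "f -` U \<inter> space (lebesgue_on A) = {s \<in> A. f s \<in> U}" by auto
  moreover have "AE s in lebesgue_on A. g s \<in> U \<longleftrightarrow> f s \<in> U" using ae by eventually_elim simp
  ultimately have "{s \<in> A. g s \<in> U} \<in> sets (lebesgue_on A)"
    using sets_lebesgue_on_AE[OF A, of "\<lambda>s. f s \<in> U" "\<lambda>s. g s \<in> U"] by simp
  moreover have "g -` U \<inter> space (lebesgue_on A) = {s \<in> A. g s \<in> U}" by auto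
  ultimately show "g -` U \<inter> space (lebesgue_on A) \<in> sets (lebesgue_on A)" by simp
qed

section \<open>Coefficients, and consequences of the minimum formula for the bracket\<close>

locale riccati_data = semigroup_on T S
  for T :: real and S :: "real \<Rightarrow> 'h::{real_inner, banach, second_countable_topology} \<Rightarrow>\<^sub>L 'h" +
  fixes B :: "real \<Rightarrow> 'u::{real_inner, banach, second_countable_topology} \<Rightarrow>\<^sub>L 'h"
    and C :: "nat \<Rightarrow> real \<Rightarrow> 'h \<Rightarrow>\<^sub>L 'h"
    and D :: "nat \<Rightarrow> real \<Rightarrow> 'u \<Rightarrow>\<^sub>L 'h"
    and Q :: "real \<Rightarrow> 'h \<Rightarrow>\<^sub>L 'h"
    and R :: "real \<Rightarrow> 'u \<Rightarrow>\<^sub>L 'u"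
    and G :: "'h \<Rightarrow>\<^sub>L 'h"
    and \<alpha> c \<delta> b q :: real
  assumes Bm: "\<And>v. (\<lambda>s. B s v) \<in> borel_measurable (lebesgue_on {0..T})"
    and Cm: "\<And>i x. (\<lambda>s. C i s x) \<in> borel_measurable (lebesgue_on {0..T})"
    and Dm: "\<And>i v. (\<lambda>s. D i s v) \<in> borel_measurable (lebesgue_on {0..T})"
    and Qm: "\<And>x. (\<lambda>s. Q s x) \<in> borel_measurable (lebesgue_on {0..T})"
    and Rm: "\<And>v. (\<lambda>s. R s v) \<in> borel_measurable (lebesgue_on {0..T})"
    and G: "G \<in> nonneg_ops"
    and \<delta>: "\<delta> > 0" and b0: "0 \<le> b" and q0: "0 \<le> q"
    and coefficients: "AE s in lebesgue_on {0..T}. norm (B s) \<le> b \<and> Q s \<in> nonneg_ops \<and> norm (Q s) \<le> q \<and>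
          R s - \<delta> *\<^sub>R id_blinfun \<in> nonneg_ops"
    and \<alpha>: "0 < \<alpha>" "\<alpha> < 1 / 2" and c: "c > 0"
    and SC: "\<And>t s x. t > 0 \<Longrightarrow> s \<in> {0..T} \<Longrightarrow> summable (\<lambda>j. (norm (S t (C j s x)))\<^sup>2) \<and>
        (\<Sum>j. (norm (S t (C j s x)))\<^sup>2) \<le> c * t powr (- 2 * \<alpha>) * (norm x)\<^sup>2"
    and DD: "\<And>s v. s \<in> {0..T} \<Longrightarrow> summable (\<lambda>j. (norm (D j s v))\<^sup>2) \<and>
        (\<Sum>j. (norm (D j s v))\<^sup>2) \<le> c * (norm v)\<^sup>2"
begin

text \<open>One exceptional null set serves all coefficients. The endpoint T belongs to it because
  \<open>0 powr a\<close> is 0, so that a bound by \<open>(T - s) powr (- 2 * \<alpha>)\<close>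
  would force the value 0 there.\<close>

definition good :: "real \<Rightarrow> bool" where
  "good s \<longleftrightarrow> s \<in> {0..<T} \<and> norm (B s) \<le> b \<and> Q s \<in> nonneg_ops \<and> norm (Q s) \<le> q \<and>
    R s - \<delta> *\<^sub>R id_blinfun \<in> nonneg_ops"

lemma goodD:
  assumes "good s"
  shows "s \<in> {0..T}" "s \<in> {0..<T}" "norm (B s) \<le> b" "Q s \<in> nonneg_ops" "norm (Q s) \<le> q"
    "R s - \<delta> *\<^sub>R id_blinfun \<in> nonneg_ops"
  using assms by (simp_all add: good_def)

lemma AE_good: "AE s in lebesgue_on {0..T}. good s"
proof -
  have "AE s in lebesgue. s \<noteq> T" by (rule AE_completion) (rule AE_lborel_singleton)
  then have "AE s in lebesgue. s \<in> {0..T} \<longrightarrow> s \<noteq> T" by eventually_elim simp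
  then have "AE s in lebesgue_on {0..T}. s \<noteq> T" by (subst AE_lebesgue_on_iff) simp_all
  with coefficients AE_space show ?thesis
    by eventually_elim (simp add: good_def)
qed

lemma R_ge:
  assumes "good s"
  shows "\<delta> * (norm v)\<^sup>2 \<le> R s v \<bullet> v"
  using nonneg_opsD(2)[OF goodD(6)[OF assms], of v]
  by (simp add: blinfun.bilinear_simps inner_simps power2_norm_eq_inner)

abbreviation bracket :: "real \<Rightarrow> ('h \<Rightarrow>\<^sub>L 'h) \<Rightarrow> ('h \<Rightarrow>\<^sub>L 'h)"
  where "bracket s P \<equiv> riccati_bracket B C D Q R s P"

abbreviation J :: "real \<Rightarrow> ('h \<Rightarrow>\<^sub>L 'h) \<Rightarrow> 'h \<Rightarrow> 'u \<Rightarrow> real"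
  where "J \<equiv> cost B C D Q R"

lemma series_bound_D:
  assumes "s \<in> {0..T}" "P \<in> nonneg_ops" "norm P \<le> \<beta>"
  shows "series_bound P (\<lambda>i. D i s) (\<beta> * c)"
  using DD[OF assms(1)] c by (intro series_bound_of_norm assms) auto

context
  fixes s \<beta> k :: real and P :: "'h \<Rightarrow>\<^sub>L 'h"
  assumes good: "good s" and P: "P \<in> nonneg_ops" and \<beta>: "norm P \<le> \<beta>"
    and bC: "series_bound P (\<lambda>i. C i s) k"
begin

lemma beta_nonneg: "0 \<le> \<beta>"
  using \<beta> norm_ge_zero order_trans by blast

lemma beta_c_nonneg: "0 \<le> \<beta> * c"
  using beta_nonneg c by simp

lemmas min_facts = bracket_is_min_cost[where s=s and C=C and D=D and Q=Q and R=R, OF P bC series_bound_D[OF goodD(1)[OF good] P \<beta>] beta_c_nonneg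
    goodD(4)[OF good] \<delta> goodD(6)[OF good]]

lemma bracket_selfadj: "op_adj (bracket s P) = bracket s P"
  by (rule min_facts(1)[where B=B])

lemma cost_0: "J s P x 0 = (\<Sum>i. P (C i s x) \<bullet> C i s x) + Q s x \<bullet> x"
  by (simp add: cost_def)

lemma Q_le: "Q s x \<bullet> x \<le> q * (norm x)\<^sup>2"
proof -
  have "Q s x \<bullet> x \<le> norm (Q s) * (norm x)\<^sup>2" using form_le_norm[of "Q s" x] by linarith
  also have "\<dots> \<le> q * (norm x)\<^sup>2" by (rule mult_right_mono[OF goodD(5)[OF good]]) simp
  finally show ?thesis .
qed

lemma bracket_upper: "bracket s P x \<bullet> x \<le> (k + q) * (norm x)\<^sup>2"
proof -
  have "bracket s P x \<bullet> x \<le> J s P x 0" by (rule min_facts(3))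
  also have "\<dots> \<le> k * (norm x)\<^sup>2 + q * (norm x)\<^sup>2"
    unfolding cost_0 by (intro add_mono series_boundD(2)[OF bC] Q_le)
  finally show ?thesis by (simp add: distrib_right)
qed

lemma cost_lower:
  "\<delta> * (norm v)\<^sup>2 + Q s x \<bullet> x - 2 * (b * norm (P x) * norm v) \<le> J s P x v"
proof -
  have "0 \<le> (\<Sum>i. P (C i s x + D i s v) \<bullet> (C i s x + D i s v))"
    by (rule suminf_nonneg[OF min_facts(5) nonneg_opsD(2)[OF P]])
  moreover have "\<bar>P x \<bullet> B s v\<bar> \<le> b * norm (P x) * norm v"
  proof -
    have "\<bar>P x \<bullet> B s v\<bar> \<le> norm (P x) * norm (B s v)" by (rule Cauchy_Schwarz_ineq2)
    also have "\<dots> \<le> norm (P x) * (b * norm v)"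
      by (intro mult_left_mono order_trans[OF norm_blinfun] mult_right_mono goodD(3)[OF good]) auto
    finally show ?thesis by (simp add: mult_ac)
  qed
  ultimately show ?thesis using R_ge[OF good, of v] unfolding cost_def by linarith
qed

text \<open>The minimal cost is at most the cost of \<open>v = 0\<close>; the \<open>Q\<close> terms
  cancel, and half of the coercive term absorbs the drift. The bound is linear in \<open>k\<close>,
  so the optimal control inherits a singularity of order (T-s)^(-2\<alpha>) in its square and no
  worse.\<close>

lemma control_bound:
  "(norm (lambda_op B C D R s P x))\<^sup>2 \<le> 2 / \<delta> * (k + 2 * b\<^sup>2 * \<beta>\<^sup>2 / \<delta>) * (norm x)\<^sup>2"
proof -
  define l where "l = lambda_op B C D R s P x"
  have "J s P x l = bracket s P x \<bullet> x" unfolding l_def by (rule min_facts(2))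
  also have "\<dots> \<le> J s P x 0" by (rule min_facts(3))
  also have "\<dots> \<le> k * (norm x)\<^sup>2 + Q s x \<bullet> x"
    unfolding cost_0 using series_boundD(2)[OF bC, of x] by linarith
  finally have 1: "\<delta> * (norm l)\<^sup>2 - 2 * (b * norm (P x) * norm l) \<le> k * (norm x)\<^sup>2"
    using cost_lower[of l x] by linarith
  have 2: "2 * (b * norm (P x) * norm l) \<le> \<delta> / 2 * (norm l)\<^sup>2 + 2 * b\<^sup>2 * \<beta>\<^sup>2 / \<delta> * (norm x)\<^sup>2"
  proof -
    have "norm (P x) \<le> \<beta> * norm x"
      by (intro order_trans[OF norm_blinfun] mult_right_mono \<beta>) auto
    then have "b * norm (P x) * norm l \<le> b * (\<beta> * norm x) * norm l"
      using b0 by (intro mult_right_mono mult_left_mono) auto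
    moreover have "0 \<le> (\<delta> * norm l - 2 * (b * (\<beta> * norm x)))\<^sup>2 / (2 * \<delta>)" using \<delta> by simp
    moreover have "(\<delta> * norm l - 2 * (b * (\<beta> * norm x)))\<^sup>2 / (2 * \<delta>) =
        \<delta> / 2 * (norm l)\<^sup>2 + 2 * b\<^sup>2 * \<beta>\<^sup>2 / \<delta> * (norm x)\<^sup>2 - 2 * (b * (\<beta> * norm x) * norm l)"
      using \<delta> by (simp add: power2_eq_square field_simps)
    ultimately show ?thesis by linarith
  qed
  from 1 2 have "\<delta> / 2 * (norm l)\<^sup>2 \<le> k * (norm x)\<^sup>2 + 2 * b\<^sup>2 * \<beta>\<^sup>2 / \<delta> * (norm x)\<^sup>2" by linarith
  also have "\<dots> = (k + 2 * b\<^sup>2 * \<beta>\<^sup>2 / \<delta>) * (norm x)\<^sup>2" by (simp add: distrib_right)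
  finally have "2 / \<delta> * (\<delta> / 2 * (norm l)\<^sup>2) \<le> 2 / \<delta> * ((k + 2 * b\<^sup>2 * \<beta>\<^sup>2 / \<delta>) * (norm x)\<^sup>2)"
    using \<delta> by (intro mult_left_mono) auto
  moreover have "2 / \<delta> * (\<delta> / 2 * (norm l)\<^sup>2) = (norm l)\<^sup>2" using \<delta> by simp
  ultimately show ?thesis unfolding l_def[symmetric] mult.assoc by linarith
qed

text \<open>The drift term is the only obstruction to positivity of the bracket, and it is absorbed by
  \<open>\<mu>P\<close>; this is why the fixed point argument is run for the equation shifted by \<open>\<mu>\<close>.\<close>

lemma bracket_shift_nonneg: "0 \<le> bracket s P x \<bullet> x + b\<^sup>2 * \<beta> / \<delta> * (P x \<bullet> x)"
proof -
  define v where "v = lambda_op B C D R s P x"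
  have "0 \<le> (\<delta> * norm v - b * norm (P x))\<^sup>2 / \<delta>" using \<delta> by simp
  also have "\<dots> = \<delta> * (norm v)\<^sup>2 - 2 * (b * norm (P x) * norm v) + b\<^sup>2 / \<delta> * (norm (P x))\<^sup>2"
    using \<delta> by (simp add: power2_eq_square field_simps)
  also have "\<dots> \<le> J s P x v + b\<^sup>2 / \<delta> * (norm (P x))\<^sup>2"
    using cost_lower[of v x] nonneg_opsD(2)[OF goodD(4)[OF good], of x] by linarith
  also have "J s P x v = bracket s P x \<bullet> x" unfolding v_def by (rule min_facts(2))
  also have "b\<^sup>2 / \<delta> * (norm (P x))\<^sup>2 \<le> b\<^sup>2 / \<delta> * (\<beta> * (P x \<bullet> x))"
    using \<delta> by (intro mult_left_mono nonneg_ops_norm_sq_le[OF P \<beta>]) auto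
  finally show ?thesis by simp
qed

lemma form_P_le: "P x \<bullet> x \<le> \<beta> * (norm x)\<^sup>2"
proof -
  have "P x \<bullet> x \<le> norm P * (norm x)\<^sup>2" using form_le_norm[of P x] by linarith
  also have "\<dots> \<le> \<beta> * (norm x)\<^sup>2" by (rule mult_right_mono[OF \<beta>]) simp
  finally show ?thesis .
qed

text \<open>The zero control bounds the form from above and \<open>bracket_shift_nonneg\<close> from
  below. Only \<open>k\<close> will be singular in s, and it enters linearly, so the bracket is
  integrable because 2\<alpha> < 1.\<close>

lemma bracket_norm_le:
  assumes k: "0 \<le> k"
  shows "norm (bracket s P) \<le> k + q + b\<^sup>2 * \<beta>\<^sup>2 / \<delta>"
proof (rule selfadj_norm_le[OF bracket_selfadj])
  fix x :: 'h
  have x0: "0 \<le> b\<^sup>2 * \<beta>\<^sup>2 / \<delta> * (norm x)\<^sup>2" "0 \<le> (k + q) * (norm x)\<^sup>2" using \<delta> k q0 by simp_all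
  have "b\<^sup>2 * \<beta> / \<delta> * (P x \<bullet> x) \<le> b\<^sup>2 * \<beta> / \<delta> * (\<beta> * (norm x)\<^sup>2)"
    using \<delta> beta_nonneg by (intro mult_left_mono form_P_le) auto
  also have "\<dots> = b\<^sup>2 * \<beta>\<^sup>2 / \<delta> * (norm x)\<^sup>2" by (simp add: power2_eq_square)
  finally have "- (b\<^sup>2 * \<beta>\<^sup>2 / \<delta> * (norm x)\<^sup>2) \<le> bracket s P x \<bullet> x"
    using bracket_shift_nonneg[of x] by linarith
  then show "\<bar>bracket s P x \<bullet> x\<bar> \<le> (k + q + b\<^sup>2 * \<beta>\<^sup>2 / \<delta>) * (norm x)\<^sup>2"
    using bracket_upper[of x] x0 unfolding distrib_right by linarith
qed (use k q0 \<delta> in simp)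

end

text \<open>Evaluating the cost of \<open>P\<close> at the minimiser of \<open>P'\<close> makes the
  difference linear in \<open>P - P'\<close>; the reverse inequality follows by exchanging the
  roles. \<open>Y\<close> will be a multiple of \<open>W\<close>: on the vectors C_i x only the sum
  of \<open>Y\<close> is controlled, while the D_i v and the drift are treated by the cruder norm
  bound \<open>\<xi>\<close>.\<close>

lemma bracket_diff_le:
  assumes good: "good s"
    and P: "P \<in> nonneg_ops" "norm P \<le> \<beta>" "series_bound P (\<lambda>i. C i s) k"
    and P': "P' \<in> nonneg_ops" "norm P' \<le> \<beta>" "series_bound P' (\<lambda>i. C i s) k"
    and Y: "\<And>y. \<bar>P y \<bullet> y - P' y \<bullet> y\<bar> \<le> Y y" and Yadd: "\<And>y z. Y (y + z) \<le> 2 * Y y + 2 * Y z"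
    and YC: "\<And>n x. (\<Sum>i<n. Y (C i s x)) \<le> \<rho> * (norm x)\<^sup>2"
    and Yn: "\<And>y. Y y \<le> \<xi> * (norm y)\<^sup>2" and \<xi>: "0 \<le> \<xi>"
  defines "L \<equiv> 2 / \<delta> * (k + 2 * b\<^sup>2 * \<beta>\<^sup>2 / \<delta>)"
  shows "bracket s P x \<bullet> x - bracket s P' x \<bullet> x \<le> (2 * \<rho> + \<xi> * (1 + (2 * c + b\<^sup>2) * L)) * (norm x)\<^sup>2"
proof -
  note min = min_facts[OF good P]
  note min' = min_facts[OF good P']
  define v where "v = lambda_op B C D R s P' x"
  have vL: "(norm v)\<^sup>2 \<le> L * (norm x)\<^sup>2"
    unfolding v_def L_def by (rule control_bound[OF good P'])
  \<comment> \<open>The terms with \<open>R\<close> and \<open>Q\<close> are the same in both costs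
    and cancel, leaving only the forms of \<open>P - P'\<close> at the \<open>z i\<close> and the
    drift term.\<close>
  define z where "z i = C i s x + D i s v" for i
  define X where "X = P - P'"
  have X: "X y \<bullet> w = P y \<bullet> w - P' y \<bullet> w" for y w by (simp add: X_def blinfun.bilinear_simps inner_simps)
  have Xsa: "op_adj X = X"
    by (rule op_adj_eqI) (use nonneg_opsD(3)[OF P(1)] nonneg_opsD(3)[OF P'(1)] in \<open>simp add: X_def blinfun.bilinear_simps inner_simps\<close>)
  have "bracket s P x \<bullet> x \<le> J s P x v" by (rule min(3))
  moreover have "bracket s P' x \<bullet> x = J s P' x v" unfolding v_def by (rule min'(2)[symmetric])
  moreover have "J s P x v - J s P' x v = (\<Sum>i. X (z i) \<bullet> z i) + 2 * (X x \<bullet> B s v)"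
  proof -
    have "e + r + u + 2 * p - (e' + r + u + 2 * p') = e - e' + 2 * (p - p')" for e e' r u p p' :: real
      by simp
    then show ?thesis unfolding cost_def z_def X suminf_diff[OF min(5) min'(5), symmetric] .
  qed
  moreover have "(\<Sum>i. X (z i) \<bullet> z i) \<le> 2 * (\<rho> * (norm x)\<^sup>2) + 2 * (\<xi> * (c * (norm v)\<^sup>2))"
  proof (rule suminf_le_const)
    show "summable (\<lambda>i. X (z i) \<bullet> z i)"
      unfolding X z_def by (rule summable_diff[OF min(5) min'(5)])
    fix n
    have "(\<Sum>i<n. X (z i) \<bullet> z i) \<le> (\<Sum>i<n. 2 * Y (C i s x) + 2 * Y (D i s v))"
    proof (rule sum_mono)
      fix i
      have "X (z i) \<bullet> z i \<le> Y (z i)" using Y[of "z i"] unfolding X by linarith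
      also have "\<dots> \<le> 2 * Y (C i s x) + 2 * Y (D i s v)" unfolding z_def by (rule Yadd)
      finally show "X (z i) \<bullet> z i \<le> 2 * Y (C i s x) + 2 * Y (D i s v)" .
    qed
    also have "\<dots> = 2 * (\<Sum>i<n. Y (C i s x)) + 2 * (\<Sum>i<n. Y (D i s v))"
      by (simp add: sum.distrib sum_distrib_left)
    also have "\<dots> \<le> 2 * (\<rho> * (norm x)\<^sup>2) + 2 * (\<xi> * (c * (norm v)\<^sup>2))"
    proof (intro add_mono mult_left_mono YC)
      have "(\<Sum>i<n. Y (D i s v)) \<le> (\<Sum>i<n. \<xi> * (norm (D i s v))\<^sup>2)" by (intro sum_mono Yn)
      also have "\<dots> = \<xi> * (\<Sum>i<n. (norm (D i s v))\<^sup>2)" by (simp add: sum_distrib_left)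
      also have "\<dots> \<le> \<xi> * (c * (norm v)\<^sup>2)"
        using DD[OF goodD(1)[OF good], of v]
        by (intro mult_left_mono \<xi>) (auto intro: order_trans[OF sum_le_suminf])
      finally show "(\<Sum>i<n. Y (D i s v)) \<le> \<xi> * (c * (norm v)\<^sup>2)" .
    qed auto
    finally show "(\<Sum>i<n. X (z i) \<bullet> z i) \<le> 2 * (\<rho> * (norm x)\<^sup>2) + 2 * (\<xi> * (c * (norm v)\<^sup>2))" .
  qed
  moreover have "2 * (X x \<bullet> B s v) \<le> \<xi> * ((norm x)\<^sup>2 + b\<^sup>2 * (norm v)\<^sup>2)"
  proof -
    have "\<bar>X x \<bullet> B s v\<bar> \<le> \<xi> / 2 * ((norm x)\<^sup>2 + (norm (B s v))\<^sup>2)"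
    proof (rule selfadj_form_bound[OF Xsa])
      show "\<bar>X y \<bullet> y\<bar> \<le> \<xi> * (norm y)\<^sup>2" for y
        using Y[of y] Yn[of y] unfolding X by linarith
    qed
    moreover have "(norm (B s v))\<^sup>2 \<le> b\<^sup>2 * (norm v)\<^sup>2"
    proof -
      have "norm (B s v) \<le> b * norm v"
        by (intro order_trans[OF norm_blinfun] mult_right_mono goodD(3)[OF good]) auto
      then show ?thesis by (simp add: power_mono flip: power_mult_distrib)
    qed
    then have "\<xi> / 2 * ((norm x)\<^sup>2 + (norm (B s v))\<^sup>2) \<le> \<xi> / 2 * ((norm x)\<^sup>2 + b\<^sup>2 * (norm v)\<^sup>2)"
      using \<xi> by (intro mult_left_mono add_left_mono) auto
    ultimately show ?thesis by linarith
  qed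
  ultimately have "bracket s P x \<bullet> x - bracket s P' x \<bullet> x \<le>
      2 * (\<rho> * (norm x)\<^sup>2) + 2 * (\<xi> * (c * (norm v)\<^sup>2)) + \<xi> * ((norm x)\<^sup>2 + b\<^sup>2 * (norm v)\<^sup>2)"
    by linarith
  also have "\<dots> = 2 * \<rho> * (norm x)\<^sup>2 + \<xi> * (norm x)\<^sup>2 + \<xi> * (2 * c + b\<^sup>2) * (norm v)\<^sup>2"
    by (simp add: algebra_simps)
  also have "\<dots> \<le> 2 * \<rho> * (norm x)\<^sup>2 + \<xi> * (norm x)\<^sup>2 + \<xi> * (2 * c + b\<^sup>2) * (L * (norm x)\<^sup>2)"
    using \<xi> c by (intro add_left_mono mult_left_mono vL) auto
  also have "\<dots> = (2 * \<rho> + \<xi> * (1 + (2 * c + b\<^sup>2) * L)) * (norm x)\<^sup>2"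
    by (simp add: algebra_simps)
  finally show ?thesis .
qed

text \<open>Measurability of \<open>op_inverse\<close> is bypassed: a strict sublevel set of the
  minimum is open in the control, so it is hit by a dense sequence of controls, and each single cost
  is measurable.\<close>

lemma bracket_measurable:
  fixes P :: "real \<Rightarrow> 'h \<Rightarrow>\<^sub>L 'h"
  assumes cont: "\<And>x. continuous_on {0..T} (\<lambda>s. P s x)"
    and nn: "\<And>s. s \<in> {0..<T} \<Longrightarrow> P s \<in> nonneg_ops"
    and bd: "\<And>s. s \<in> {0..<T} \<Longrightarrow> \<exists>k. series_bound (P s) (\<lambda>i. C i s) k"
  shows "(\<lambda>s. bracket s (P s) x) \<in> borel_measurable (lebesgue_on {0..T})"
proof -
  have Pm: "(\<lambda>s. P s y) \<in> borel_measurable (lebesgue_on {0..T})" for y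
    by (intro continuous_imp_measurable_on_sets_lebesgue cont) simp
  have Jm: "(\<lambda>s. J s (P s) x v) \<in> borel_measurable (lebesgue_on {0..T})" for x v
  proof -
    note [measurable] = Bm Cm Dm Qm Rm Pm
    have z[measurable]: "(\<lambda>s. C i s x + D i s v) \<in> borel_measurable (lebesgue_on {0..T})" for i by measurable
    have [measurable]: "(\<lambda>s. P s (C i s x + D i s v)) \<in> borel_measurable (lebesgue_on {0..T})" for i
      by (rule borel_measurable_blinfun_apply[OF Pm z])
    show ?thesis unfolding cost_def by measurable
  qed
  have min: "op_adj (bracket s (P s)) = bracket s (P s)"
      "bracket s (P s) x \<bullet> x = J s (P s) x (lambda_op B C D R s (P s) x)"
      "bracket s (P s) x \<bullet> x \<le> J s (P s) x v" "continuous_on UNIV (J s (P s) x)" if good: "good s" for s x v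
  proof -
    obtain k where k: "series_bound (P s) (\<lambda>i. C i s) k" using bd[OF goodD(2)[OF good]] by blast
    note m = min_facts[OF good nn[OF goodD(2)[OF good]] order_refl k]
    show "op_adj (bracket s (P s)) = bracket s (P s)" by (rule m(1))
    show "bracket s (P s) x \<bullet> x = J s (P s) x (lambda_op B C D R s (P s) x)" by (rule m(2)[symmetric])
    show "bracket s (P s) x \<bullet> x \<le> J s (P s) x v" by (rule m(3))
    show "continuous_on UNIV (J s (P s) x)" by (rule m(4))
  qed
  obtain V :: "'u set" where V: "countable V" "\<And>X. open X \<Longrightarrow> X \<noteq> {} \<Longrightarrow> \<exists>d\<in>V. d \<in> X"
    by (erule countable_dense_setE)
  obtain e :: "nat \<Rightarrow> 'u" where e: "V = range e"
    using V(1) V(2)[of UNIV] by (metis UNIV_not_empty empty_iff open_UNIV range_from_nat_into)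
  have form: "(\<lambda>s. bracket s (P s) x \<bullet> x) \<in> borel_measurable (lebesgue_on {0..T})" for x
    unfolding borel_measurable_iff_less
  proof
    fix a
    have "{s \<in> {0..T}. bracket s (P s) x \<bullet> x < a} \<in> sets (lebesgue_on {0..T})"
    proof (rule sets_lebesgue_on_AE)
      note [measurable] = Jm
      have "{s \<in> space (lebesgue_on {0..T}). \<exists>n. J s (P s) x (e n) < a} \<in> sets (lebesgue_on {0..T})"
        by measurable
      then show "{s \<in> {0..T}. \<exists>n. J s (P s) x (e n) < a} \<in> sets (lebesgue_on {0..T})" by simp
      show "AE s in lebesgue_on {0..T}. (bracket s (P s) x \<bullet> x < a) = (\<exists>n. J s (P s) x (e n) < a)"
        using AE_good
      proof eventually_elim
        fix s assume good: "good s"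
        show "(bracket s (P s) x \<bullet> x < a) = (\<exists>n. J s (P s) x (e n) < a)"
        proof
          assume "bracket s (P s) x \<bullet> x < a"
          then have "lambda_op B C D R s (P s) x \<in> {v. J s (P s) x v < a}"
            by (simp add: min(2)[OF good])
          moreover have "open {v. J s (P s) x v < a}"
            by (intro open_Collect_less min(4)[OF good] continuous_intros)
          ultimately obtain d where "d \<in> V" "J s (P s) x d < a" using V(2) by blast
          then show "\<exists>n. J s (P s) x (e n) < a" unfolding e by blast
        next
          assume "\<exists>n. J s (P s) x (e n) < a"
          then show "bracket s (P s) x \<bullet> x < a" using min(3)[OF good] by (meson le_less_trans)
        qed
      qed
    qed simp
    then show "{w \<in> space (lebesgue_on {0..T}). bracket w (P w) x \<bullet> x < a} \<in> sets (lebesgue_on {0..T})" by simp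
  qed
  \<comment> \<open>From forms to vectors: polarisation gives measurability of the inner products
    with every \<open>y\<close>, and weak measurability suffices.\<close>
  show ?thesis
  proof (rule borel_measurable_weakly)
    fix y
    show "(\<lambda>s. bracket s (P s) x \<bullet> y) \<in> borel_measurable (lebesgue_on {0..T})"
    proof (rule borel_measurable_lebesgue_on_AE)
      show "(\<lambda>s. (bracket s (P s) (x + y) \<bullet> (x + y) - bracket s (P s) (x - y) \<bullet> (x - y)) / 4)
          \<in> borel_measurable (lebesgue_on {0..T})"
        by (intro borel_measurable_divide borel_measurable_diff borel_measurable_const form)
      show "AE s in lebesgue_on {0..T}. bracket s (P s) x \<bullet> y =
          (bracket s (P s) (x + y) \<bullet> (x + y) - bracket s (P s) (x - y) \<bullet> (x - y)) / 4"
        using AE_good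
      proof eventually_elim
        fix s assume good: "good s"
        show "bracket s (P s) x \<bullet> y =
            (bracket s (P s) (x + y) \<bullet> (x + y) - bracket s (P s) (x - y) \<bullet> (x - y)) / 4"
          unfolding selfadj_polarization[OF min(1)[OF good], of x y, symmetric] by simp
      qed
    qed simp
  qed
qed

end

section \<open>Weakly singular kernels\<close>

lemma nonneg_has_integral_lebesgue_on:
  fixes f :: "real \<Rightarrow> real"
  assumes f: "(f has_integral I) A" and nn: "\<And>x. x \<in> A \<Longrightarrow> 0 \<le> f x" and A: "A \<in> sets lebesgue"
  shows "integrable (lebesgue_on A) f" "integral\<^sup>L (lebesgue_on A) f = I"
proof -
  have a: "f absolutely_integrable_on A"
    using f nn by (intro nonnegative_absolutely_integrable_1) (auto simp: has_integral_iff)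
  then show "integrable (lebesgue_on A) f"
    using A by (simp add: set_integrable_def integrable_lebesgue_on_iff)
  show "integral\<^sup>L (lebesgue_on A) f = I"
    using set_lebesgue_integral_eq_integral(2)[OF a] f A
    by (simp add: set_lebesgue_integral_def integral_lebesgue_on_eq has_integral_iff)
qed

lemma powr_from_left_lebesgue:
  assumes a: "a > (-1::real)" and st: "s \<le> t"
  shows "integrable (lebesgue_on {s..t}) (\<lambda>r. (r - s) powr a)"
    and "integral\<^sup>L (lebesgue_on {s..t}) (\<lambda>r. (r - s) powr a) = (t - s) powr (a + 1) / (a + 1)"
proof -
  have "((\<lambda>u. u powr a) has_integral ((t - s) powr (a + 1) / (a + 1))) {0..t - s}"
    using st by (intro has_integral_powr_from_0 a) auto
  then have "(((\<lambda>r. (r - s) powr a) \<circ> (+) s) has_integral ((t - s) powr (a + 1) / (a + 1))) {0..t - s}"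
    by (simp add: comp_def)
  then have "((\<lambda>r. (r - s) powr a) has_integral ((t - s) powr (a + 1) / (a + 1))) {s..t}"
    unfolding has_integral_shift_Icc_real by simp
  from nonneg_has_integral_lebesgue_on[OF this]
  show "integrable (lebesgue_on {s..t}) (\<lambda>r. (r - s) powr a)"
    and "integral\<^sup>L (lebesgue_on {s..t}) (\<lambda>r. (r - s) powr a) = (t - s) powr (a + 1) / (a + 1)"
    by simp_all
qed

lemma powr_from_right_lebesgue:
  assumes a: "a > (-1::real)" and st: "s \<le> t"
  shows "integrable (lebesgue_on {s..t}) (\<lambda>r. (t - r) powr a)"
    and "integral\<^sup>L (lebesgue_on {s..t}) (\<lambda>r. (t - r) powr a) = (t - s) powr (a + 1) / (a + 1)"
proof -
  have "((\<lambda>u. u powr a) has_integral ((t - s) powr (a + 1) / (a + 1))) {0..t - s}"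
    using st by (intro has_integral_powr_from_0 a) auto
  then have "((\<lambda>u. (- u) powr a) has_integral ((t - s) powr (a + 1) / (a + 1))) {- (t - s).. - 0}"
    by (subst has_integral_reflect_real[symmetric]) simp
  then have "(((\<lambda>r. (t - r) powr a) \<circ> (+) t) has_integral ((t - s) powr (a + 1) / (a + 1))) {s - t..0}"
    by (simp add: comp_def)
  then have "((\<lambda>r. (t - r) powr a) has_integral ((t - s) powr (a + 1) / (a + 1))) {s..t}"
    unfolding has_integral_shift_Icc_real by simp
  from nonneg_has_integral_lebesgue_on[OF this]
  show "integrable (lebesgue_on {s..t}) (\<lambda>r. (t - r) powr a)"
    and "integral\<^sup>L (lebesgue_on {s..t}) (\<lambda>r. (t - r) powr a) = (t - s) powr (a + 1) / (a + 1)"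
    by simp_all
qed

text \<open>Any power of order at most 1 is dominated by the exponential. It trades exponential
  damping for a negative power of \<nu> at the price of a slightly stronger singularity.\<close>

lemma exp_minus_le_powr:
  assumes z: "(z::real) > 0" and b: "0 \<le> b" "b \<le> 1"
  shows "exp (- z) \<le> z powr (- b)"
proof -
  have "z powr b \<le> exp z"
  proof (cases "z \<le> 1")
    case True
    then have "z powr b \<le> 1 powr b" using z b by (intro powr_mono2) auto
    also have "\<dots> \<le> exp z" using z by simp
    finally show ?thesis .
  next
    case False
    then have "z powr b \<le> z powr 1" using b by (intro powr_mono) auto
    also have "\<dots> = z" using z by simp
    also have "\<dots> \<le> exp z" using exp_ge_add_one_self[of z] by linarith
    finally show ?thesis .
  qed
  then have "1 / exp z \<le> 1 / z powr b" using z by (intro divide_left_mono) auto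
  then show ?thesis by (simp add: exp_minus powr_minus divide_inverse)
qed

text \<open>The weight \<open>e\<^bsup>\<nu>(T-r)\<^esup>\<close> turns the weakly singular Volterra kernel into a contraction.
  The larger of \<open>a = r - s\<close> and \<open>u = T - r\<close> is at least half of \<open>T - s\<close>.\<close>

lemma singular_kernel_pointwise:
  fixes a u \<alpha> \<nu> :: real
  assumes a: "0 \<le> a" and u: "0 \<le> u" and \<alpha>: "0 < \<alpha>" "\<alpha> < 1 / 2" and \<nu>: "\<nu> > 0"
  defines "\<gamma> \<equiv> (1 + 2 * \<alpha>) / 2" and "\<beta> \<equiv> (1 - 2 * \<alpha>) / 2"
  shows "u powr (- 2 * \<alpha>) * exp (\<nu> * u) * a powr (- 2 * \<alpha>) \<le>
    2 powr (2 * \<alpha>) * ((a + u) powr (- 2 * \<alpha>) * exp (\<nu> * (a + u))) * \<nu> powr (- \<beta>) *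
      (a powr (- \<gamma>) + u powr (- \<gamma>))"
proof (cases "a = 0 \<or> u = 0")
  case True
  then show ?thesis by auto
next
  case False
  then have pos: "a > 0" "u > 0" using a u by auto
  define p where "p = - 2 * \<alpha>"
  have half: "y powr p \<le> 2 powr (2 * \<alpha>) * (a + u) powr p" if "y \<ge> (a + u) / 2" for y
  proof -
    have "y powr p \<le> ((a + u) / 2) powr p" using that pos \<alpha> by (intro powr_mono2') (auto simp: p_def)
    also have "\<dots> = (a + u) powr p / 2 powr p" by (rule powr_divide)
    also have "2 powr p = 2 powr - (2 * \<alpha>)" by (simp add: p_def)
    also have "\<dots> = inverse (2 powr (2 * \<alpha>))" by (rule powr_minus)
    finally show ?thesis by (simp add: divide_inverse mult.commute)
  qed
  \<comment> \<open>The gap between 2\<alpha> and 1 is spent in halves: \<beta> is half of it and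
    yields the negative power of \<nu>, and \<gamma> = 2\<alpha> + \<beta> is still below 1, hence
    integrable.\<close>
  have damp: "x powr p * exp (- \<nu> * x) \<le> \<nu> powr (- \<beta>) * x powr (- \<gamma>)" if x: "x > 0" for x
  proof -
    have "exp (- (\<nu> * x)) \<le> (\<nu> * x) powr (- \<beta>)"
      using x \<nu> \<alpha> by (intro exp_minus_le_powr) (auto simp: \<beta>_def)
    then have "x powr p * exp (- \<nu> * x) \<le> x powr p * (\<nu> * x) powr (- \<beta>)"
      by (intro mult_left_mono) auto
    also have "\<dots> = \<nu> powr (- \<beta>) * (x powr p * x powr (- \<beta>))" using x \<nu> by (simp add: powr_mult)
    also have "x powr p * x powr (- \<beta>) = x powr (- \<gamma>)"
    proof -
      have "p + - \<beta> = - \<gamma>" by (simp add: p_def \<beta>_def \<gamma>_def field_simps)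
      then show ?thesis by (simp only: powr_add[symmetric])
    qed
    finally show ?thesis .
  qed
  have split: "exp (\<nu> * u) = exp (\<nu> * (a + u)) * exp (- \<nu> * a)" by (simp add: algebra_simps flip: exp_add)
  have nn: "0 \<le> \<nu> powr (- \<beta>) * a powr (- \<gamma>)" "0 \<le> \<nu> powr (- \<beta>) * u powr (- \<gamma>)" by simp_all
  have damp': "a powr p * exp (- \<nu> * a) \<le> \<nu> powr (- \<beta>) * a powr (- \<gamma>) + \<nu> powr (- \<beta>) * u powr (- \<gamma>)"
      "u powr p * exp (- \<nu> * u) \<le> \<nu> powr (- \<beta>) * a powr (- \<gamma>) + \<nu> powr (- \<beta>) * u powr (- \<gamma>)"
    using damp[OF pos(1)] damp[OF pos(2)] nn by linarith+
  have "u powr p * exp (\<nu> * u) * a powr p \<le>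
    2 powr (2 * \<alpha>) * (a + u) powr p * exp (\<nu> * (a + u)) * (\<nu> powr (- \<beta>) * a powr (- \<gamma>) + \<nu> powr (- \<beta>) * u powr (- \<gamma>))"
  proof (cases "a \<le> u")
    case True
    have "u powr p * exp (\<nu> * u) * a powr p = u powr p * exp (\<nu> * (a + u)) * (a powr p * exp (- \<nu> * a))"
      unfolding split by simp
    also have "\<dots> \<le> 2 powr (2 * \<alpha>) * (a + u) powr p * exp (\<nu> * (a + u)) *
        (\<nu> powr (- \<beta>) * a powr (- \<gamma>) + \<nu> powr (- \<beta>) * u powr (- \<gamma>))"
      using True nn by (intro mult_mono mult_right_mono half damp') (auto simp del: mult_minus_left)
    finally show ?thesis .
  next
    case False
    \<comment> \<open>Here \<open>u\<close> is the smaller variable and must receive the damping;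
      since \<open>a\<close> exceeds \<open>u\<close>, the available factor
      \<open>exp (- \<nu> * a)\<close> may be weakened to \<open>exp (- \<nu> * u)\<close>.\<close>
    then have "exp (- \<nu> * a) \<le> exp (- \<nu> * u)" using \<nu> by simp
    then have "u powr p * exp (\<nu> * u) * a powr p \<le>
        a powr p * exp (\<nu> * (a + u)) * (u powr p * exp (- \<nu> * u))"
      unfolding split using mult_left_mono[of "exp (- \<nu> * a)" "exp (- \<nu> * u)"
        "a powr p * exp (\<nu> * (a + u)) * u powr p"] by (simp add: mult_ac)
    also have "\<dots> \<le> 2 powr (2 * \<alpha>) * (a + u) powr p * exp (\<nu> * (a + u)) *
        (\<nu> powr (- \<beta>) * a powr (- \<gamma>) + \<nu> powr (- \<beta>) * u powr (- \<gamma>))"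
      using False nn by (intro mult_mono mult_right_mono half damp') (auto simp del: mult_minus_left)
    finally show ?thesis .
  qed
  then show ?thesis by (simp add: p_def algebra_simps)
qed

section \<open>The weight, the functional \<open>W\<close>, and the smoothing hypothesis\<close>

context riccati_data
begin

text \<open>A Bielecki weight: the power matches the size of the brackets, the exponential will make
  the Volterra kernel small.\<close>

definition w :: "real \<Rightarrow> real \<Rightarrow> real" where
  "w \<nu> r = (T - r) powr (- 2 * \<alpha>) * exp (\<nu> * (T - r))"

definition W :: "real \<Rightarrow> real \<Rightarrow> 'h \<Rightarrow> real" where
  "W \<nu> t y = integral\<^sup>L (lebesgue_on {t..T}) (\<lambda>r. w \<nu> r * (norm (S (r - t) y))\<^sup>2)"

lemma w_nonneg: "0 \<le> w \<nu> r"
  by (simp add: w_def)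

lemma w_measurable: "w \<nu> \<in> borel_measurable (lebesgue_on A)"
proof -
  have "w \<nu> \<in> borel_measurable borel" unfolding w_def[abs_def] by measurable
  then have "w \<nu> \<in> borel_measurable lborel" by simp
  then have "w \<nu> \<in> borel_measurable lebesgue" by (rule measurable_completion)
  then show ?thesis by (rule measurable_restrict_space1)
qed

lemma w_integrable: "0 \<le> \<nu> \<Longrightarrow> t \<in> {0..T} \<Longrightarrow> integrable (lebesgue_on {t..T}) (w \<nu>)"
proof (rule Bochner_Integration.integrable_bound)
  assume \<nu>: "0 \<le> \<nu>" and t: "t \<in> {0..T}"
  show "integrable (lebesgue_on {t..T}) (\<lambda>r. exp (\<nu> * T) * (T - r) powr (- 2 * \<alpha>))"
    using \<alpha> t by (intro integrable_mult_right powr_from_right_lebesgue) auto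
  show "AE r in lebesgue_on {t..T}. norm (w \<nu> r) \<le> norm (exp (\<nu> * T) * (T - r) powr (- 2 * \<alpha>))"
  proof (rule AE_lebesgue_on_I)
    fix r assume r: "r \<in> {t..T}"
    have "\<nu> * (T - r) \<le> \<nu> * T" using r t \<nu> by (intro mult_left_mono) auto
    then have "(T - r) powr (- 2 * \<alpha>) * exp (\<nu> * (T - r)) \<le> (T - r) powr (- 2 * \<alpha>) * exp (\<nu> * T)"
      by (intro mult_left_mono) auto
    then show "norm (w \<nu> r) \<le> norm (exp (\<nu> * T) * (T - r) powr (- 2 * \<alpha>))"
      by (simp add: w_def mult.commute abs_mult)
  qed
qed (rule w_measurable)

lemma w_ge: "0 \<le> \<nu> \<Longrightarrow> s \<in> {0..T} \<Longrightarrow> (T - s) powr (- 2 * \<alpha>) \<le> w \<nu> s"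
  unfolding w_def using mult_left_mono[of 1 "exp (\<nu> * (T - s))" "(T - s) powr (- 2 * \<alpha>)"] by simp

lemma w_le: "0 \<le> \<nu> \<Longrightarrow> s \<in> {0..T} \<Longrightarrow> w \<nu> s \<le> exp (\<nu> * T) * (T - s) powr (- 2 * \<alpha>)"
  unfolding w_def by (subst mult.commute) (intro mult_right_mono, auto intro: mult_left_mono)

lemma powr_ge: "s \<in> {0..<T} \<Longrightarrow> T powr (- 2 * \<alpha>) \<le> (T - s) powr (- 2 * \<alpha>)"
  using \<alpha> T_pos by (intro powr_mono2') auto

text \<open>Integrating \<open>singular_kernel_pointwise\<close> leaves a factor \<nu>^(-\<beta>)
  times integrals of powers above -1, which are bounded uniformly in s. One \<nu> therefore works
  for all s.\<close>

lemma w_kernel_small: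
  assumes \<epsilon>: "\<epsilon> > 0"
  obtains \<nu> where "\<nu> > 0"
    "\<And>s. s \<in> {0..<T} \<Longrightarrow> integrable (lebesgue_on {s..T}) (\<lambda>r. w \<nu> r * (r - s) powr (- 2 * \<alpha>))"
    "\<And>s. s \<in> {0..<T} \<Longrightarrow>
      integral\<^sup>L (lebesgue_on {s..T}) (\<lambda>r. w \<nu> r * (r - s) powr (- 2 * \<alpha>)) \<le> \<epsilon> * w \<nu> s"
proof -
  define \<gamma> where "\<gamma> = (1 + 2 * \<alpha>) / 2"
  define \<beta> where "\<beta> = (1 - 2 * \<alpha>) / 2"
  have \<gamma>: "- \<gamma> > - 1" using \<alpha> by (simp add: \<gamma>_def)
  have \<beta>: "\<beta> > 0" using \<alpha> by (simp add: \<beta>_def)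
  define K where "K = 2 powr (2 * \<alpha>) * (2 * (T powr (1 - \<gamma>) / (1 - \<gamma>)))"
  have K: "K > 0" using \<gamma> T_pos by (simp add: K_def)
  \<comment> \<open>The solution of \<open>K * \<nu> powr (- \<beta>) = \<epsilon>\<close>.\<close>
  define \<nu> where "\<nu> = (K / \<epsilon>) powr (1 / \<beta>)"
  have \<nu>: "\<nu> > 0" using K \<epsilon> by (simp add: \<nu>_def)
  have "\<nu> powr (- \<beta>) = (K / \<epsilon>) powr (- 1)" using \<beta> by (simp add: \<nu>_def powr_powr)
  then have K\<nu>: "K * \<nu> powr (- \<beta>) = \<epsilon>" using K \<epsilon> by (simp add: powr_minus)
  show thesis
  proof (rule that[OF \<nu>])
    fix s assume s: "s \<in> {0..<T}"
    let ?h = "\<lambda>r. 2 powr (2 * \<alpha>) * w \<nu> s * \<nu> powr (- \<beta>) * ((r - s) powr (- \<gamma>) + (T - r) powr (- \<gamma>))"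
    have ih: "integrable (lebesgue_on {s..T}) ?h"
      using s \<gamma> by (intro integrable_mult_right Bochner_Integration.integrable_add
          powr_from_left_lebesgue powr_from_right_lebesgue) auto
    have le: "w \<nu> r * (r - s) powr (- 2 * \<alpha>) \<le> ?h r" if r: "r \<in> {s..T}" for r
      using singular_kernel_pointwise[of "r - s" "T - r" \<alpha> \<nu>] r s \<alpha> \<nu>
      by (simp add: w_def \<gamma>_def \<beta>_def)
    show i: "integrable (lebesgue_on {s..T}) (\<lambda>r. w \<nu> r * (r - s) powr (- 2 * \<alpha>))"
    proof (rule Bochner_Integration.integrable_bound[OF ih])
      have "integrable (lebesgue_on {s..T}) (\<lambda>r. (r - s) powr (- 2 * \<alpha>))"
        using s \<alpha> by (intro powr_from_left_lebesgue) auto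
      then show "(\<lambda>r. w \<nu> r * (r - s) powr (- 2 * \<alpha>)) \<in> borel_measurable (lebesgue_on {s..T})"
        by (intro borel_measurable_times w_measurable) auto
      show "AE r in lebesgue_on {s..T}. norm (w \<nu> r * (r - s) powr (- 2 * \<alpha>)) \<le> norm (?h r)"
      proof (rule AE_lebesgue_on_I)
        fix r assume "r \<in> {s..T}"
        have "0 \<le> w \<nu> r * (r - s) powr (- 2 * \<alpha>)" using w_nonneg by simp
        then show "norm (w \<nu> r * (r - s) powr (- 2 * \<alpha>)) \<le> norm (?h r)"
          using le[OF \<open>r \<in> {s..T}\<close>] by (simp only: real_norm_def abs_of_nonneg)
      qed
    qed
    have "integral\<^sup>L (lebesgue_on {s..T}) (\<lambda>r. w \<nu> r * (r - s) powr (- 2 * \<alpha>)) \<le> integral\<^sup>L (lebesgue_on {s..T}) ?h"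
      by (rule integral_mono_AE[OF i ih AE_lebesgue_on_I]) (rule le)
    also have "\<dots> = 2 powr (2 * \<alpha>) * w \<nu> s * \<nu> powr (- \<beta>) *
        ((T - s) powr (- \<gamma> + 1) / (- \<gamma> + 1) + (T - s) powr (- \<gamma> + 1) / (- \<gamma> + 1))"
      using s \<gamma> by (subst integral_mult_right_zero, subst Bochner_Integration.integral_add)
        (simp_all add: powr_from_left_lebesgue powr_from_right_lebesgue)
    also have "\<dots> \<le> 2 powr (2 * \<alpha>) * w \<nu> s * \<nu> powr (- \<beta>) *
        (T powr (- \<gamma> + 1) / (- \<gamma> + 1) + T powr (- \<gamma> + 1) / (- \<gamma> + 1))"
      using s \<gamma> w_nonneg by (intro mult_left_mono add_mono divide_right_mono powr_mono2) auto
    also have "\<dots> = (K * \<nu> powr (- \<beta>)) * w \<nu> s" by (simp add: K_def)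
    finally show "integral\<^sup>L (lebesgue_on {s..T}) (\<lambda>r. w \<nu> r * (r - s) powr (- 2 * \<alpha>)) \<le> \<epsilon> * w \<nu> s"
      unfolding K\<nu> .
  qed
qed

lemma S_shift_continuous: "continuous_on {t..T} (\<lambda>r. S (r - t) y)"
  by (rule continuous_on_compose2[OF S_cont]) (auto intro!: continuous_intros)

lemma W_integrable:
  assumes \<nu>: "0 \<le> \<nu>" and t: "t \<in> {0..T}"
  shows "integrable (lebesgue_on {t..T}) (\<lambda>r. w \<nu> r * (norm (S (r - t) y))\<^sup>2)"
proof (rule Bochner_Integration.integrable_bound)
  show "integrable (lebesgue_on {t..T}) (\<lambda>r. w \<nu> r * (NS * norm y)\<^sup>2)"
    using w_integrable[OF \<nu> t] by simp
  have "(\<lambda>r. (norm (S (r - t) y))\<^sup>2) \<in> borel_measurable (lebesgue_on {t..T})"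
    by (intro continuous_imp_measurable_on_sets_lebesgue continuous_intros S_shift_continuous) simp
  then show "(\<lambda>r. w \<nu> r * (norm (S (r - t) y))\<^sup>2) \<in> borel_measurable (lebesgue_on {t..T})"
    by (intro borel_measurable_times w_measurable)
  show "AE r in lebesgue_on {t..T}. norm (w \<nu> r * (norm (S (r - t) y))\<^sup>2) \<le> norm (w \<nu> r * (NS * norm y)\<^sup>2)"
  proof (rule AE_lebesgue_on_I)
    fix r assume "r \<in> {t..T}"
    then have "norm (S (r - t) y) \<le> NS * norm y" using t by (intro norm_S_apply_le) auto
    then have "w \<nu> r * (norm (S (r - t) y))\<^sup>2 \<le> w \<nu> r * (NS * norm y)\<^sup>2"
      by (intro mult_left_mono power_mono w_nonneg) auto
    then show "norm (w \<nu> r * (norm (S (r - t) y))\<^sup>2) \<le> norm (w \<nu> r * (NS * norm y)\<^sup>2)"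
      using w_nonneg[of \<nu> r] by simp
  qed
qed

lemma W_nonneg: "0 \<le> W \<nu> t y"
  unfolding W_def by (intro integral_nonneg_AE AE_lebesgue_on_I) (simp add: w_nonneg)

lemma W_add:
  assumes \<nu>: "0 \<le> \<nu>" and t: "t \<in> {0..T}"
  shows "W \<nu> t (y + z) \<le> 2 * W \<nu> t y + 2 * W \<nu> t z"
proof -
  have "W \<nu> t (y + z) \<le> integral\<^sup>L (lebesgue_on {t..T})
      (\<lambda>r. 2 * (w \<nu> r * (norm (S (r - t) y))\<^sup>2) + 2 * (w \<nu> r * (norm (S (r - t) z))\<^sup>2))"
    unfolding W_def
  proof (intro integral_mono_AE W_integrable \<nu> t AE_lebesgue_on_I Bochner_Integration.integrable_add integrable_mult_right)
    fix r
    have "(norm (S (r - t) (y + z)))\<^sup>2 \<le> (norm (S (r - t) y) + norm (S (r - t) z))\<^sup>2"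
      by (simp add: blinfun.add_right norm_triangle_ineq power_mono)
    also have "\<dots> \<le> 2 * (norm (S (r - t) y))\<^sup>2 + 2 * (norm (S (r - t) z))\<^sup>2"
      using sum_squares_bound[of "norm (S (r - t) y)" "norm (S (r - t) z)"] by (simp add: power2_sum)
    finally have "w \<nu> r * (norm (S (r - t) (y + z)))\<^sup>2 \<le>
        w \<nu> r * (2 * (norm (S (r - t) y))\<^sup>2 + 2 * (norm (S (r - t) z))\<^sup>2)"
      by (intro mult_left_mono w_nonneg)
    then show "w \<nu> r * (norm (S (r - t) (y + z)))\<^sup>2 \<le>
        2 * (w \<nu> r * (norm (S (r - t) y))\<^sup>2) + 2 * (w \<nu> r * (norm (S (r - t) z))\<^sup>2)"
      by (simp add: algebra_simps)
  qed
  also have "\<dots> = 2 * W \<nu> t y + 2 * W \<nu> t z"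
    unfolding W_def
    by (subst Bochner_Integration.integral_add) (intro integrable_mult_right W_integrable \<nu> t, simp)+
  finally show ?thesis .
qed

lemma W_le:
  assumes \<nu>: "0 \<le> \<nu>" and t: "t \<in> {0..T}"
  shows "W \<nu> t y \<le> NS\<^sup>2 * integral\<^sup>L (lebesgue_on {t..T}) (w \<nu>) * (norm y)\<^sup>2"
proof -
  have "W \<nu> t y \<le> integral\<^sup>L (lebesgue_on {t..T}) (\<lambda>r. w \<nu> r * (NS * norm y)\<^sup>2)"
    unfolding W_def
  proof (intro integral_mono_AE W_integrable \<nu> t AE_lebesgue_on_I)
    show "integrable (lebesgue_on {t..T}) (\<lambda>r. w \<nu> r * (NS * norm y)\<^sup>2)"
      using w_integrable[OF \<nu> t] by simp
    fix r assume "r \<in> {t..T}"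
    then have "norm (S (r - t) y) \<le> NS * norm y" using t by (intro norm_S_apply_le) auto
    then show "w \<nu> r * (norm (S (r - t) y))\<^sup>2 \<le> w \<nu> r * (NS * norm y)\<^sup>2"
      by (intro mult_left_mono power_mono w_nonneg) auto
  qed
  then show ?thesis by (simp add: power_mult_distrib mult_ac)
qed

lemma integral_w_nonneg: "0 \<le> integral\<^sup>L (lebesgue_on A) (w \<nu>)"
  by (intro integral_nonneg_AE AE_lebesgue_on_I) (simp add: w_nonneg)

lemma W_le_uniform:
  assumes \<nu>: "0 \<le> \<nu>" and t: "t \<in> {0..T}"
  shows "W \<nu> t y \<le> NS\<^sup>2 * integral\<^sup>L (lebesgue_on {0..T}) (w \<nu>) * (norm y)\<^sup>2"
proof -
  have "integral\<^sup>L lebesgue (\<lambda>s. indicator {t..T} s *\<^sub>R w \<nu> s) \<le> integral\<^sup>L lebesgue (\<lambda>s. indicator {0..T} s *\<^sub>R w \<nu> s)"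
  proof (rule integral_mono_AE)
    show "integrable lebesgue (\<lambda>s. indicator {t..T} s *\<^sub>R w \<nu> s)"
      using w_integrable[OF \<nu> t] by (subst integrable_lebesgue_on_iff[symmetric]) auto
    show "integrable lebesgue (\<lambda>s. indicator {0..T} s *\<^sub>R w \<nu> s)"
      using w_integrable[OF \<nu>, of 0] T_pos by (subst integrable_lebesgue_on_iff[symmetric]) auto
    show "AE s in lebesgue. indicator {t..T} s *\<^sub>R w \<nu> s \<le> indicator {0..T} s *\<^sub>R w \<nu> s"
      using t by (intro AE_I2) (auto simp: indicator_def w_nonneg)
  qed
  then have "integral\<^sup>L (lebesgue_on {t..T}) (w \<nu>) \<le> integral\<^sup>L (lebesgue_on {0..T}) (w \<nu>)"
    by (simp add: integral_lebesgue_on_eq)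
  then have "NS\<^sup>2 * integral\<^sup>L (lebesgue_on {t..T}) (w \<nu>) * (norm y)\<^sup>2 \<le>
      NS\<^sup>2 * integral\<^sup>L (lebesgue_on {0..T}) (w \<nu>) * (norm y)\<^sup>2"
    by (intro mult_right_mono mult_left_mono) auto
  then show ?thesis using W_le[OF \<nu> t, of y] by linarith
qed

lemma sum_norm_SC_le:
  assumes "t > 0" "s \<in> {0..T}"
  shows "(\<Sum>i<n. (norm (S t (C i s x)))\<^sup>2) \<le> c * t powr (- 2 * \<alpha>) * (norm x)\<^sup>2"
  using SC[OF assms, of x] by (auto intro: order_trans[OF sum_le_suminf])

text \<open>The hypothesis on \<open>C\<close> is used under the integral at time
  \<open>r - s\<close>. Only finite sums occur, so no infinite sum is exchanged with the
  integral.\<close>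

lemma sum_W_C_le:
  assumes \<nu>: "0 \<le> \<nu>" and s: "s \<in> {0..<T}"
    and i: "integrable (lebesgue_on {s..T}) (\<lambda>r. w \<nu> r * (r - s) powr (- 2 * \<alpha>))"
  shows "(\<Sum>i<n. W \<nu> s (C i s x)) \<le>
    c * integral\<^sup>L (lebesgue_on {s..T}) (\<lambda>r. w \<nu> r * (r - s) powr (- 2 * \<alpha>)) * (norm x)\<^sup>2"
proof -
  have s': "s \<in> {0..T}" using s by simp
  have int: "integrable (lebesgue_on {s..T}) (\<lambda>r. \<Sum>i<n. w \<nu> r * (norm (S (r - s) (C i s x)))\<^sup>2)"
    by (intro Bochner_Integration.integrable_sum W_integrable \<nu> s')
  have "(\<Sum>i<n. W \<nu> s (C i s x)) =
      integral\<^sup>L (lebesgue_on {s..T}) (\<lambda>r. \<Sum>i<n. w \<nu> r * (norm (S (r - s) (C i s x)))\<^sup>2)"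
    unfolding W_def by (intro Bochner_Integration.integral_sum[symmetric] W_integrable \<nu> s')
  also have "\<dots> \<le> integral\<^sup>L (lebesgue_on {s..T}) (\<lambda>r. w \<nu> r * (r - s) powr (- 2 * \<alpha>) * (c * (norm x)\<^sup>2))"
  proof (rule integral_mono_AE[OF int])
    show "integrable (lebesgue_on {s..T}) (\<lambda>r. w \<nu> r * (r - s) powr (- 2 * \<alpha>) * (c * (norm x)\<^sup>2))"
      using i by simp
    have "AE r in lebesgue. r \<noteq> s" by (rule AE_completion) (rule AE_lborel_singleton)
    then have "AE r in lebesgue. r \<in> {s..T} \<longrightarrow> s < r" by eventually_elim auto
    then have "AE r in lebesgue_on {s..T}. s < r" by (subst AE_lebesgue_on_iff) simp_all
    then show "AE r in lebesgue_on {s..T}. (\<Sum>i<n. w \<nu> r * (norm (S (r - s) (C i s x)))\<^sup>2) \<le>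
        w \<nu> r * (r - s) powr (- 2 * \<alpha>) * (c * (norm x)\<^sup>2)"
    proof eventually_elim
      fix r assume "s < r"
      then have "w \<nu> r * (\<Sum>i<n. (norm (S (r - s) (C i s x)))\<^sup>2) \<le>
          w \<nu> r * (c * (r - s) powr (- 2 * \<alpha>) * (norm x)\<^sup>2)"
        by (intro mult_left_mono sum_norm_SC_le w_nonneg s') auto
      then show "(\<Sum>i<n. w \<nu> r * (norm (S (r - s) (C i s x)))\<^sup>2) \<le>
          w \<nu> r * (r - s) powr (- 2 * \<alpha>) * (c * (norm x)\<^sup>2)"
        by (simp add: sum_distrib_left mult_ac)
    qed
  qed
  also have "\<dots> = integral\<^sup>L (lebesgue_on {s..T}) (\<lambda>r. w \<nu> r * (r - s) powr (- 2 * \<alpha>)) * (c * (norm x)\<^sup>2)"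
    by (rule integral_mult_left_zero)
  finally show ?thesis by (simp only: mult_ac)
qed

text \<open>\<open>T - s\<close> is the largest value of \<open>r - s\<close>. The Lipschitz
  constant of the bracket is itself singular in s; this lets its product with a plain norm bound be
  absorbed by the same small kernel.\<close>

lemma integral_w_le_kernel:
  assumes \<nu>: "0 \<le> \<nu>" and s: "s \<in> {0..<T}"
    and i: "integrable (lebesgue_on {s..T}) (\<lambda>r. w \<nu> r * (r - s) powr (- 2 * \<alpha>))"
  shows "integral\<^sup>L (lebesgue_on {s..T}) (w \<nu>) * (T - s) powr (- 2 * \<alpha>) \<le>
    integral\<^sup>L (lebesgue_on {s..T}) (\<lambda>r. w \<nu> r * (r - s) powr (- 2 * \<alpha>))"
proof -
  have "integral\<^sup>L (lebesgue_on {s..T}) (\<lambda>r. w \<nu> r * (T - s) powr (- 2 * \<alpha>)) \<le>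
    integral\<^sup>L (lebesgue_on {s..T}) (\<lambda>r. w \<nu> r * (r - s) powr (- 2 * \<alpha>))"
  proof (rule integral_mono_AE[OF _ i])
    show "integrable (lebesgue_on {s..T}) (\<lambda>r. w \<nu> r * (T - s) powr (- 2 * \<alpha>))"
      using w_integrable[OF \<nu>, of s] s by simp
    have "AE r in lebesgue. r \<noteq> s" by (rule AE_completion) (rule AE_lborel_singleton)
    then have "AE r in lebesgue. r \<in> {s..T} \<longrightarrow> s < r \<and> r \<le> T" by eventually_elim auto
    then have "AE r in lebesgue_on {s..T}. s < r \<and> r \<le> T" by (subst AE_lebesgue_on_iff) simp_all
    then show "AE r in lebesgue_on {s..T}. w \<nu> r * (T - s) powr (- 2 * \<alpha>) \<le> w \<nu> r * (r - s) powr (- 2 * \<alpha>)"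
    proof eventually_elim
      fix r assume "s < r \<and> r \<le> T"
      then show "w \<nu> r * (T - s) powr (- 2 * \<alpha>) \<le> w \<nu> r * (r - s) powr (- 2 * \<alpha>)"
        using \<alpha> by (intro mult_left_mono w_nonneg powr_mono2') auto
    qed
  qed
  then show ?thesis by simp
qed

end

section \<open>The shifted fixed point map\<close>

lemma continuous_lebesgue_on_integral:
  fixes f :: "real \<Rightarrow> real"
  assumes "continuous_on {a..b} f"
  shows "integrable (lebesgue_on {a..b}) f" "integral\<^sup>L (lebesgue_on {a..b}) f = integral {a..b} f"
proof -
  show i: "integrable (lebesgue_on {a..b}) f" by (rule continuous_imp_integrable_real[OF assms])
  show "integral\<^sup>L (lebesgue_on {a..b}) f = integral {a..b} f"
    by (rule lebesgue_integral_eq_integral[OF i]) simp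
qed

lemma exp_kernel_integral:
  fixes \<mu> a t :: real
  assumes "t \<le> a"
  shows "integrable (lebesgue_on {t..a}) (\<lambda>s. \<mu> * exp (- \<mu> * (a - s)))"
    and "integral\<^sup>L (lebesgue_on {t..a}) (\<lambda>s. \<mu> * exp (- \<mu> * (a - s))) = 1 - exp (- \<mu> * (a - t))"
proof -
  have c: "continuous_on {t..a} (\<lambda>s. \<mu> * exp (- \<mu> * (a - s)))" by (intro continuous_intros)
  show "integrable (lebesgue_on {t..a}) (\<lambda>s. \<mu> * exp (- \<mu> * (a - s)))"
    by (rule continuous_lebesgue_on_integral[OF c])
  have "((\<lambda>s. \<mu> * exp (- \<mu> * (a - s))) has_integral
      (exp (- \<mu> * (a - a)) - exp (- \<mu> * (a - t)))) {t..a}"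
    by (rule fundamental_theorem_of_calculus[OF assms])
      (auto intro!: derivative_eq_intros simp flip: has_real_derivative_iff_has_vector_derivative)
  from integral_unique[OF this]
  show "integral\<^sup>L (lebesgue_on {t..a}) (\<lambda>s. \<mu> * exp (- \<mu> * (a - s))) = 1 - exp (- \<mu> * (a - t))"
    unfolding continuous_lebesgue_on_integral(2)[OF c] by (simp only: diff_self mult_zero_right exp_zero)
qed

text \<open>Variation of constants: an exponentially damped backward Volterra identity is equivalent
  to the undamped one with the damping moved into the integrand.\<close>

lemma backward_volterra_shift:
  fixes g h :: "real \<Rightarrow> real"
  assumes t: "t \<le> T" and h: "integrable (lebesgue_on {t..T}) h"
    and g: "\<And>s. s \<in> {t..T} \<Longrightarrow> g s = exp (- \<mu> * (T - s)) * gT +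
        integral\<^sup>L (lebesgue_on {s..T}) (\<lambda>r. exp (- \<mu> * (r - s)) * h r)"
  shows "integrable (lebesgue_on {t..T}) (\<lambda>r. h r - \<mu> * g r)"
    and "g t = gT + integral\<^sup>L (lebesgue_on {t..T}) (\<lambda>r. h r - \<mu> * g r)"
proof -
  define M where "M = lebesgue_on {t..T}"
  have spM: "space M = {t..T}" by (simp add: M_def)
  have fin: "finite_measure M" unfolding M_def by (intro finite_measure_lebesgue_on) simp
  interpret M: finite_measure M by (rule fin)
  interpret MM: pair_sigma_finite M M by unfold_locales
  have hM[measurable]: "h \<in> borel_measurable M" and ihM: "integrable M h" using h by (auto simp: M_def)
  have idM[measurable]: "(\<lambda>x. x) \<in> borel_measurable M"
    unfolding M_def by (intro continuous_imp_measurable_on_sets_lebesgue continuous_intros) simp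
  \<comment> \<open>\<open>f\<close> lives on the triangle where s is at most r. Integrating first
    in r gives \<open>\<mu> * g\<close> up to the terminal term, integrating first in s gives
    \<open>h\<close> minus its damped version, and Fubini equates the two results.\<close>
  define f where "f s r = (if s \<le> r then \<mu> * exp (- \<mu> * (r - s)) else 0) * h r" for s r
  define K where "K = \<bar>\<mu>\<bar> * exp (\<bar>\<mu>\<bar> * (T - t))"
  have K0: "0 \<le> K" by (simp add: K_def)
  have fK: "\<bar>f s r\<bar> \<le> K * \<bar>h r\<bar>" if "s \<in> {t..T}" "r \<in> {t..T}" for s r
  proof (cases "s \<le> r")
    case True
    have "- \<mu> * (r - s) \<le> \<bar>\<mu>\<bar> * (r - s)" using True by (intro mult_right_mono) auto
    also have "\<dots> \<le> \<bar>\<mu>\<bar> * (T - t)" using that by (intro mult_left_mono) auto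
    finally have "exp (- \<mu> * (r - s)) \<le> exp (\<bar>\<mu>\<bar> * (T - t))" by simp
    then have "\<bar>\<mu>\<bar> * exp (- \<mu> * (r - s)) * \<bar>h r\<bar> \<le> K * \<bar>h r\<bar>"
      unfolding K_def by (intro mult_right_mono mult_left_mono) auto
    then show ?thesis using True by (simp add: f_def abs_mult)
  qed (simp add: f_def K0)
  have fm: "case_prod f \<in> borel_measurable (M \<Otimes>\<^sub>M M)"
    unfolding f_def by measurable
  have iKh: "integrable (M \<Otimes>\<^sub>M M) (\<lambda>(s, r). K * \<bar>h r\<bar>)"
  proof (rule MM.Fubini_integrable)
    show "(\<lambda>(s, r). K * \<bar>h r\<bar>) \<in> borel_measurable (M \<Otimes>\<^sub>M M)" by measurable
  qed (use ihM in simp_all)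
  have fi: "integrable (M \<Otimes>\<^sub>M M) (case_prod f)"
  proof (rule Bochner_Integration.integrable_bound[OF iKh fm])
    show "AE x in M \<Otimes>\<^sub>M M. norm (case_prod f x) \<le> norm (case x of (s, r) \<Rightarrow> K * \<bar>h r\<bar>)"
    proof (rule AE_I2)
      fix x assume "x \<in> space (M \<Otimes>\<^sub>M M)"
      then obtain s r where "x = (s, r)" "s \<in> {t..T}" "r \<in> {t..T}"
        by (auto simp: space_pair_measure spM)
      then show "norm (case_prod f x) \<le> norm (case x of (s, r) \<Rightarrow> K * \<bar>h r\<bar>)" using fK[of s r] by simp
    qed
  qed
  have inner1: "integral\<^sup>L M (f s) = \<mu> * g s - \<mu> * exp (- \<mu> * (T - s)) * gT" if s: "s \<in> {t..T}" for s
  proof -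
    have "integral\<^sup>L M (f s) = integral\<^sup>L lebesgue (\<lambda>r. indicator {t..T} r *\<^sub>R f s r)"
      unfolding M_def by (rule integral_lebesgue_on_eq) simp
    also have "\<dots> = integral\<^sup>L lebesgue (\<lambda>r. indicator {s..T} r *\<^sub>R (\<mu> * (exp (- \<mu> * (r - s)) * h r)))"
      using s by (intro Bochner_Integration.integral_cong) (auto simp: indicator_def f_def)
    also have "\<dots> = integral\<^sup>L (lebesgue_on {s..T}) (\<lambda>r. \<mu> * (exp (- \<mu> * (r - s)) * h r))"
      by (rule integral_lebesgue_on_eq[symmetric]) simp
    also have "\<dots> = \<mu> * integral\<^sup>L (lebesgue_on {s..T}) (\<lambda>r. exp (- \<mu> * (r - s)) * h r)"
      by (rule integral_mult_right_zero)
    finally show ?thesis unfolding g[OF s] by (simp add: distrib_left)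
  qed
  have inner2: "integral\<^sup>L M (\<lambda>s. f s r) = h r - exp (- \<mu> * (r - t)) * h r" if r: "r \<in> {t..T}" for r
  proof -
    have "integral\<^sup>L M (\<lambda>s. f s r) = integral\<^sup>L lebesgue (\<lambda>s. indicator {t..T} s *\<^sub>R f s r)"
      unfolding M_def by (rule integral_lebesgue_on_eq) simp
    also have "\<dots> = integral\<^sup>L lebesgue (\<lambda>s. indicator {t..r} s *\<^sub>R (\<mu> * exp (- \<mu> * (r - s)) * h r))"
      using r by (intro Bochner_Integration.integral_cong) (auto simp: indicator_def f_def)
    also have "\<dots> = integral\<^sup>L (lebesgue_on {t..r}) (\<lambda>s. \<mu> * exp (- \<mu> * (r - s)) * h r)"
      by (rule integral_lebesgue_on_eq[symmetric]) simp
    also have "\<dots> = integral\<^sup>L (lebesgue_on {t..r}) (\<lambda>s. \<mu> * exp (- \<mu> * (r - s))) * h r"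
      by (rule integral_mult_left_zero)
    also have "\<dots> = (1 - exp (- \<mu> * (r - t))) * h r"
      using r by (subst exp_kernel_integral(2)) auto
    finally show ?thesis by (simp add: left_diff_distrib)
  qed
  have i1: "integrable M (\<lambda>s. \<mu> * g s - \<mu> * exp (- \<mu> * (T - s)) * gT)"
    using MM.integrable_fst'[OF fi] inner1 spM
    by (subst Bochner_Integration.integrable_cong[OF refl, of _ _ "\<lambda>s. integral\<^sup>L M (f s)"]) auto
  have i2: "integrable M (\<lambda>s. \<mu> * exp (- \<mu> * (T - s)) * gT)"
    unfolding M_def by (intro integrable_mult_left exp_kernel_integral t)
  have i3: "integrable M (\<lambda>s. \<mu> * g s)"
    using Bochner_Integration.integrable_add[OF i1 i2] by simp
  have i4: "integrable M (\<lambda>r. exp (- \<mu> * (r - t)) * h r)"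
  proof -
    have "integrable M (\<lambda>r. exp (\<bar>\<mu>\<bar> * (T - t)) * h r)" using ihM by simp
    then show ?thesis
    proof (rule Bochner_Integration.integrable_bound)
      show "AE r in M. norm (exp (- \<mu> * (r - t)) * h r) \<le> norm (exp (\<bar>\<mu>\<bar> * (T - t)) * h r)"
      proof (rule AE_I2)
        fix r assume "r \<in> space M"
        then have r: "t \<le> r" "r \<le> T" by (auto simp: spM)
        have "- \<mu> * (r - t) \<le> \<bar>\<mu>\<bar> * (r - t)" using r by (intro mult_right_mono) auto
        also have "\<dots> \<le> \<bar>\<mu>\<bar> * (T - t)" using r by (intro mult_left_mono) auto
        finally have "exp (- \<mu> * (r - t)) \<le> exp (\<bar>\<mu>\<bar> * (T - t))" by simp
        then show "norm (exp (- \<mu> * (r - t)) * h r) \<le> norm (exp (\<bar>\<mu>\<bar> * (T - t)) * h r)"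
          by (simp add: abs_mult mult_right_mono)
      qed
    qed measurable
  qed
  have "integral\<^sup>L M (\<lambda>r. integral\<^sup>L M (\<lambda>s. f s r)) = integral\<^sup>L M (\<lambda>s. integral\<^sup>L M (f s))"
    by (rule MM.Fubini_integral[OF fi])
  moreover have "integral\<^sup>L M (\<lambda>r. integral\<^sup>L M (\<lambda>s. f s r)) = integral\<^sup>L M (\<lambda>r. h r - exp (- \<mu> * (r - t)) * h r)"
    by (intro Bochner_Integration.integral_cong refl inner2) (simp add: spM)
  moreover have "\<dots> = integral\<^sup>L M h - integral\<^sup>L M (\<lambda>r. exp (- \<mu> * (r - t)) * h r)"
    by (rule Bochner_Integration.integral_diff[OF ihM i4])
  moreover have "integral\<^sup>L M (\<lambda>s. integral\<^sup>L M (f s)) = integral\<^sup>L M (\<lambda>s. \<mu> * g s - \<mu> * exp (- \<mu> * (T - s)) * gT)"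
    by (intro Bochner_Integration.integral_cong refl inner1) (simp add: spM)
  moreover have "\<dots> = integral\<^sup>L M (\<lambda>s. \<mu> * g s) - integral\<^sup>L M (\<lambda>s. \<mu> * exp (- \<mu> * (T - s)) * gT)"
    by (rule Bochner_Integration.integral_diff[OF i3 i2])
  moreover have "integral\<^sup>L M (\<lambda>s. \<mu> * exp (- \<mu> * (T - s)) * gT) = (1 - exp (- \<mu> * (T - t))) * gT"
    unfolding M_def using exp_kernel_integral(2)[OF t, of \<mu>] by (subst integral_mult_left_zero) simp
  moreover have "g t = exp (- \<mu> * (T - t)) * gT + integral\<^sup>L M (\<lambda>r. exp (- \<mu> * (r - t)) * h r)"
    unfolding M_def using t by (intro g) simp
  moreover have "integral\<^sup>L M (\<lambda>r. h r - \<mu> * g r) = integral\<^sup>L M h - integral\<^sup>L M (\<lambda>r. \<mu> * g r)"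
    by (rule Bochner_Integration.integral_diff[OF ihM i3])
  ultimately have "g t = gT + integral\<^sup>L M (\<lambda>r. h r - \<mu> * g r)"
    by (simp add: left_diff_distrib)
  then show "g t = gT + integral\<^sup>L (lebesgue_on {t..T}) (\<lambda>r. h r - \<mu> * g r)" by (simp add: M_def)
  show "integrable (lebesgue_on {t..T}) (\<lambda>r. h r - \<mu> * g r)"
    using Bochner_Integration.integrable_diff[OF ihM i3] by (simp add: M_def)
qed

section \<open>The shifted map and its contraction property\<close>

context riccati_data
begin

text \<open>Generated by A - \<mu>/2: the semigroup enters a conjugation twice, so forms are damped
  by \<open>exp (- \<mu> * t)\<close>.\<close>

definition Sm :: "real \<Rightarrow> real \<Rightarrow> 'h \<Rightarrow>\<^sub>L 'h" where
  "Sm \<mu> t = exp (- \<mu> * t / 2) *\<^sub>R S t"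

lemma semigroup_Sm: "semigroup_on T (Sm \<mu>)"
proof
  show "0 < T" by (rule T_pos)
  show "C0_semigroup (Sm \<mu>)"
    unfolding C0_semigroup_def
  proof (intro conjI allI impI)
    show "Sm \<mu> 0 = id_blinfun" by (simp add: Sm_def S_0)
    show "Sm \<mu> (s + t) = Sm \<mu> s o\<^sub>L Sm \<mu> t" if "0 \<le> s" "0 \<le> t" for s t
    proof (rule blinfun_eqI)
      fix x
      have "exp (- \<mu> * (s + t) / 2) = exp (- \<mu> * s / 2) * exp (- \<mu> * t / 2)"
        by (simp add: exp_add[symmetric] field_simps)
      then show "Sm \<mu> (s + t) x = (Sm \<mu> s o\<^sub>L Sm \<mu> t) x"
        using that by (simp add: Sm_def S_add blinfun.bilinear_simps)
    qed
    show "continuous_on {0..} (\<lambda>t. Sm \<mu> t x)" for x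
      unfolding Sm_def blinfun.scaleR_left by (intro continuous_intros S_cont) simp
  qed
qed

lemma Sm_0: "Sm 0 = S"
  by (simp add: Sm_def fun_eq_iff)

lemma form_Sm: "M (Sm \<mu> t x) \<bullet> Sm \<mu> t y = exp (- \<mu> * t) * (M (S t x) \<bullet> S t y)"
  for M :: "'h \<Rightarrow>\<^sub>L 'h"
proof -
  have "exp (- \<mu> * t / 2) * exp (- \<mu> * t / 2) = exp (- \<mu> * t)"
    by (simp add: exp_add[symmetric])
  then show ?thesis by (simp add: Sm_def blinfun.bilinear_simps mult.assoc[symmetric])
qed

definition ker :: "real \<Rightarrow> (real \<Rightarrow> 'h \<Rightarrow>\<^sub>L 'h) \<Rightarrow> real \<Rightarrow> 'h \<Rightarrow>\<^sub>L 'h" where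
  "ker \<mu> P s = bracket s (P s) + \<mu> *\<^sub>R P s"

definition Gam :: "real \<Rightarrow> (real \<Rightarrow> 'h \<Rightarrow>\<^sub>L 'h) \<Rightarrow> real \<Rightarrow> 'h \<Rightarrow>\<^sub>L 'h" where
  "Gam \<mu> P = mild_op T (Sm \<mu>) G (ker \<mu> P)"

text \<open>The class on which the contraction is proved. It contains the iterates, with constants
  read off from \<open>U\<close>, and every solution in the sense of the theorem, with constants of
  its own; invariance is proved on a smaller class.\<close>

definition adm :: "real \<Rightarrow> real \<Rightarrow> (real \<Rightarrow> 'h \<Rightarrow>\<^sub>L 'h) \<Rightarrow> bool" where
  "adm \<beta> K P \<longleftrightarrow> (\<forall>x. continuous_on {0..T} (\<lambda>s. P s x)) \<and>
    (\<forall>s\<in>{0..T}. P s \<in> nonneg_ops \<and> norm (P s) \<le> \<beta>) \<and>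
    (\<forall>s\<in>{0..<T}. series_bound (P s) (\<lambda>i. C i s) (K * (T - s) powr (- 2 * \<alpha>)))"

text \<open>The weighted distance as a relation, which avoids an infimum and the question whether it
  is finite.\<close>

definition near :: "real \<Rightarrow> real \<Rightarrow> (real \<Rightarrow> 'h \<Rightarrow>\<^sub>L 'h) \<Rightarrow> (real \<Rightarrow> 'h \<Rightarrow>\<^sub>L 'h) \<Rightarrow> bool" where
  "near \<nu> a P P' \<longleftrightarrow> (\<forall>s\<in>{0..T}. \<forall>y. \<bar>P s y \<bullet> y - P' s y \<bullet> y\<bar> \<le> a * W \<nu> s y)"

lemma admD:
  assumes "adm \<beta> K P"
  shows "continuous_on {0..T} (\<lambda>s. P s x)"
    and "s \<in> {0..T} \<Longrightarrow> P s \<in> nonneg_ops" "s \<in> {0..T} \<Longrightarrow> norm (P s) \<le> \<beta>"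
    and "s \<in> {0..<T} \<Longrightarrow> series_bound (P s) (\<lambda>i. C i s) (K * (T - s) powr (- 2 * \<alpha>))"
  using assms unfolding adm_def by blast+

lemma adm_good:
  assumes "adm \<beta> K P" "good s"
  shows "P s \<in> nonneg_ops" "norm (P s) \<le> \<beta>" "series_bound (P s) (\<lambda>i. C i s) (K * (T - s) powr (- 2 * \<alpha>))"
  using admD(2)[OF assms(1) goodD(1)[OF assms(2)]] admD(3)[OF assms(1) goodD(1)[OF assms(2)]]
    admD(4)[OF assms(1) goodD(2)[OF assms(2)]] .

text \<open>Multiplying bounded terms by this factor brings every estimate into the single form of a
  constant times \<open>(T - s) powr (- 2 * \<alpha>)\<close>.\<close>

lemma one_le_powr: "s \<in> {0..<T} \<Longrightarrow> 1 \<le> T powr (2 * \<alpha>) * (T - s) powr (- 2 * \<alpha>)"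
proof -
  assume "s \<in> {0..<T}"
  then have "T powr (2 * \<alpha>) * T powr (- 2 * \<alpha>) \<le> T powr (2 * \<alpha>) * (T - s) powr (- 2 * \<alpha>)"
    by (intro mult_left_mono powr_ge) auto
  moreover have "T powr (2 * \<alpha>) * T powr (- 2 * \<alpha>) = 1" using T_pos by (simp flip: powr_add)
  ultimately show ?thesis by simp
qed

definition kbound :: "real \<Rightarrow> real \<Rightarrow> real \<Rightarrow> real" where
  "kbound \<beta> K \<mu> = K + (q + b\<^sup>2 * \<beta>\<^sup>2 / \<delta> + \<mu> * \<beta>) * T powr (2 * \<alpha>)"

lemma kbound_nonneg: "0 \<le> \<beta> \<Longrightarrow> 0 \<le> K \<Longrightarrow> 0 \<le> \<mu> \<Longrightarrow> 0 \<le> kbound \<beta> K \<mu>"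
  using q0 \<delta> by (simp add: kbound_def)

lemma ker_selfadj:
  assumes P: "adm \<beta> K P" and good: "good s"
  shows "op_adj (ker \<mu> P s) = ker \<mu> P s"
proof (rule op_adj_eqI)
  fix x y
  note sa = bracket_selfadj[OF good adm_good[OF P good]]
  show "ker \<mu> P s x \<bullet> y = x \<bullet> ker \<mu> P s y"
    using selfadj_inner[OF sa, of x y] nonneg_opsD(3)[OF adm_good(1)[OF P good], of x y]
    by (simp add: ker_def blinfun.bilinear_simps inner_simps)
qed

lemma ker_norm_le:
  assumes P: "adm \<beta> K P" and good: "good s" and K: "0 \<le> K" and \<mu>: "0 \<le> \<mu>"
  shows "norm (ker \<mu> P s) \<le> kbound \<beta> K \<mu> * (T - s) powr (- 2 * \<alpha>)"
proof -
  define p where "p = (T - s) powr (- 2 * \<alpha>)"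
  have \<beta>: "0 \<le> \<beta>" using adm_good(2)[OF P good] norm_ge_zero order_trans by blast
  have "norm (ker \<mu> P s) \<le> norm (bracket s (P s)) + norm (\<mu> *\<^sub>R P s)"
    unfolding ker_def by (rule norm_triangle_ineq)
  also have "\<dots> \<le> (K * p + q + b\<^sup>2 * \<beta>\<^sup>2 / \<delta>) + \<mu> * \<beta>"
  proof (rule add_mono)
    show "norm (bracket s (P s)) \<le> K * p + q + b\<^sup>2 * \<beta>\<^sup>2 / \<delta>"
      unfolding p_def by (rule bracket_norm_le[OF good adm_good[OF P good]]) (use K in simp)
    show "norm (\<mu> *\<^sub>R P s) \<le> \<mu> * \<beta>"
      using adm_good(2)[OF P good] \<mu> by (simp add: mult_left_mono)
  qed
  also have "\<dots> = K * p + (q + b\<^sup>2 * \<beta>\<^sup>2 / \<delta> + \<mu> * \<beta>) * 1" by simp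
  also have "\<dots> \<le> K * p + (q + b\<^sup>2 * \<beta>\<^sup>2 / \<delta> + \<mu> * \<beta>) * (T powr (2 * \<alpha>) * p)"
    unfolding p_def using \<beta> \<mu> \<delta> q0 by (intro add_left_mono mult_left_mono one_le_powr goodD(2)[OF good]) auto
  also have "\<dots> = kbound \<beta> K \<mu> * p" by (simp add: kbound_def algebra_simps)
  finally show ?thesis unfolding p_def .
qed

lemma ker_dom:
  assumes P: "adm \<beta> K P" and K: "0 \<le> K" and \<mu>: "0 \<le> \<mu>"
  shows "kernel_dom T (ker \<mu> P) (\<lambda>s. kbound \<beta> K \<mu> * (T - s) powr (- 2 * \<alpha>))"
  unfolding kernel_dom_def
proof (intro conjI allI)
  fix x
  have Pm: "(\<lambda>s. P s x) \<in> borel_measurable (lebesgue_on {0..T})"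
    by (intro continuous_imp_measurable_on_sets_lebesgue admD(1)[OF P]) simp
  have "(\<lambda>s. bracket s (P s) x) \<in> borel_measurable (lebesgue_on {0..T})"
  proof (rule bracket_measurable)
    show "P s \<in> nonneg_ops" if "s \<in> {0..<T}" for s using that by (intro admD(2)[OF P]) auto
    show "\<exists>k. series_bound (P s) (\<lambda>i. C i s) k" if "s \<in> {0..<T}" for s using admD(4)[OF P that] by blast
  qed (rule admD(1)[OF P])
  then show "(\<lambda>s. ker \<mu> P s x) \<in> borel_measurable (lebesgue_on {0..T})"
    unfolding ker_def blinfun.add_left blinfun.scaleR_left
    by (intro borel_measurable_add borel_measurable_scaleR borel_measurable_const Pm)
  show "integrable (lebesgue_on {0..T}) (\<lambda>s. kbound \<beta> K \<mu> * (T - s) powr (- 2 * \<alpha>))"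
    using \<alpha> T_pos by (intro integrable_mult_right powr_from_right_lebesgue) auto
  show "AE s in lebesgue_on {0..T}. op_adj (ker \<mu> P s) = ker \<mu> P s \<and>
      norm (ker \<mu> P s) \<le> kbound \<beta> K \<mu> * (T - s) powr (- 2 * \<alpha>)"
    using AE_good
  proof eventually_elim
    fix s assume "good s"
    then show "op_adj (ker \<mu> P s) = ker \<mu> P s \<and> norm (ker \<mu> P s) \<le> kbound \<beta> K \<mu> * (T - s) powr (- 2 * \<alpha>)"
      using ker_selfadj[OF P] ker_norm_le[OF P _ K \<mu>] by blast
  qed
qed

lemma Gam_form:
  assumes P: "adm \<beta> K P" and K: "0 \<le> K" and \<mu>: "0 \<le> \<mu>" and t: "t \<in> {0..T}"
  shows "integrable (lebesgue_on {t..T}) (\<lambda>s. exp (- \<mu> * (s - t)) * (ker \<mu> P s (S (s - t) x) \<bullet> S (s - t) y))"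
    and "Gam \<mu> P t x \<bullet> y = exp (- \<mu> * (T - t)) * (G (S (T - t) x) \<bullet> S (T - t) y) +
      integral\<^sup>L (lebesgue_on {t..T}) (\<lambda>s. exp (- \<mu> * (s - t)) * (ker \<mu> P s (S (s - t) x) \<bullet> S (s - t) y))"
  using semigroup_on.mild_op_form_integrable[OF semigroup_Sm ker_dom[OF P K \<mu>] t, of \<mu> x y]
    semigroup_on.mild_op_inner[OF semigroup_Sm ker_dom[OF P K \<mu>] t, of \<mu> G x y]
  unfolding Gam_def form_Sm by blast+

lemma Gam_selfadj:
  assumes "adm \<beta> K P" "0 \<le> K" "0 \<le> \<mu>" "t \<in> {0..T}"
  shows "op_adj (Gam \<mu> P t) = Gam \<mu> P t"
  unfolding Gam_def
  by (rule semigroup_on.mild_op_selfadj[OF semigroup_Sm ker_dom[OF assms(1-3)] assms(4) nonneg_opsD(1)[OF G]])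

lemma Gam_continuous:
  assumes "adm \<beta> K P" "0 \<le> K" "0 \<le> \<mu>"
  shows "continuous_on {0..T} (\<lambda>t. Gam \<mu> P t x)"
  unfolding Gam_def by (rule semigroup_on.mild_op_continuous[OF semigroup_Sm ker_dom[OF assms]])

lemma AE_good_sub: "t \<in> {0..T} \<Longrightarrow> AE s in lebesgue_on {t..T}. good s"
  by (rule AE_lebesgue_on_subset[OF AE_good]) auto

text \<open>The terminal terms cancel and the damping factor is at most 1. Integrating
  \<open>a * w\<close> times the squared norm along the trajectory of y gives \<open>a * W\<close>
  by the definition of \<open>W\<close>.\<close>

lemma Gam_near:
  assumes P: "adm \<beta> K P" and P': "adm \<beta> K P'" and K: "0 \<le> K" and \<mu>: "0 \<le> \<mu>" and \<nu>: "0 \<le> \<nu>"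
    and a: "0 \<le> a"
    and le: "\<And>s x. good s \<Longrightarrow> \<bar>ker \<mu> P s x \<bullet> x - ker \<mu> P' s x \<bullet> x\<bar> \<le> a * w \<nu> s * (norm x)\<^sup>2"
  shows "near \<nu> a (Gam \<mu> P) (Gam \<mu> P')"
  unfolding near_def
proof (intro ballI allI)
  fix t y assume t: "t \<in> {0..T}"
  let ?f = "\<lambda>P s. exp (- \<mu> * (s - t)) * (ker \<mu> P s (S (s - t) y) \<bullet> S (s - t) y)"
  have i: "integrable (lebesgue_on {t..T}) (?f P)" "integrable (lebesgue_on {t..T}) (?f P')"
    by (rule Gam_form[OF P K \<mu> t], rule Gam_form[OF P' K \<mu> t])
  have "Gam \<mu> P t y \<bullet> y - Gam \<mu> P' t y \<bullet> y =
      integral\<^sup>L (lebesgue_on {t..T}) (?f P) - integral\<^sup>L (lebesgue_on {t..T}) (?f P')"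
    unfolding Gam_form(2)[OF P K \<mu> t] Gam_form(2)[OF P' K \<mu> t] by simp
  also have "\<dots> = integral\<^sup>L (lebesgue_on {t..T}) (\<lambda>s. ?f P s - ?f P' s)"
    by (rule Bochner_Integration.integral_diff[OF i, symmetric])
  finally have "\<bar>Gam \<mu> P t y \<bullet> y - Gam \<mu> P' t y \<bullet> y\<bar> \<le>
      integral\<^sup>L (lebesgue_on {t..T}) (\<lambda>s. \<bar>?f P s - ?f P' s\<bar>)"
    by (simp only:) (rule integral_abs_bound)
  also have "\<dots> \<le> integral\<^sup>L (lebesgue_on {t..T}) (\<lambda>s. a * (w \<nu> s * (norm (S (s - t) y))\<^sup>2))"
  proof (rule integral_mono_AE)
    show "integrable (lebesgue_on {t..T}) (\<lambda>s. \<bar>?f P s - ?f P' s\<bar>)" by (intro integrable_abs Bochner_Integration.integrable_diff i)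
    show "integrable (lebesgue_on {t..T}) (\<lambda>s. a * (w \<nu> s * (norm (S (s - t) y))\<^sup>2))"
      by (intro integrable_mult_right W_integrable \<nu> t)
    show "AE s in lebesgue_on {t..T}. \<bar>?f P s - ?f P' s\<bar> \<le> a * (w \<nu> s * (norm (S (s - t) y))\<^sup>2)"
      using AE_good_sub[OF t] AE_space
    proof eventually_elim
      fix s assume good: "good s" and s: "s \<in> space (lebesgue_on {t..T})"
      define x where "x = S (s - t) y"
      have "exp (- \<mu> * (s - t)) \<le> 1" using s \<mu> by (simp add: mult_nonneg_nonneg)
      then have "exp (- \<mu> * (s - t)) * \<bar>ker \<mu> P s x \<bullet> x - ker \<mu> P' s x \<bullet> x\<bar> \<le> 1 * (a * w \<nu> s * (norm x)\<^sup>2)"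
        using le[OF good, of x] by (intro mult_mono) auto
      then show "\<bar>?f P s - ?f P' s\<bar> \<le> a * (w \<nu> s * (norm (S (s - t) y))\<^sup>2)"
        by (simp add: x_def[symmetric] right_diff_distrib[symmetric] abs_mult mult.assoc)
    qed
  qed
  also have "\<dots> = a * W \<nu> t y" unfolding W_def by (rule integral_mult_right_zero)
  finally show "\<bar>Gam \<mu> P t y \<bullet> y - Gam \<mu> P' t y \<bullet> y\<bar> \<le> a * W \<nu> t y" .
qed

text \<open>Starts the contraction. Two admissible functions need not be comparable themselves,
  since \<open>W\<close> vanishes at T; their images always are, because both kernels are bounded by
  a multiple of \<open>w\<close>.\<close>

lemma Gam_near_initial:
  assumes P: "adm \<beta> K P" and P': "adm \<beta> K P'" and \<beta>: "0 \<le> \<beta>" and K: "0 \<le> K" and \<mu>: "0 \<le> \<mu>" and \<nu>: "0 \<le> \<nu>"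
  shows "near \<nu> (2 * kbound \<beta> K \<mu>) (Gam \<mu> P) (Gam \<mu> P')"
proof (rule Gam_near[OF P P' K \<mu> \<nu>])
  show "0 \<le> 2 * kbound \<beta> K \<mu>" using kbound_nonneg[OF \<beta> K \<mu>] by simp
  fix s x assume good: "good s"
  have "\<bar>ker \<mu> P s x \<bullet> x\<bar> \<le> kbound \<beta> K \<mu> * w \<nu> s * (norm x)\<^sup>2" if "adm \<beta> K P" for P
  proof -
    have "\<bar>ker \<mu> P s x \<bullet> x\<bar> \<le> norm (ker \<mu> P s) * (norm x)\<^sup>2" by (rule form_le_norm)
    also have "\<dots> \<le> (kbound \<beta> K \<mu> * w \<nu> s) * (norm x)\<^sup>2"
    proof (rule mult_right_mono)
      have "norm (ker \<mu> P s) \<le> kbound \<beta> K \<mu> * (T - s) powr (- 2 * \<alpha>)" by (rule ker_norm_le[OF that good K \<mu>])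
      also have "\<dots> \<le> kbound \<beta> K \<mu> * w \<nu> s"
        by (intro mult_left_mono w_ge \<nu> goodD(1)[OF good] kbound_nonneg \<beta> K \<mu>)
      finally show "norm (ker \<mu> P s) \<le> kbound \<beta> K \<mu> * w \<nu> s" .
    qed simp
    finally show ?thesis .
  qed
  from this[OF P] this[OF P']
  show "\<bar>ker \<mu> P s x \<bullet> x - ker \<mu> P' s x \<bullet> x\<bar> \<le> 2 * kbound \<beta> K \<mu> * w \<nu> s * (norm x)\<^sup>2" by linarith
qed

text \<open>\<open>bracket_diff_le\<close> with \<open>Y = a * W\<close>. The C-part is bounded
  directly by the kernel integral. The other parts carry \<open>\<xi>\<close>, a multiple of the
  integral of \<open>w\<close>, times coefficients of order (T-s)^(-2\<alpha>), and
  \<open>integral_w_le_kernel\<close> returns this product to the kernel integral.\<close>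

lemma ker_diff_le:
  assumes P: "adm \<beta> K P" and P': "adm \<beta> K P'" and K: "0 \<le> K" and \<mu>: "0 \<le> \<mu>"
    and \<nu>: "\<nu> > 0" and a: "0 \<le> a" and win: "near \<nu> a P P'" and good: "good s"
    and ik: "integrable (lebesgue_on {s..T}) (\<lambda>r. w \<nu> r * (r - s) powr (- 2 * \<alpha>))"
    and sm: "integral\<^sup>L (lebesgue_on {s..T}) (\<lambda>r. w \<nu> r * (r - s) powr (- 2 * \<alpha>)) \<le> \<epsilon> * w \<nu> s"
  defines "\<kappa>\<^sub>1 \<equiv> T powr (2 * \<alpha>) * (1 + \<mu> + (2 * c + b\<^sup>2) * (2 / \<delta> * (2 * b\<^sup>2 * \<beta>\<^sup>2 / \<delta>))) + (2 * c + b\<^sup>2) * (2 / \<delta> * K)"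
  shows "ker \<mu> P s x \<bullet> x - ker \<mu> P' s x \<bullet> x \<le> (2 * c + NS\<^sup>2 * \<kappa>\<^sub>1) * \<epsilon> * a * w \<nu> s * (norm x)\<^sup>2"
proof -
  have s: "s \<in> {0..<T}" and s': "s \<in> {0..T}" using goodD[OF good] by blast+
  have \<nu>0: "0 \<le> \<nu>" using \<nu> by simp
  define p where "p = (T - s) powr (- 2 * \<alpha>)"
  define I where "I = integral\<^sup>L (lebesgue_on {s..T}) (w \<nu>)"
  define e where "e = integral\<^sup>L (lebesgue_on {s..T}) (\<lambda>r. w \<nu> r * (r - s) powr (- 2 * \<alpha>))"
  define \<xi> where "\<xi> = a * (NS\<^sup>2 * I)"
  define \<rho> where "\<rho> = a * (c * e)"
  define L where "L = 2 / \<delta> * (K * p + 2 * b\<^sup>2 * \<beta>\<^sup>2 / \<delta>)"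
  have I0: "0 \<le> I" unfolding I_def by (intro integral_nonneg_AE AE_lebesgue_on_I) (simp add: w_nonneg)
  have \<xi>0: "0 \<le> \<xi>" using a I0 by (simp add: \<xi>_def)
  have c2: "0 \<le> 2 * c + b\<^sup>2" using c by (simp add: add_nonneg_nonneg)
  have XY: "\<bar>P s y \<bullet> y - P' s y \<bullet> y\<bar> \<le> a * W \<nu> s y" for y
    using win s' by (simp add: near_def)
  have Wn: "a * W \<nu> s y \<le> \<xi> * (norm y)\<^sup>2" for y
    unfolding \<xi>_def I_def using mult_left_mono[OF W_le[OF \<nu>0 s', of y] a] by (simp add: mult.assoc)
  have "bracket s (P s) x \<bullet> x - bracket s (P' s) x \<bullet> x \<le> (2 * \<rho> + \<xi> * (1 + (2 * c + b\<^sup>2) * L)) * (norm x)\<^sup>2"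
    unfolding L_def p_def
  proof (rule bracket_diff_le[OF good adm_good[OF P good] adm_good[OF P' good] XY])
    show "a * W \<nu> s (y + z) \<le> 2 * (a * W \<nu> s y) + 2 * (a * W \<nu> s z)" for y z
      using mult_left_mono[OF W_add[OF \<nu>0 s', of y z] a] by (simp add: algebra_simps)
    show "(\<Sum>i<n. a * W \<nu> s (C i s x)) \<le> \<rho> * (norm x)\<^sup>2" for n x
    proof -
      have "a * (\<Sum>i<n. W \<nu> s (C i s x)) \<le> a * (c * e * (norm x)\<^sup>2)"
        unfolding e_def by (intro mult_left_mono a sum_W_C_le \<nu>0 s ik)
      then show ?thesis by (simp add: sum_distrib_left \<rho>_def mult.assoc)
    qed
  qed (rule Wn \<xi>0)+
  moreover have "\<mu> * (P s x \<bullet> x - P' s x \<bullet> x) \<le> \<mu> * (\<xi> * (norm x)\<^sup>2)"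
    using XY[of x] Wn[of x] by (intro mult_left_mono \<mu>) linarith
  ultimately have "ker \<mu> P s x \<bullet> x - ker \<mu> P' s x \<bullet> x \<le>
      (2 * \<rho> + \<xi> * (1 + \<mu> + (2 * c + b\<^sup>2) * L)) * (norm x)\<^sup>2"
    by (simp add: ker_def blinfun.bilinear_simps inner_simps algebra_simps)
  also have "\<dots> \<le> (2 * c + NS\<^sup>2 * \<kappa>\<^sub>1) * \<epsilon> * a * w \<nu> s * (norm x)\<^sup>2"
  proof (rule mult_right_mono)
    have "1 + \<mu> + (2 * c + b\<^sup>2) * L =
        (1 + \<mu> + (2 * c + b\<^sup>2) * (2 / \<delta> * (2 * b\<^sup>2 * \<beta>\<^sup>2 / \<delta>))) * 1 + (2 * c + b\<^sup>2) * (2 / \<delta> * K) * p"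
      by (simp add: L_def algebra_simps)
    also have "\<dots> \<le> (1 + \<mu> + (2 * c + b\<^sup>2) * (2 / \<delta> * (2 * b\<^sup>2 * \<beta>\<^sup>2 / \<delta>))) * (T powr (2 * \<alpha>) * p) +
        (2 * c + b\<^sup>2) * (2 / \<delta> * K) * p"
      unfolding p_def using c \<mu> c2 \<delta> by (intro add_right_mono mult_left_mono one_le_powr s add_nonneg_nonneg mult_nonneg_nonneg) auto
    also have "\<dots> = \<kappa>\<^sub>1 * p" by (simp add: \<kappa>\<^sub>1_def algebra_simps)
    finally have 1: "\<xi> * (1 + \<mu> + (2 * c + b\<^sup>2) * L) \<le> \<xi> * (\<kappa>\<^sub>1 * p)" using \<xi>0 by (intro mult_left_mono)
    have \<kappa>: "0 \<le> \<kappa>\<^sub>1" unfolding \<kappa>\<^sub>1_def using c \<mu> c2 \<delta> K by (intro add_nonneg_nonneg mult_nonneg_nonneg) auto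
    have "I * p \<le> e" unfolding I_def p_def e_def by (rule integral_w_le_kernel[OF \<nu>0 s ik])
    also have e: "e \<le> \<epsilon> * w \<nu> s" unfolding e_def by (rule sm)
    finally have "a * NS\<^sup>2 * \<kappa>\<^sub>1 * (I * p) \<le> a * NS\<^sup>2 * \<kappa>\<^sub>1 * (\<epsilon> * w \<nu> s)"
      using a \<kappa> by (intro mult_left_mono) auto
    moreover have "2 * a * c * e \<le> 2 * a * c * (\<epsilon> * w \<nu> s)" using a c e by (intro mult_left_mono) auto
    ultimately show "2 * \<rho> + \<xi> * (1 + \<mu> + (2 * c + b\<^sup>2) * L) \<le> (2 * c + NS\<^sup>2 * \<kappa>\<^sub>1) * \<epsilon> * a * w \<nu> s"
      using 1 by (simp add: \<xi>_def \<rho>_def algebra_simps)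
  qed simp
  finally show ?thesis .
qed

lemma near_sym: "near \<nu> a P P' \<Longrightarrow> near \<nu> a P' P"
  by (simp add: near_def abs_minus_commute)

text \<open>Kernel smallness with \<epsilon> = 1/(2\<kappa>), \<kappa> being the constant of
  \<open>ker_diff_le\<close>. Here \<nu> depends on \<beta>, K and \<mu>, but not on the pair
  compared.\<close>

lemma Gam_contraction:
  assumes K: "0 \<le> K" and \<mu>: "0 \<le> \<mu>"
  obtains \<nu> where "\<nu> > 0"
    "\<And>P P' a. adm \<beta> K P \<Longrightarrow> adm \<beta> K P' \<Longrightarrow> 0 \<le> a \<Longrightarrow> near \<nu> a P P' \<Longrightarrow>
      near \<nu> (a / 2) (Gam \<mu> P) (Gam \<mu> P')"
proof -
  define \<kappa>\<^sub>1 where "\<kappa>\<^sub>1 = T powr (2 * \<alpha>) * (1 + \<mu> + (2 * c + b\<^sup>2) * (2 / \<delta> * (2 * b\<^sup>2 * \<beta>\<^sup>2 / \<delta>))) + (2 * c + b\<^sup>2) * (2 / \<delta> * K)"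
  define \<kappa> where "\<kappa> = 2 * c + NS\<^sup>2 * \<kappa>\<^sub>1"
  have c2: "0 \<le> 2 * c + b\<^sup>2" using c by (simp add: add_nonneg_nonneg)
  have "0 \<le> \<kappa>\<^sub>1" unfolding \<kappa>\<^sub>1_def using c \<mu> c2 \<delta> K by (intro add_nonneg_nonneg mult_nonneg_nonneg) auto
  then have \<kappa>: "\<kappa> > 0" unfolding \<kappa>_def using c by (intro add_pos_nonneg) auto
  then have "1 / (2 * \<kappa>) > 0" by simp
  then obtain \<nu> where \<nu>: "\<nu> > 0"
    and ik: "\<And>s. s \<in> {0..<T} \<Longrightarrow> integrable (lebesgue_on {s..T}) (\<lambda>r. w \<nu> r * (r - s) powr (- 2 * \<alpha>))"
    and sm: "\<And>s. s \<in> {0..<T} \<Longrightarrow>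
      integral\<^sup>L (lebesgue_on {s..T}) (\<lambda>r. w \<nu> r * (r - s) powr (- 2 * \<alpha>)) \<le> 1 / (2 * \<kappa>) * w \<nu> s"
    using w_kernel_small by blast
  show thesis
  proof (rule that[OF \<nu>])
    fix P P' :: "real \<Rightarrow> 'h \<Rightarrow>\<^sub>L 'h" and a :: real
    assume P: "adm \<beta> K P" and P': "adm \<beta> K P'" and a: "0 \<le> a" and win: "near \<nu> a P P'"
    have key: "ker \<mu> P s x \<bullet> x - ker \<mu> P' s x \<bullet> x \<le> a / 2 * w \<nu> s * (norm x)\<^sup>2"
      if "adm \<beta> K P" "adm \<beta> K P'" "near \<nu> a P P'" "good s" for P P' s x
    proof -
      have "ker \<mu> P s x \<bullet> x - ker \<mu> P' s x \<bullet> x \<le> \<kappa> * (1 / (2 * \<kappa>)) * a * w \<nu> s * (norm x)\<^sup>2"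
        unfolding \<kappa>_def \<kappa>\<^sub>1_def
        by (rule ker_diff_le[OF that(1,2) K \<mu> \<nu> a that(3,4)])
          (use ik[OF goodD(2)[OF that(4)]] sm[OF goodD(2)[OF that(4)]] in \<open>simp_all add: \<kappa>_def \<kappa>\<^sub>1_def\<close>)
      also have "\<kappa> * (1 / (2 * \<kappa>)) = 1 / 2" using \<kappa> by simp
      finally show ?thesis by simp
    qed
    show "near \<nu> (a / 2) (Gam \<mu> P) (Gam \<mu> P')"
    proof (rule Gam_near[OF P P' K \<mu>])
      fix s x assume good: "good s"
      show "\<bar>ker \<mu> P s x \<bullet> x - ker \<mu> P' s x \<bullet> x\<bar> \<le> a / 2 * w \<nu> s * (norm x)\<^sup>2"
        using key[OF P P' win good, of x] key[OF P' P near_sym[OF win] good, of x] by linarith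
    qed (use \<nu> a in auto)
  qed
qed

end

section \<open>Existence and uniqueness\<close>

context riccati_data
begin

lemma adm_mono:
  assumes "adm \<beta> K P" "\<beta> \<le> \<beta>'" "K \<le> K'"
  shows "adm \<beta>' K' P"
  unfolding adm_def
proof (intro conjI allI ballI)
  show "continuous_on {0..T} (\<lambda>s. P s x)" for x by (rule admD(1)[OF assms(1)])
  show "P s \<in> nonneg_ops" if "s \<in> {0..T}" for s by (rule admD(2)[OF assms(1) that])
  show "norm (P s) \<le> \<beta>'" if "s \<in> {0..T}" for s using admD(3)[OF assms(1) that] assms(2) by linarith
  show "series_bound (P s) (\<lambda>i. C i s) (K' * (T - s) powr (- 2 * \<alpha>))" if "s \<in> {0..<T}" for s
    by (rule series_bound_mono[OF admD(4)[OF assms(1) that]]) (intro mult_right_mono assms(3), simp)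
qed

lemma near_cong:
  assumes "near \<nu> a P P'" "\<And>s. s \<in> {0..T} \<Longrightarrow> P s = X s" "\<And>s. s \<in> {0..T} \<Longrightarrow> P' s = X' s"
  shows "near \<nu> a X X'"
  using assms unfolding near_def by metis

lemma near_all_imp_eq:
  assumes n: "\<And>n::nat. near \<nu> (a / 2 ^ n) P P'" and s: "s \<in> {0..T}"
    and sa: "op_adj (P s) = P s" "op_adj (P' s) = P' s"
  shows "P s = P' s"
proof (rule selfadj_eqI[OF sa])
  fix y :: 'h
  have "(\<lambda>n. a * W \<nu> s y * (1 / 2) ^ n) \<longlonglongrightarrow> a * W \<nu> s y * 0"
    by (intro tendsto_mult tendsto_const LIMSEQ_power_zero) simp
  then have "\<bar>P s y \<bullet> y - P' s y \<bullet> y\<bar> \<le> a * W \<nu> s y * 0"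
  proof (rule LIMSEQ_le_const)
    show "\<exists>N. \<forall>n\<ge>N. \<bar>P s y \<bullet> y - P' s y \<bullet> y\<bar> \<le> a * W \<nu> s y * (1 / 2) ^ n"
    proof (intro exI allI impI)
      fix n
      have "\<bar>P s y \<bullet> y - P' s y \<bullet> y\<bar> \<le> a / 2 ^ n * W \<nu> s y" using n[of n] s by (simp add: near_def)
      also have "\<dots> = a * W \<nu> s y * (1 / 2) ^ n" by (simp add: power_divide)
      finally show "\<bar>P s y \<bullet> y - P' s y \<bullet> y\<bar> \<le> a * W \<nu> s y * (1 / 2) ^ n" .
    qed
  qed
  then show "P s y \<bullet> y = P' s y \<bullet> y" by simp
qed

text \<open>A fixed point is its own image, so \<open>Gam_near_initial\<close> compares the two to
  begin with, and each further application of the map halves the constant.\<close>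

lemma fixpoint_unique:
  assumes P: "adm \<beta> K P" "\<And>s. s \<in> {0..T} \<Longrightarrow> Gam 0 P s = P s"
    and P': "adm \<beta> K P'" "\<And>s. s \<in> {0..T} \<Longrightarrow> Gam 0 P' s = P' s"
    and \<beta>: "0 \<le> \<beta>" and K: "0 \<le> K" and s: "s \<in> {0..T}"
  shows "P s = P' s"
proof -
  obtain \<nu> where \<nu>: "\<nu> > 0" and contr: "\<And>P P' a. adm \<beta> K P \<Longrightarrow> adm \<beta> K P' \<Longrightarrow> 0 \<le> a \<Longrightarrow> near \<nu> a P P' \<Longrightarrow>
      near \<nu> (a / 2) (Gam 0 P) (Gam 0 P')"
    using Gam_contraction[OF K order_refl] by metis
  define a where "a = 2 * kbound \<beta> K 0"
  have a: "0 \<le> a" using kbound_nonneg[OF \<beta> K order_refl] by (simp add: a_def)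
  have "near \<nu> (a / 2 ^ n) P P'" for n
  proof (induction n)
    case 0
    have "near \<nu> a (Gam 0 P) (Gam 0 P')"
      unfolding a_def using \<nu> by (intro Gam_near_initial P(1) P'(1) \<beta> K) auto
    then show ?case using near_cong[of \<nu> a "Gam 0 P" "Gam 0 P'" P P'] P(2) P'(2) by simp
  next
    case (Suc n)
    have "near \<nu> (a / 2 ^ n / 2) (Gam 0 P) (Gam 0 P')"
      using a by (intro contr P(1) P'(1) Suc) simp
    then show ?case using near_cong[of \<nu> "a / 2 ^ n / 2" "Gam 0 P" "Gam 0 P'" P P'] P(2) P'(2)
      by (simp add: mult.commute)
  qed
  then show ?thesis
    by (rule near_all_imp_eq[OF _ s]) (rule nonneg_opsD(1), rule admD(2)[OF _ s], fact P(1) P'(1))+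
qed

lemma S_compose: "t \<le> s \<Longrightarrow> s \<le> r \<Longrightarrow> S (r - s) (S (s - t) x) = S (r - t) x"
  using S_add_apply[of "r - s" "s - t" x] by simp

text \<open>Along the trajectory \<open>S (s - t) x\<close> the form of \<open>P\<close> is a scalar
  function satisfying a damped backward Volterra identity, so \<open>backward_volterra_shift\<close>
  removes the damping; at s = t this is the form of the unshifted equation.\<close>

lemma fixpoint_shift:
  assumes P: "adm \<beta> K P" and K: "0 \<le> K" and \<mu>: "0 \<le> \<mu>"
    and fp: "\<And>s. s \<in> {0..T} \<Longrightarrow> Gam \<mu> P s = P s" and t: "t \<in> {0..T}"
  shows "Gam 0 P t = P t"
proof (rule selfadj_eqI)
  show "op_adj (Gam 0 P t) = Gam 0 P t" by (rule Gam_selfadj[OF P K order_refl t])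
  show "op_adj (P t) = P t" by (rule nonneg_opsD(1)[OF admD(2)[OF P t]])
  fix x :: 'h
  define g where "g s = P s (S (s - t) x) \<bullet> S (s - t) x" for s
  define h where "h r = ker \<mu> P r (S (r - t) x) \<bullet> S (r - t) x" for r
  define gT where "gT = G (S (T - t) x) \<bullet> S (T - t) x"
  have "g t = gT + integral\<^sup>L (lebesgue_on {t..T}) (\<lambda>r. h r - \<mu> * g r)"
  proof (rule backward_volterra_shift(2))
    show "t \<le> T" using t by simp
    show "integrable (lebesgue_on {t..T}) h"
      unfolding h_def by (rule mild_op_form_integrable[OF ker_dom[OF P K \<mu>] t])
    fix s assume s: "s \<in> {t..T}"
    then have s0: "s \<in> {0..T}" using t by auto
    have "g s = Gam \<mu> P s (S (s - t) x) \<bullet> S (s - t) x" using fp[OF s0] by (simp add: g_def)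
    also have "\<dots> = exp (- \<mu> * (T - s)) * gT + integral\<^sup>L (lebesgue_on {s..T})
        (\<lambda>r. exp (- \<mu> * (r - s)) * (ker \<mu> P r (S (r - s) (S (s - t) x)) \<bullet> S (r - s) (S (s - t) x)))"
      unfolding Gam_form(2)[OF P K \<mu> s0] gT_def using s by (simp add: S_compose)
    also have "integral\<^sup>L (lebesgue_on {s..T})
        (\<lambda>r. exp (- \<mu> * (r - s)) * (ker \<mu> P r (S (r - s) (S (s - t) x)) \<bullet> S (r - s) (S (s - t) x))) =
        integral\<^sup>L (lebesgue_on {s..T}) (\<lambda>r. exp (- \<mu> * (r - s)) * h r)"
      using s by (intro Bochner_Integration.integral_cong refl) (simp add: h_def S_compose)
    finally show "g s = exp (- \<mu> * (T - s)) * gT +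
        integral\<^sup>L (lebesgue_on {s..T}) (\<lambda>r. exp (- \<mu> * (r - s)) * h r)" .
  qed
  moreover have "h r - \<mu> * g r = ker 0 P r (S (r - t) x) \<bullet> S (r - t) x" for r
    by (simp add: h_def g_def ker_def blinfun.bilinear_simps inner_simps)
  moreover have "Gam 0 P t x \<bullet> x = gT + integral\<^sup>L (lebesgue_on {t..T}) (\<lambda>r. ker 0 P r (S (r - t) x) \<bullet> S (r - t) x)"
    unfolding Gam_form(2)[OF P K order_refl t] gT_def by simp
  moreover have "g t = P t x \<bullet> x" by (simp add: g_def S_0)
  ultimately show "Gam 0 P t x \<bullet> x = P t x \<bullet> x" by simp
qed

lemma Gam_0_apply:
  assumes P: "adm \<beta> K P" and K: "0 \<le> K" and t: "t \<in> {0..T}"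
  shows "integrable (lebesgue_on {t..T}) (\<lambda>s. op_adj (S (s - t)) (bracket s (P s) (S (s - t) x)))"
    and "Gam 0 P t x = op_adj (S (T - t)) (G (S (T - t) x)) +
      integral\<^sup>L (lebesgue_on {t..T}) (\<lambda>s. op_adj (S (s - t)) (bracket s (P s) (S (s - t) x)))"
proof -
  have k: "ker 0 P = (\<lambda>s. bracket s (P s))" by (simp add: ker_def fun_eq_iff)
  note dom = ker_dom[OF P K order_refl, unfolded k]
  show "integrable (lebesgue_on {t..T}) (\<lambda>s. op_adj (S (s - t)) (bracket s (P s) (S (s - t) x)))"
    by (rule kernel_integrable[OF dom t])
  show "Gam 0 P t x = op_adj (S (T - t)) (G (S (T - t) x)) +
      integral\<^sup>L (lebesgue_on {t..T}) (\<lambda>s. op_adj (S (s - t)) (bracket s (P s) (S (s - t) x)))"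
    unfolding Gam_def Sm_0 k by (rule mild_op_apply[OF dom t])
qed

text \<open>Admissibility supplies the integrability clause, so only the fixed point equation of the
  unshifted map remains.\<close>

lemma riccati_solution_iff:
  assumes P: "adm \<beta> K P" and K: "0 \<le> K"
  shows "riccati_solution T S B C D Q R G P \<longleftrightarrow> (\<forall>t\<in>{0..T}. Gam 0 P t = P t)"
proof -
  have "riccati_solution T S B C D Q R G P \<longleftrightarrow> (\<forall>t\<in>{0..T}. \<forall>x. P t x = Gam 0 P t x)"
    unfolding riccati_solution_def Let_def blinfun_compose.rep_eq comp_def
    using Gam_0_apply[OF P K] by simp
  also have "\<dots> \<longleftrightarrow> (\<forall>t\<in>{0..T}. Gam 0 P t = P t)"
    by (intro ball_cong refl iffI) (auto intro!: blinfun_eqI)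
  finally show ?thesis .
qed

section \<open>Admissibility versus the estimate of the theorem\<close>

lemma CPC_form: "CPC C s P i x \<bullet> x = P (C i s x) \<bullet> C i s x"
  by (simp add: CPC_def inner_op_adj')

lemma adm_imp_estimate:
  assumes P: "adm \<beta> K P" and K: "0 \<le> K"
  shows "riccati_estimate T \<alpha> C P K"
  unfolding riccati_estimate_def
proof (intro ballI conjI)
  fix s assume s: "s \<in> {0..<T}"
  then have s': "s \<in> {0..T}" by simp
  note bd = admD(4)[OF P s] and nn = admD(2)[OF P s']
  show "form_summable (CPC C s (P s))"
    unfolding form_summable_def CPC_form using series_boundD(1)[OF bd] by blast
  have F: "op_adj (form_sum (CPC C s (P s))) = form_sum (CPC C s (P s))"
      "(\<lambda>i. P s (C i s x) \<bullet> C i s x) sums (form_sum (CPC C s (P s)) x \<bullet> x)" for x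
    using form_sum_series[OF nn bd] unfolding CPC_def[abs_def] by blast+
  show "norm (form_sum (CPC C s (P s))) \<le> K * (T - s) powr (- 2 * \<alpha>)"
  proof (rule selfadj_norm_le[OF F(1)])
    fix x
    have "0 \<le> form_sum (CPC C s (P s)) x \<bullet> x"
      using suminf_nonneg[OF sums_summable[OF F(2)], of x] sums_unique[OF F(2), of x] nonneg_opsD(2)[OF nn] by simp
    moreover have "form_sum (CPC C s (P s)) x \<bullet> x \<le> K * (T - s) powr (- 2 * \<alpha>) * (norm x)\<^sup>2"
      using series_boundD(2)[OF bd, of x] sums_unique[OF F(2), of x] by simp
    ultimately show "\<bar>form_sum (CPC C s (P s)) x \<bullet> x\<bar> \<le> K * (T - s) powr (- 2 * \<alpha>) * (norm x)\<^sup>2" by simp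
  qed (use K in simp)
qed

text \<open>Strong continuity on a compact interval bounds the norms. The estimate speaks of
  \<open>form_sum\<close>, a definite description, so uniform boundedness first provides some
  \<open>k\<close> and identifies \<open>form_sum\<close> with the actual sum; only then can the
  estimate replace \<open>k\<close> by the singular bound.\<close>

lemma solution_imp_adm:
  assumes P: "P \<in> Cs_nonneg T" and est: "riccati_estimate T \<alpha> C P K"
  obtains \<beta> where "\<beta> \<ge> 0" "adm \<beta> K P"
proof -
  have cont: "\<And>x. continuous_on {0..T} (\<lambda>s. P s x)" and nn: "\<And>s. s \<in> {0..T} \<Longrightarrow> P s \<in> nonneg_ops"
    using P by (auto simp: Cs_nonneg_def)
  obtain \<beta> where \<beta>: "\<beta> \<ge> 1" "\<And>s. s \<in> {0..T} \<Longrightarrow> norm (P s) \<le> \<beta>"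
    using strongly_continuous_bounded[OF compact_Icc cont] by blast
  have "adm \<beta> K P"
    unfolding adm_def
  proof (intro conjI allI ballI cont nn \<beta>(2))
    fix s assume s: "s \<in> {0..<T}"
    then have s': "s \<in> {0..T}" by simp
    have fs: "summable (\<lambda>i. P s (C i s x) \<bullet> C i s x)" for x
      using est s unfolding riccati_estimate_def form_summable_def CPC_form by blast
    have fn: "norm (form_sum (CPC C s (P s))) \<le> K * (T - s) powr (- 2 * \<alpha>)"
      using est s unfolding riccati_estimate_def by blast
    obtain k where k: "series_bound (P s) (\<lambda>i. C i s) k"
      using form_summable_imp_series_bound[OF nn[OF s'], of "\<lambda>i. C i s"] fs by blast
    have F: "(\<lambda>i. P s (C i s x) \<bullet> C i s x) sums (form_sum (CPC C s (P s)) x \<bullet> x)" for x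
      using form_sum_series(2)[OF nn[OF s'] k] unfolding CPC_def[abs_def] by blast
    show "series_bound (P s) (\<lambda>i. C i s) (K * (T - s) powr (- 2 * \<alpha>))"
      unfolding series_bound_def
    proof (intro allI conjI fs)
      fix x
      have "(\<Sum>i. P s (C i s x) \<bullet> C i s x) = form_sum (CPC C s (P s)) x \<bullet> x"
        by (rule sums_unique[OF F, symmetric])
      also have "\<dots> \<le> norm (form_sum (CPC C s (P s))) * (norm x)\<^sup>2"
        using form_le_norm[of "form_sum (CPC C s (P s))" x] by linarith
      also have "\<dots> \<le> K * (T - s) powr (- 2 * \<alpha>) * (norm x)\<^sup>2" by (intro mult_right_mono fn) simp
      finally show "(\<Sum>i. P s (C i s x) \<bullet> C i s x) \<le> K * (T - s) powr (- 2 * \<alpha>) * (norm x)\<^sup>2" .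
    qed
  qed
  then show thesis by (rule that[rotated]) (use \<beta>(1) in simp)
qed

section \<open>The supersolution, the invariant set and the fixed point\<close>

context
  fixes \<nu> :: real
  assumes \<nu>: "\<nu> > 0"
    and ik: "\<And>s. s \<in> {0..<T} \<Longrightarrow> integrable (lebesgue_on {s..T}) (\<lambda>r. w \<nu> r * (r - s) powr (- 2 * \<alpha>))"
    and sm: "\<And>s. s \<in> {0..<T} \<Longrightarrow>
      integral\<^sup>L (lebesgue_on {s..T}) (\<lambda>r. w \<nu> r * (r - s) powr (- 2 * \<alpha>)) \<le> 1 / (2 * c) * w \<nu> s"
begin

text \<open>\<open>\<kappa>\<close> is chosen so that \<open>U\<close> is a supersolution of the linear Lyapunov equation without
  control, and hence an a priori upper bound.\<close>

definition \<kappa> :: real where "\<kappa> = 2 * (c * norm G + q * T powr (2 * \<alpha>))"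

definition U :: "real \<Rightarrow> 'h \<Rightarrow> real" where
  "U s y = norm G * (norm (S (T - s) y))\<^sup>2 + \<kappa> * W \<nu> s y"

definition \<beta>0 :: real where
  "\<beta>0 = NS\<^sup>2 * norm G + \<kappa> * (NS\<^sup>2 * integral\<^sup>L (lebesgue_on {0..T}) (w \<nu>))"

definition K0 :: real where "K0 = c * norm G + \<kappa> / 2 * exp (\<nu> * T)"

text \<open>The coefficient of \<open>bracket_shift_nonneg\<close> for operators of norm at most
  \<open>\<beta>0\<close>; neither \<open>U\<close> nor \<open>\<beta>0\<close> involves the
  shift.\<close>

definition \<mu>0 :: real where "\<mu>0 = b\<^sup>2 * \<beta>0 / \<delta>"

definition dominated :: "(real \<Rightarrow> 'h \<Rightarrow>\<^sub>L 'h) \<Rightarrow> bool" where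
  "dominated P \<longleftrightarrow> (\<forall>x. continuous_on {0..T} (\<lambda>s. P s x)) \<and>
    (\<forall>s\<in>{0..T}. P s \<in> nonneg_ops \<and> (\<forall>y. P s y \<bullet> y \<le> U s y))"

lemma dominatedD:
  assumes "dominated P"
  shows "continuous_on {0..T} (\<lambda>s. P s x)" "s \<in> {0..T} \<Longrightarrow> P s \<in> nonneg_ops"
    "s \<in> {0..T} \<Longrightarrow> P s y \<bullet> y \<le> U s y"
  using assms unfolding dominated_def by blast+

lemma nu0: "0 \<le> \<nu>" using \<nu> by simp

lemma kappa_nonneg: "0 \<le> \<kappa>"
  using c q0 by (simp add: \<kappa>_def)

lemma beta0_nonneg: "0 \<le> \<beta>0"
  using kappa_nonneg integral_w_nonneg by (simp add: \<beta>0_def)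

lemma K0_nonneg: "0 \<le> K0"
  using kappa_nonneg c by (simp add: K0_def)

lemma mu0_nonneg: "0 \<le> \<mu>0"
  using beta0_nonneg \<delta> by (simp add: \<mu>0_def)

lemma U_nonneg: "0 \<le> U s y"
  using kappa_nonneg W_nonneg by (simp add: U_def)

lemma U_le: 
  assumes s: "s \<in> {0..T}"
  shows "U s y \<le> \<beta>0 * (norm y)\<^sup>2"
proof -
  have "norm (S (T - s) y) \<le> NS * norm y" using s by (intro norm_S_apply_le) auto
  then have "(norm (S (T - s) y))\<^sup>2 \<le> NS\<^sup>2 * (norm y)\<^sup>2" by (simp add: power_mono flip: power_mult_distrib)
  then have 1: "norm G * (norm (S (T - s) y))\<^sup>2 \<le> norm G * (NS\<^sup>2 * (norm y)\<^sup>2)" by (intro mult_left_mono) auto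
  have 2: "\<kappa> * W \<nu> s y \<le> \<kappa> * (NS\<^sup>2 * integral\<^sup>L (lebesgue_on {0..T}) (w \<nu>) * (norm y)\<^sup>2)"
    by (intro mult_left_mono kappa_nonneg W_le_uniform nu0 s)
  show ?thesis using 1 2 by (simp add: U_def \<beta>0_def algebra_simps)
qed

text \<open>The terminal part uses the hypothesis on \<open>C\<close> at time \<open>T - s\<close>,
  the integral part the kernel estimate with \<epsilon> = 1/(2c). That choice returns half of
  \<open>\<kappa> * w\<close> and leaves the other half for the terminal and \<open>Q\<close>
  contributions.\<close>

lemma sum_U_C_le:
  assumes s: "s \<in> {0..<T}"
  shows "(\<Sum>i<n. U s (C i s x)) \<le> (c * norm G * (T - s) powr (- 2 * \<alpha>) + \<kappa> / 2 * w \<nu> s) * (norm x)\<^sup>2"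
proof -
  have s': "s \<in> {0..T}" using s by simp
  have "(\<Sum>i<n. U s (C i s x)) = norm G * (\<Sum>i<n. (norm (S (T - s) (C i s x)))\<^sup>2) + \<kappa> * (\<Sum>i<n. W \<nu> s (C i s x))"
    by (simp add: U_def sum.distrib sum_distrib_left)
  also have "\<dots> \<le> norm G * (c * (T - s) powr (- 2 * \<alpha>) * (norm x)\<^sup>2) + \<kappa> * (1 / 2 * w \<nu> s * (norm x)\<^sup>2)"
  proof (intro add_mono mult_left_mono kappa_nonneg norm_ge_zero)
    show "(\<Sum>i<n. (norm (S (T - s) (C i s x)))\<^sup>2) \<le> c * (T - s) powr (- 2 * \<alpha>) * (norm x)\<^sup>2"
      using s by (intro sum_norm_SC_le s') auto
    have "(\<Sum>i<n. W \<nu> s (C i s x)) \<le>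
        c * integral\<^sup>L (lebesgue_on {s..T}) (\<lambda>r. w \<nu> r * (r - s) powr (- 2 * \<alpha>)) * (norm x)\<^sup>2"
      by (rule sum_W_C_le[OF nu0 s ik[OF s]])
    also have "\<dots> \<le> c * (1 / (2 * c) * w \<nu> s) * (norm x)\<^sup>2"
      using c by (intro mult_right_mono mult_left_mono sm s) auto
    also have "c * (1 / (2 * c) * w \<nu> s) = 1 / 2 * w \<nu> s" using c by simp
    finally show "(\<Sum>i<n. W \<nu> s (C i s x)) \<le> 1 / 2 * w \<nu> s * (norm x)\<^sup>2" .
  qed
  finally show ?thesis by (simp add: algebra_simps)
qed

lemma dominated_series_bound:
  assumes P: "dominated P" and s: "s \<in> {0..<T}"
  shows "series_bound (P s) (\<lambda>i. C i s) (c * norm G * (T - s) powr (- 2 * \<alpha>) + \<kappa> / 2 * w \<nu> s)"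
proof (rule series_bound_partialI)
  have s': "s \<in> {0..T}" using s by simp
  show "P s \<in> nonneg_ops" by (rule dominatedD(2)[OF P s'])
  show "(\<Sum>i<n. P s (C i s x) \<bullet> C i s x) \<le> (c * norm G * (T - s) powr (- 2 * \<alpha>) + \<kappa> / 2 * w \<nu> s) * (norm x)\<^sup>2" for n x
    by (rule order_trans[OF sum_mono[OF dominatedD(3)[OF P s']] sum_U_C_le[OF s]])
qed

lemma dominated_adm:
  assumes P: "dominated P"
  shows "adm \<beta>0 K0 P"
  unfolding adm_def
proof (intro conjI allI ballI dominatedD(1,2)[OF P])
  show "norm (P s) \<le> \<beta>0" if s: "s \<in> {0..T}" for s
  proof (rule selfadj_norm_le[OF nonneg_opsD(1)[OF dominatedD(2)[OF P s]] _ beta0_nonneg])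
    show "\<bar>P s x \<bullet> x\<bar> \<le> \<beta>0 * (norm x)\<^sup>2" for x
      using nonneg_opsD(2)[OF dominatedD(2)[OF P s], of x] dominatedD(3)[OF P s, of x] U_le[OF s, of x] by linarith
  qed
  show "series_bound (P s) (\<lambda>i. C i s) (K0 * (T - s) powr (- 2 * \<alpha>))" if s: "s \<in> {0..<T}" for s
  proof (rule series_bound_mono[OF dominated_series_bound[OF P s]])
    have "\<kappa> / 2 * w \<nu> s \<le> \<kappa> / 2 * (exp (\<nu> * T) * (T - s) powr (- 2 * \<alpha>))"
      using s kappa_nonneg by (intro mult_left_mono w_le nu0) auto
    then show "c * norm G * (T - s) powr (- 2 * \<alpha>) + \<kappa> / 2 * w \<nu> s \<le> K0 * (T - s) powr (- 2 * \<alpha>)"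
      by (simp add: K0_def algebra_simps)
  qed
qed

text \<open>\<open>\<kappa> / 2\<close> equals
  \<open>c * norm G + q * T powr (2 * \<alpha>)\<close>, precisely what the half not returned by
  \<open>sum_U_C_le\<close> has to cover. So the bracket stays below \<open>\<kappa> * w\<close>,
  the integrand from which \<open>U\<close> is built.\<close>

lemma dominated_bracket_upper:
  assumes P: "dominated P" and good: "good s"
  shows "bracket s (P s) x \<bullet> x \<le> \<kappa> * w \<nu> s * (norm x)\<^sup>2"
proof -
  note s = goodD(2)[OF good] and s' = goodD(1)[OF good]
  define p where "p = (T - s) powr (- 2 * \<alpha>)"
  have pw: "p \<le> w \<nu> s" unfolding p_def by (rule w_ge[OF nu0 s'])
  have "bracket s (P s) x \<bullet> x \<le> (c * norm G * p + \<kappa> / 2 * w \<nu> s + q) * (norm x)\<^sup>2"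
    unfolding p_def
    by (rule bracket_upper[OF good dominatedD(2)[OF P s'] order_refl dominated_series_bound[OF P s]])
  also have "\<dots> \<le> (\<kappa> * w \<nu> s) * (norm x)\<^sup>2"
  proof (rule mult_right_mono)
    have "q * 1 \<le> q * (T powr (2 * \<alpha>) * p)" unfolding p_def by (intro mult_left_mono one_le_powr s q0)
    also have "\<dots> \<le> q * (T powr (2 * \<alpha>) * w \<nu> s)" by (intro mult_left_mono pw q0) auto
    finally have "q \<le> q * T powr (2 * \<alpha>) * w \<nu> s" by simp
    moreover have "c * norm G * p \<le> c * norm G * w \<nu> s" using c by (intro mult_left_mono pw) auto
    moreover have "\<kappa> * w \<nu> s = \<kappa> / 2 * w \<nu> s + c * norm G * w \<nu> s + q * T powr (2 * \<alpha>) * w \<nu> s"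
      by (simp add: \<kappa>_def algebra_simps)
    ultimately show "c * norm G * p + \<kappa> / 2 * w \<nu> s + q \<le> \<kappa> * w \<nu> s" by linarith
  qed simp
  finally show ?thesis .
qed

text \<open>\<open>U\<close> is the form of the unshifted mild integral with integrand
  \<open>\<kappa> * w\<close> times the identity. Variation of constants transports this identity to
  an arbitrary shift, where it can be compared with \<open>Gam\<close> integrand by
  integrand.\<close>

lemma U_shift:
  fixes t \<mu> :: real and y :: 'h
  assumes t: "t \<in> {0..T}"
  defines "F \<equiv> \<lambda>s. exp (- \<mu> * (s - t)) * (\<kappa> * w \<nu> s * (norm (S (s - t) y))\<^sup>2 + \<mu> * U s (S (s - t) y))"
  shows "integrable (lebesgue_on {t..T}) F"
    and "U t y = exp (- \<mu> * (T - t)) * (norm G * (norm (S (T - t) y))\<^sup>2) + integral\<^sup>L (lebesgue_on {t..T}) F"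
proof -
  define gT where "gT = norm G * (norm (S (T - t) y))\<^sup>2"
  \<comment> \<open>The factor \<open>exp (\<mu> * (T - s))\<close> brings the undamped identity for
    \<open>U\<close> into the form required by \<open>backward_volterra_shift\<close> with shift
    \<open>- \<mu>\<close>; it is divided out at the end.\<close>
  define g where "g s = exp (\<mu> * (T - s)) * U s (S (s - t) y)" for s
  define h where "h r = exp (\<mu> * (T - r)) * (\<kappa> * (w \<nu> r * (norm (S (r - t) y))\<^sup>2))" for r
  have Wi: "integrable (lebesgue_on {t..T}) (\<lambda>r. w \<nu> r * (norm (S (r - t) y))\<^sup>2)"
    by (rule W_integrable[OF nu0 t])
  have hi: "integrable (lebesgue_on {t..T}) h"
  proof (rule Bochner_Integration.integrable_bound)
    show "integrable (lebesgue_on {t..T}) (\<lambda>r. exp (\<bar>\<mu>\<bar> * T) * (\<kappa> * (w \<nu> r * (norm (S (r - t) y))\<^sup>2)))"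
      by (intro integrable_mult_right Wi)
    have "(\<lambda>r. exp (\<mu> * (T - r))) \<in> borel_measurable (lebesgue_on {t..T})"
      by (intro continuous_imp_measurable_on_sets_lebesgue continuous_intros) simp
    then show "h \<in> borel_measurable (lebesgue_on {t..T})"
      unfolding h_def[abs_def]
      by (intro borel_measurable_times borel_measurable_const borel_measurable_integrable[OF Wi])
    show "AE r in lebesgue_on {t..T}. norm (h r) \<le> norm (exp (\<bar>\<mu>\<bar> * T) * (\<kappa> * (w \<nu> r * (norm (S (r - t) y))\<^sup>2)))"
    proof (rule AE_lebesgue_on_I)
      fix r assume r: "r \<in> {t..T}"
      have "\<mu> * (T - r) \<le> \<bar>\<mu>\<bar> * (T - r)" using r by (intro mult_right_mono) auto
      also have "\<dots> \<le> \<bar>\<mu>\<bar> * T" using r t by (intro mult_left_mono) auto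
      finally have "exp (\<mu> * (T - r)) \<le> exp (\<bar>\<mu>\<bar> * T)" by simp
      then show "norm (h r) \<le> norm (exp (\<bar>\<mu>\<bar> * T) * (\<kappa> * (w \<nu> r * (norm (S (r - t) y))\<^sup>2)))"
        unfolding h_def norm_mult by (intro mult_right_mono) auto
    qed
  qed
  have eq: "g s = exp (- (- \<mu>) * (T - s)) * gT +
      integral\<^sup>L (lebesgue_on {s..T}) (\<lambda>r. exp (- (- \<mu>) * (r - s)) * h r)" if s: "s \<in> {t..T}" for s
  proof -
    have "integral\<^sup>L (lebesgue_on {s..T}) (\<lambda>r. exp (- (- \<mu>) * (r - s)) * h r) =
        integral\<^sup>L (lebesgue_on {s..T}) (\<lambda>r. exp (\<mu> * (T - s)) * \<kappa> * (w \<nu> r * (norm (S (r - s) (S (s - t) y)))\<^sup>2))"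
    proof (intro Bochner_Integration.integral_cong refl)
      fix r assume "r \<in> space (lebesgue_on {s..T})"
      then have r: "S (r - s) (S (s - t) y) = S (r - t) y" using s by (intro S_compose) auto
      have "exp (- (- \<mu>) * (r - s)) * exp (\<mu> * (T - r)) = exp (\<mu> * (T - s))"
        by (simp add: exp_add[symmetric] algebra_simps)
      then show "exp (- (- \<mu>) * (r - s)) * h r =
          exp (\<mu> * (T - s)) * \<kappa> * (w \<nu> r * (norm (S (r - s) (S (s - t) y)))\<^sup>2)"
        unfolding h_def r mult.assoc[symmetric] by simp
    qed
    also have "\<dots> = exp (\<mu> * (T - s)) * \<kappa> * W \<nu> s (S (s - t) y)"
      unfolding W_def by (rule integral_mult_right_zero)
    finally show ?thesis
      using s by (simp add: g_def U_def gT_def S_compose distrib_left mult.assoc)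
  qed
  have tT: "t \<le> T" using t by simp
  note shift = backward_volterra_shift[OF tT hi eq]
  have hg: "exp (- \<mu> * (T - t)) * (h r - - \<mu> * g r) = F r" for r
  proof -
    have "exp (- \<mu> * (T - t)) * exp (\<mu> * (T - r)) = exp (- \<mu> * (r - t))"
      by (simp add: exp_add[symmetric] algebra_simps)
    moreover have "exp (- \<mu> * (T - t)) * (h r - - \<mu> * g r) = exp (- \<mu> * (T - t)) * exp (\<mu> * (T - r)) *
        (\<kappa> * w \<nu> r * (norm (S (r - t) y))\<^sup>2 + \<mu> * U r (S (r - t) y))"
      by (simp add: h_def g_def algebra_simps)
    ultimately show ?thesis by (simp add: F_def)
  qed
  show "integrable (lebesgue_on {t..T}) F"
    using integrable_mult_right[OF shift(1), of "exp (- \<mu> * (T - t))"] unfolding hg .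
  have "exp (- \<mu> * (T - t)) * g t = exp (- \<mu> * (T - t)) * gT +
      exp (- \<mu> * (T - t)) * integral\<^sup>L (lebesgue_on {t..T}) (\<lambda>r. h r - - \<mu> * g r)"
    using shift(2) by (simp add: distrib_left)
  also have "exp (- \<mu> * (T - t)) * integral\<^sup>L (lebesgue_on {t..T}) (\<lambda>r. h r - - \<mu> * g r) =
      integral\<^sup>L (lebesgue_on {t..T}) F"
    unfolding hg[symmetric] by (rule integral_mult_right_zero[symmetric])
  also have "exp (- \<mu> * (T - t)) * g t = U t y"
    unfolding g_def mult.assoc[symmetric] exp_add[symmetric] by (simp add: S_0)
  finally show "U t y = exp (- \<mu> * (T - t)) * (norm G * (norm (S (T - t) y))\<^sup>2) + integral\<^sup>L (lebesgue_on {t..T}) F"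
    by (simp only: gT_def)
qed

text \<open>From below, the added multiple of \<open>P\<close> compensates the drift. From above,
  the integrand is compared with the one in \<open>U_shift\<close>: the bracket lies below
  \<open>\<kappa> * w\<close> and \<open>P\<close> below \<open>U\<close>.\<close>

lemma Gam_dominated:
  assumes P: "dominated P"
  shows "dominated (Gam \<mu>0 P)"
proof -
  note adm = dominated_adm[OF P]
  note \<mu>0 = mu0_nonneg and K0 = K0_nonneg
  have form: "0 \<le> Gam \<mu>0 P t y \<bullet> y \<and> Gam \<mu>0 P t y \<bullet> y \<le> U t y" if t: "t \<in> {0..T}" for t y
  proof -
    let ?f = "\<lambda>s. exp (- \<mu>0 * (s - t)) * (ker \<mu>0 P s (S (s - t) y) \<bullet> S (s - t) y)"
    note gf = Gam_form[OF adm K0 \<mu>0 t, of y y]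
    define z where "z = S (T - t) y"
    have G0: "0 \<le> G z \<bullet> z" by (rule nonneg_opsD(2)[OF G])
    have G1: "G z \<bullet> z \<le> norm G * (norm z)\<^sup>2" using form_le_norm[of G z] by linarith
    have lo: "0 \<le> integral\<^sup>L (lebesgue_on {t..T}) ?f"
    proof (rule integral_nonneg_AE)
      show "AE s in lebesgue_on {t..T}. 0 \<le> ?f s"
        using AE_good_sub[OF t]
      proof eventually_elim
        fix s assume good: "good s"
        have "0 \<le> ker \<mu>0 P s x \<bullet> x" for x
          using bracket_shift_nonneg[OF good adm_good[OF adm good], of x]
          by (simp add: ker_def \<mu>0_def blinfun.bilinear_simps inner_simps)
        then show "0 \<le> ?f s" by simp
      qed
    qed
    have hi: "integral\<^sup>L (lebesgue_on {t..T}) ?f \<le> integral\<^sup>L (lebesgue_on {t..T})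
      (\<lambda>s. exp (- \<mu>0 * (s - t)) * (\<kappa> * w \<nu> s * (norm (S (s - t) y))\<^sup>2 + \<mu>0 * U s (S (s - t) y)))"
    proof (rule integral_mono_AE[OF gf(1) U_shift(1)[OF t]])
      show "AE s in lebesgue_on {t..T}. ?f s \<le>
          exp (- \<mu>0 * (s - t)) * (\<kappa> * w \<nu> s * (norm (S (s - t) y))\<^sup>2 + \<mu>0 * U s (S (s - t) y))"
        using AE_good_sub[OF t]
      proof eventually_elim
        fix s assume good: "good s"
        have "ker \<mu>0 P s x \<bullet> x \<le> \<kappa> * w \<nu> s * (norm x)\<^sup>2 + \<mu>0 * U s x" for x
        proof -
          have "\<mu>0 * (P s x \<bullet> x) \<le> \<mu>0 * U s x"
            by (intro mult_left_mono dominatedD(3)[OF P] goodD(1)[OF good] \<mu>0)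
          then show ?thesis
            using dominated_bracket_upper[OF P good, of x] by (simp add: ker_def blinfun.bilinear_simps inner_simps)
        qed
        then show "?f s \<le> exp (- \<mu>0 * (s - t)) * (\<kappa> * w \<nu> s * (norm (S (s - t) y))\<^sup>2 + \<mu>0 * U s (S (s - t) y))"
          by (intro mult_left_mono) auto
      qed
    qed
    have e0: "0 \<le> exp (- \<mu>0 * (T - t))" by simp
    show ?thesis
      unfolding gf(2) U_shift(2)[OF t, of y \<mu>0] z_def[symmetric]
      using mult_nonneg_nonneg[OF e0 G0] mult_left_mono[OF G1 e0] lo hi by linarith
  qed
  show ?thesis
    unfolding dominated_def
  proof (intro conjI allI ballI)
    show "continuous_on {0..T} (\<lambda>s. Gam \<mu>0 P s x)" for x by (rule Gam_continuous[OF adm K0 \<mu>0])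
    show "Gam \<mu>0 P s \<in> nonneg_ops" if s: "s \<in> {0..T}" for s
      unfolding nonneg_ops_def using Gam_selfadj[OF adm K0 \<mu>0 s] form[OF s] by simp
    show "Gam \<mu>0 P s y \<bullet> y \<le> U s y" if s: "s \<in> {0..T}" for s y using form[OF s] by blast
  qed
qed

lemma dominated_0: "dominated (\<lambda>_. 0)"
  unfolding dominated_def
proof (intro conjI allI ballI)
  have "op_adj (0 :: 'h \<Rightarrow>\<^sub>L 'h) = 0" by (rule op_adj_eqI) simp
  then show "(0 :: 'h \<Rightarrow>\<^sub>L 'h) \<in> nonneg_ops" by (simp add: nonneg_ops_def)
  show "blinfun_apply 0 y \<bullet> y \<le> U s y" for y s using U_nonneg[of s y] by simp
qed simp

text \<open>Picard iteration. As \<open>W\<close> is bounded by a multiple of the squared norm,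
  closeness gives convergence in operator norm, uniformly in s. Domination is a condition on forms
  and passes to the limit; the bound on the infinite sums over \<open>C i s\<close> is then deduced
  from domination, so limit and sum are never exchanged.\<close>

lemma exists_dominated_fixpoint:
  obtains P where "dominated P" "P \<in> extensional {0..T}" "\<And>s. s \<in> {0..T} \<Longrightarrow> Gam \<mu>0 P s = P s"
proof -
  obtain \<nu>' where \<nu>': "\<nu>' > 0" and contr: "\<And>P P' a. adm \<beta>0 K0 P \<Longrightarrow> adm \<beta>0 K0 P' \<Longrightarrow> 0 \<le> a \<Longrightarrow> near \<nu>' a P P' \<Longrightarrow>
      near \<nu>' (a / 2) (Gam \<mu>0 P) (Gam \<mu>0 P')"
    using Gam_contraction[OF K0_nonneg mu0_nonneg] by metis
  have \<nu>'0: "0 \<le> \<nu>'" using \<nu>' by simp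
  \<comment> \<open>The sequence starts with the first image of 0, not with 0 itself: at T the
    latter differs from \<open>G\<close> in general, and \<open>W\<close> vanishes there.\<close>
  define X where "X n = (Gam \<mu>0 ^^ Suc n) (\<lambda>_. 0)" for n
  have XS: "X (Suc n) = Gam \<mu>0 (X n)" for n by (simp add: X_def)
  have Xdom: "dominated (X n)" for n
  proof (induction n)
    case 0
    then show ?case using Gam_dominated[OF dominated_0] by (simp add: X_def)
  next
    case (Suc n)
    then show ?case unfolding XS by (rule Gam_dominated)
  qed
  note Xadm = dominated_adm[OF Xdom]
  define a where "a = 2 * kbound \<beta>0 K0 \<mu>0"
  have a0: "0 \<le> a" using kbound_nonneg[OF beta0_nonneg K0_nonneg mu0_nonneg] by (simp add: a_def)
  have step: "near \<nu>' (a / 2 ^ n) (X n) (X (Suc n))" for n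
  proof (induction n)
    case 0
    have "near \<nu>' a (Gam \<mu>0 (\<lambda>_. 0)) (Gam \<mu>0 (X 0))"
      unfolding a_def
      by (rule Gam_near_initial[OF dominated_adm[OF dominated_0] Xadm beta0_nonneg K0_nonneg mu0_nonneg \<nu>'0])
    then show ?case by (simp add: X_def)
  next
    case (Suc n)
    have "near \<nu>' (a / 2 ^ n / 2) (Gam \<mu>0 (X n)) (Gam \<mu>0 (X (Suc n)))"
      using a0 by (intro contr Xadm Suc) simp
    then show ?case by (simp add: XS mult.commute)
  qed
  have tail: "\<bar>X n s y \<bullet> y - X (n + m) s y \<bullet> y\<bar> \<le> 2 * a / 2 ^ n * W \<nu>' s y" if s: "s \<in> {0..T}" for n m s y
  proof -
    \<comment> \<open>The exact remainder of the geometric series is kept so that the induction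
      closes.\<close>
    have "\<bar>X n s y \<bullet> y - X (n + m) s y \<bullet> y\<bar> \<le> (2 * a / 2 ^ n - 2 * a / 2 ^ (n + m)) * W \<nu>' s y"
    proof (induction m)
      case (Suc m)
      have "\<bar>X (n + m) s y \<bullet> y - X (Suc (n + m)) s y \<bullet> y\<bar> \<le> a / 2 ^ (n + m) * W \<nu>' s y"
        using step[of "n + m"] s by (simp add: near_def)
      then have "\<bar>X n s y \<bullet> y - X (n + Suc m) s y \<bullet> y\<bar> \<le>
          (2 * a / 2 ^ n - 2 * a / 2 ^ (n + m)) * W \<nu>' s y + a / 2 ^ (n + m) * W \<nu>' s y"
        using Suc by simp
      also have "\<dots> = (2 * a / 2 ^ n - 2 * a / 2 ^ (n + m) + a / 2 ^ (n + m)) * W \<nu>' s y"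
        by (rule distrib_right[symmetric])
      also have "2 * a / 2 ^ n - 2 * a / 2 ^ (n + m) + a / 2 ^ (n + m) = 2 * a / 2 ^ n - 2 * a / 2 ^ (n + Suc m)"
        by (simp add: field_simps)
      finally show ?case .
    qed simp
    also have "\<dots> \<le> 2 * a / 2 ^ n * W \<nu>' s y"
      using a0 W_nonneg by (intro mult_right_mono) auto
    finally show ?thesis .
  qed
  define \<omega> where "\<omega> = NS\<^sup>2 * integral\<^sup>L (lebesgue_on {0..T}) (w \<nu>')"
  have \<omega>0: "0 \<le> \<omega>" using integral_w_nonneg by (simp add: \<omega>_def)
  have W\<omega>: "W \<nu>' s y \<le> \<omega> * (norm y)\<^sup>2" if "s \<in> {0..T}" for s y
    unfolding \<omega>_def by (rule W_le_uniform[OF \<nu>'0 that])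
  have Xsa: "op_adj (X n s) = X n s" if "s \<in> {0..T}" for n s
    by (rule nonneg_opsD(1)[OF dominatedD(2)[OF Xdom that]])
  have dist: "norm (X n s - X (n + m) s) \<le> 2 * a * \<omega> / 2 ^ n" if s: "s \<in> {0..T}" for n m s
  proof (rule selfadj_norm_le)
    show "op_adj (X n s - X (n + m) s) = X n s - X (n + m) s" by (simp add: op_adj_diff Xsa[OF s])
    show "0 \<le> 2 * a * \<omega> / 2 ^ n" using a0 \<omega>0 by simp
    fix y
    have "\<bar>(X n s - X (n + m) s) y \<bullet> y\<bar> \<le> 2 * a / 2 ^ n * W \<nu>' s y"
      using tail[OF s] by (simp add: blinfun.bilinear_simps inner_simps)
    also have "\<dots> \<le> 2 * a / 2 ^ n * (\<omega> * (norm y)\<^sup>2)" using a0 by (intro mult_left_mono W\<omega>[OF s]) auto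
    finally show "\<bar>(X n s - X (n + m) s) y \<bullet> y\<bar> \<le> 2 * a * \<omega> / 2 ^ n * (norm y)\<^sup>2" by simp
  qed
  have lim0: "(\<lambda>n. x / 2 ^ n) \<longlonglongrightarrow> 0" for x :: real
  proof -
    have "(\<lambda>n. x * (1 / 2) ^ n) \<longlonglongrightarrow> x * 0"
      by (intro tendsto_mult tendsto_const LIMSEQ_power_zero) simp
    then show ?thesis by (simp add: power_divide)
  qed
  \<comment> \<open>Restriction to \<open>{0..T}\<close> makes the limit extensional, as
    \<open>Cs_nonneg\<close> requires.\<close>
  define P where "P = (\<lambda>s\<in>{0..T}. lim (\<lambda>n. X n s))"
  have XP: "(\<lambda>n. X n s) \<longlonglongrightarrow> P s" if s: "s \<in> {0..T}" for s
  proof -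
    have "Cauchy (\<lambda>n. X n s)"
    proof (rule metric_CauchyI)
      fix e :: real assume e: "e > 0"
      have "\<forall>\<^sub>F n in sequentially. 2 * a * \<omega> / 2 ^ n < e / 2"
        by (rule order_tendstoD(2)[OF lim0]) (use e in simp)
      then obtain N where N: "2 * a * \<omega> / 2 ^ N < e / 2"
        unfolding eventually_sequentially by blast
      show "\<exists>M. \<forall>m\<ge>M. \<forall>n\<ge>M. dist (X m s) (X n s) < e"
      proof (intro exI allI impI)
        fix m n assume "N \<le> m" "N \<le> n"
        then have "norm (X N s - X m s) < e / 2" "norm (X N s - X n s) < e / 2"
          using order_le_less_trans[OF dist[OF s, of N "m - N"] N] order_le_less_trans[OF dist[OF s, of N "n - N"] N]
          by auto
        moreover have "dist (X m s) (X n s) \<le> dist (X N s) (X m s) + dist (X N s) (X n s)"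
          by (rule dist_triangle3)
        ultimately show "dist (X m s) (X n s) < e" unfolding dist_norm by linarith
      qed
    qed
    then have "convergent (\<lambda>n. X n s)" by (rule Cauchy_convergent)
    then show ?thesis using s by (simp add: P_def convergent_LIMSEQ_iff)
  qed
  have XPy: "(\<lambda>n. X n s y) \<longlonglongrightarrow> P s y" if "s \<in> {0..T}" for s y
    by (intro blinfun.tendsto XP[OF that] tendsto_const)
  have Pform: "(\<lambda>n. X n s y \<bullet> z) \<longlonglongrightarrow> P s y \<bullet> z" if "s \<in> {0..T}" for s y z
    by (intro tendsto_inner XPy[OF that] tendsto_const)
  have Pdist: "norm (X n s - P s) \<le> 2 * a * \<omega> / 2 ^ n" if s: "s \<in> {0..T}" for n s
  proof (rule LIMSEQ_le_const2)
    show "(\<lambda>m. norm (X n s - X (n + m) s)) \<longlonglongrightarrow> norm (X n s - P s)"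
      using LIMSEQ_ignore_initial_segment[OF XP[OF s], of n] by (intro tendsto_intros) (simp add: add.commute)
  qed (use dist[OF s] in blast)
  have Pnear: "near \<nu>' (2 * a / 2 ^ n) (X n) P" for n
    unfolding near_def
  proof (intro ballI allI)
    fix s y assume s: "s \<in> {0..T}"
    show "\<bar>X n s y \<bullet> y - P s y \<bullet> y\<bar> \<le> 2 * a / 2 ^ n * W \<nu>' s y"
    proof (rule LIMSEQ_le_const2)
      have "(\<lambda>m. X (n + m) s y \<bullet> y) \<longlonglongrightarrow> P s y \<bullet> y"
        using LIMSEQ_ignore_initial_segment[OF Pform[OF s, of y y], of n] by (simp add: add.commute)
      then show "(\<lambda>m. \<bar>X n s y \<bullet> y - X (n + m) s y \<bullet> y\<bar>) \<longlonglongrightarrow> \<bar>X n s y \<bullet> y - P s y \<bullet> y\<bar>"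
        by (intro tendsto_rabs tendsto_diff tendsto_const)
    qed (use tail[OF s] in blast)
  qed
  have Pdom: "dominated P"
    unfolding dominated_def
  proof (intro conjI allI ballI)
    fix x
    show "continuous_on {0..T} (\<lambda>s. P s x)"
    proof (rule uniform_limit_theorem)
      show "\<forall>\<^sub>F n in sequentially. continuous_on {0..T} (\<lambda>s. X n s x)"
        by (intro always_eventually allI dominatedD(1)[OF Xdom])
      show "uniform_limit {0..T} (\<lambda>n s. X n s x) (\<lambda>s. P s x) sequentially"
      proof (rule uniform_limitI)
        fix e :: real assume "e > 0"
        have "\<forall>\<^sub>F n in sequentially. (2 * a * \<omega> * norm x) / 2 ^ n < e"
          by (rule order_tendstoD(2)[OF lim0 \<open>e > 0\<close>])
        then show "\<forall>\<^sub>F n in sequentially. \<forall>s\<in>{0..T}. dist (X n s x) (P s x) < e"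
        proof eventually_elim
          case (elim n)
          show ?case
          proof
            fix s assume s: "s \<in> {0..T}"
            have "norm ((X n s - P s) x) \<le> 2 * a * \<omega> / 2 ^ n * norm x"
              by (rule order_trans[OF norm_blinfun mult_right_mono[OF Pdist[OF s] norm_ge_zero]])
            then show "dist (X n s x) (P s x) < e" using elim by (simp add: dist_norm blinfun.diff_left)
          qed
        qed
      qed
    qed simp
  next
    fix s assume s: "s \<in> {0..T}"
    have "P s x \<bullet> y = x \<bullet> P s y" for x y
    proof (rule LIMSEQ_unique[OF Pform[OF s]])
      have "(\<lambda>n. x \<bullet> X n s y) \<longlonglongrightarrow> x \<bullet> P s y" by (intro tendsto_inner XPy[OF s] tendsto_const)
      then show "(\<lambda>n. X n s x \<bullet> y) \<longlonglongrightarrow> x \<bullet> P s y" using selfadj_inner[OF Xsa[OF s]] by simp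
    qed
    then have "op_adj (P s) = P s" by (rule op_adj_eqI)
    moreover have "0 \<le> P s x \<bullet> x" for x
      by (rule LIMSEQ_le_const[OF Pform[OF s]]) (use nonneg_opsD(2)[OF dominatedD(2)[OF Xdom s]] in blast)
    ultimately show "P s \<in> nonneg_ops" by (simp add: nonneg_ops_def)
    show "P s y \<bullet> y \<le> U s y" for y
      by (rule LIMSEQ_le_const2[OF Pform[OF s]]) (use dominatedD(3)[OF Xdom s] in blast)
  qed
  note Padm = dominated_adm[OF Pdom]
  \<comment> \<open>Both \<open>Gam \<mu>0 P\<close> and \<open>P\<close> are within
    \<open>a / 2 ^ n\<close> of \<open>X (Suc n)\<close>: the former by contraction, the latter by
    the tail bound.\<close>
  have nn: "near \<nu>' (2 * a / 2 ^ n) (Gam \<mu>0 P) P" for n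
    unfolding near_def
  proof (intro ballI allI)
    fix s y assume s: "s \<in> {0..T}"
    have "near \<nu>' (2 * a / 2 ^ n / 2) (Gam \<mu>0 (X n)) (Gam \<mu>0 P)"
      using a0 by (intro contr Xadm Padm Pnear) simp
    then have 1: "\<bar>X (Suc n) s y \<bullet> y - Gam \<mu>0 P s y \<bullet> y\<bar> \<le> 2 * a / 2 ^ n / 2 * W \<nu>' s y"
      using s unfolding near_def XS by blast
    have 2: "\<bar>X (Suc n) s y \<bullet> y - P s y \<bullet> y\<bar> \<le> 2 * a / 2 ^ Suc n * W \<nu>' s y"
      using Pnear[of "Suc n"] s unfolding near_def by blast
    define d where "d = a / 2 ^ n * W \<nu>' s y"
    have d: "2 * a / 2 ^ n / 2 * W \<nu>' s y = d" "2 * a / 2 ^ Suc n * W \<nu>' s y = d"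
        "2 * a / 2 ^ n * W \<nu>' s y = 2 * d"
      by (simp_all add: d_def)
    show "\<bar>Gam \<mu>0 P s y \<bullet> y - P s y \<bullet> y\<bar> \<le> 2 * a / 2 ^ n * W \<nu>' s y"
      using 1 2 unfolding d by linarith
  qed
  show thesis
  proof (rule that[OF Pdom])
    show "P \<in> extensional {0..T}" by (simp add: P_def)
    fix s assume s: "s \<in> {0..T}"
    show "Gam \<mu>0 P s = P s"
      by (rule near_all_imp_eq[OF nn s Gam_selfadj[OF Padm K0_nonneg mu0_nonneg s]
            nonneg_opsD(1)[OF dominatedD(2)[OF Pdom s]]])
  qed
qed

end

section \<open>Existence and uniqueness combined\<close>

lemma exists_unique_solution:
  "\<exists>!P. P \<in> Cs_nonneg T \<and> riccati_solution T S B C D Q R G P \<and> (\<exists>K>0. riccati_estimate T \<alpha> C P K)"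
proof (rule ex_ex1I)
  have "1 / (2 * c) > 0" using c by simp
  then obtain \<nu> where \<nu>: "\<nu> > 0"
    and ik: "\<And>s. s \<in> {0..<T} \<Longrightarrow> integrable (lebesgue_on {s..T}) (\<lambda>r. w \<nu> r * (r - s) powr (- 2 * \<alpha>))"
    and sm: "\<And>s. s \<in> {0..<T} \<Longrightarrow>
      integral\<^sup>L (lebesgue_on {s..T}) (\<lambda>r. w \<nu> r * (r - s) powr (- 2 * \<alpha>)) \<le> 1 / (2 * c) * w \<nu> s"
    using w_kernel_small by blast
  obtain P where P: "dominated \<nu> P" "P \<in> extensional {0..T}" "\<And>s. s \<in> {0..T} \<Longrightarrow> Gam (\<mu>0 \<nu>) P s = P s"
    using exists_dominated_fixpoint[OF \<nu> ik sm] by blast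
  have adm: "adm (\<beta>0 \<nu>) (K0 \<nu>) P" by (rule dominated_adm[OF \<nu> ik sm P(1)])
  have K0: "0 \<le> K0 \<nu>" by (rule K0_nonneg[OF \<nu> ik sm])
  have \<mu>0: "0 \<le> \<mu>0 \<nu>" by (rule mu0_nonneg[OF \<nu> ik sm])
  have "riccati_solution T S B C D Q R G P"
    unfolding riccati_solution_iff[OF adm K0]
    by (intro ballI fixpoint_shift[OF adm K0 \<mu>0 P(3)])
  moreover have "P \<in> Cs_nonneg T"
    using P(2) admD(1,2)[OF adm] by (auto simp: Cs_nonneg_def PiE_def)
  \<comment> \<open>A strictly positive constant is asked for, while \<open>K0\<close> vanishes if
    \<open>G\<close> and \<open>q\<close> do.\<close>
  moreover have "adm (\<beta>0 \<nu>) (K0 \<nu> + 1) P" by (rule adm_mono[OF adm]) simp_all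
  then have "riccati_estimate T \<alpha> C P (K0 \<nu> + 1)" using K0 by (intro adm_imp_estimate) auto
  moreover have "K0 \<nu> + 1 > 0" using K0 by simp
  ultimately show "\<exists>P. P \<in> Cs_nonneg T \<and> riccati_solution T S B C D Q R G P \<and> (\<exists>K>0. riccati_estimate T \<alpha> C P K)"
    by blast
next
  fix P P'
  assume P: "P \<in> Cs_nonneg T \<and> riccati_solution T S B C D Q R G P \<and> (\<exists>K>0. riccati_estimate T \<alpha> C P K)"
    and P': "P' \<in> Cs_nonneg T \<and> riccati_solution T S B C D Q R G P' \<and> (\<exists>K>0. riccati_estimate T \<alpha> C P' K)"
  obtain K K' where K: "K > 0" "riccati_estimate T \<alpha> C P K" and K': "K' > 0" "riccati_estimate T \<alpha> C P' K'"
    using P P' by blast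
  obtain \<beta> \<beta>' where \<beta>: "\<beta> \<ge> 0" "adm \<beta> K P" and \<beta>': "\<beta>' \<ge> 0" "adm \<beta>' K' P'"
    using solution_imp_adm P P' K(2) K'(2) by metis
  \<comment> \<open>Each solution comes with its own constants; the contraction needs common
    ones.\<close>
  have adm: "adm (max \<beta> \<beta>') (max K K') P" "adm (max \<beta> \<beta>') (max K K') P'"
    by (rule adm_mono[OF \<beta>(2)], simp_all, rule adm_mono[OF \<beta>'(2)], simp_all)
  have K0: "0 \<le> max K K'" and \<beta>0: "0 \<le> max \<beta> \<beta>'" using K \<beta> by auto
  have "P s = P' s" if s: "s \<in> {0..T}" for s
  proof (rule fixpoint_unique[OF adm(1) _ adm(2) _ \<beta>0 K0 s])
    show "Gam 0 P s = P s" if "s \<in> {0..T}" for s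
      using P riccati_solution_iff[OF adm(1) K0] that by blast
    show "Gam 0 P' s = P' s" if "s \<in> {0..T}" for s
      using P' riccati_solution_iff[OF adm(2) K0] that by blast
  qed
  moreover have "P \<in> extensional {0..T}" "P' \<in> extensional {0..T}"
    using P P' by (auto simp: Cs_nonneg_def PiE_def)
  ultimately show "P = P'" by (metis extensionalityI)
qed

end

theorem theorem4p4:
  fixes A :: "('h::{real_inner, banach, second_countable_topology} \<times> 'h) set"
    and S :: "real \<Rightarrow> 'h \<Rightarrow>\<^sub>L 'h"
    and B :: "real \<Rightarrow> 'u::{real_inner, banach, second_countable_topology} \<Rightarrow>\<^sub>L 'h"
    and C :: "nat \<Rightarrow> real \<Rightarrow> 'h \<Rightarrow>\<^sub>L 'h"
    and D :: "nat \<Rightarrow> real \<Rightarrow> 'u \<Rightarrow>\<^sub>L 'h"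
    and Q :: "real \<Rightarrow> 'h \<Rightarrow>\<^sub>L 'h"
    and R :: "real \<Rightarrow> 'u \<Rightarrow>\<^sub>L 'u"
    and G :: "'h \<Rightarrow>\<^sub>L 'h"
    and T \<alpha> c \<delta> :: real
  assumes T: "T > 0"
    and A: "generates A S"
    and B: "B \<in> Linf_ops T UNIV"
    and C: "\<And>j. C j \<in> Linf_ops T UNIV"
    and D: "\<And>j. D j \<in> Linf_ops T UNIV"
    and Q: "Q \<in> Linf_ops T nonneg_ops"
    and G: "G \<in> nonneg_ops"
    and R: "R \<in> Linf_ops T nonneg_ops"
    and \<delta>: "\<delta> > 0"
    and R_ge: "AE s in lebesgue_on {0..T}. R s - \<delta> *\<^sub>R id_blinfun \<in> nonneg_ops"
    and \<alpha>: "0 < \<alpha>" "\<alpha> < 1 / 2"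
    and c: "c > 0"
    and SC: "\<And>t s x. t > 0 \<Longrightarrow> s \<in> {0..T} \<Longrightarrow>
        summable (\<lambda>j. (norm (blinfun_apply (S t) (blinfun_apply (C j s) x)))\<^sup>2) \<and>
        (\<Sum>j. (norm (blinfun_apply (S t) (blinfun_apply (C j s) x)))\<^sup>2)
          \<le> c * t powr (- 2 * \<alpha>) * (norm x)\<^sup>2"
    and DD: "\<And>s v. s \<in> {0..T} \<Longrightarrow>
        summable (\<lambda>j. (norm (blinfun_apply (D j s) v))\<^sup>2) \<and>
        (\<Sum>j. (norm (blinfun_apply (D j s) v))\<^sup>2) \<le> c * (norm v)\<^sup>2"
  shows "\<exists>!P. P \<in> Cs_nonneg T \<and> riccati_solution T S B C D Q R G P \<and>
           (\<exists>K>0. riccati_estimate T \<alpha> C P K)"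
proof -
  obtain b where b: "AE s in lebesgue_on {0..T}. norm (B s) \<le> b" using B by (auto simp: Linf_ops_def)
  obtain q where q: "AE s in lebesgue_on {0..T}. norm (Q s) \<le> q" using Q by (auto simp: Linf_ops_def)
  have "AE s in lebesgue_on {0..T}. Q s \<in> nonneg_ops" using Q by (auto simp: Linf_ops_def)
  \<comment> \<open>The maximum with 0 makes the essential bounds nonnegative without arguing that
    the interval has positive measure.\<close>
  with b q R_ge have coefficients: "AE s in lebesgue_on {0..T}. norm (B s) \<le> max b 0 \<and> Q s \<in> nonneg_ops \<and>
      norm (Q s) \<le> max q 0 \<and> R s - \<delta> *\<^sub>R id_blinfun \<in> nonneg_ops"
    by eventually_elim auto
  interpret riccati_data T S B C D Q R G \<alpha> c \<delta> "max b 0" "max q 0"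
  proof
    show "C0_semigroup S" using A by (simp add: generates_def)
    show "(\<lambda>s. B s v) \<in> borel_measurable (lebesgue_on {0..T})" for v
      using B unfolding Linf_ops_def by blast
    show "(\<lambda>s. C i s x) \<in> borel_measurable (lebesgue_on {0..T})" for i x
      using C[of i] unfolding Linf_ops_def by blast
    show "(\<lambda>s. D i s v) \<in> borel_measurable (lebesgue_on {0..T})" for i v
      using D[of i] unfolding Linf_ops_def by blast
    show "(\<lambda>s. Q s x) \<in> borel_measurable (lebesgue_on {0..T})" for x
      using Q unfolding Linf_ops_def by blast
    show "(\<lambda>s. R s v) \<in> borel_measurable (lebesgue_on {0..T})" for v
      using R unfolding Linf_ops_def by blast
  qed (fact T G \<delta> coefficients \<alpha> c SC DD | simp)+
  show ?thesis by (rule exists_unique_solution)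
qed

end
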